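(* For every integer $h\ge 1$ there is a constant $c_h$, depending only on $h$, such that the following holds. If $G\in\mathsf{rig}(G_0)$ and $G_0$ excludes the complete graph $K_h$ as a minor, then $G$ has a $\frac23$-balanced separator of size at most $c_h\sqrt{m}$, where $m$ is the number of edges in $G$. Moreover, one has the estimate $c_h\le O(h^3\sqrt{\log h})$.
   Context: All graphs are finite and undirected. A graph $G=(V,E)$ is a region intersection graph over a graph $G_0=(V_0,E_0)$ if there is a family of connected subsets $\{R_u\subseteq V_0 : u\in V\}$ of $G_0$ such that, for distinct $u,v\in V$, $\{u,v\}\in E \iff R_u\cap R_v\neq\emptyset$. The family of all finite region intersection graphs over $G_0$ is denoted $\mathsf{rig}(G_0)$. A $\frac23$-balanced separator of $G=(V,E)$ is a subset $S\subseteq V$ such that in the induced graph $G[V\setminus S]$ every connected component contains at most $\frac23|V|$ vertices; its size is $|S|$. A graph $H$ is a minor of $G_0$ if $H$ can be obtained from $G_0$ by a sequence of edge contractions, edge deletions, and vertex deletions; $G_0$ excludes $H$ as a minor if $H$ is not a minor of $G_0$.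
   Formalization: One-vertex graphs G are excluded: there m = 0 forces an empty separator, but the remaining component has 1 > 2/3 vertices, so the claim fails. Vertices of G and G_0 are natural numbers, which covers all finite graphs up to isomorphism. *)

theory Defs
  imports
    Complex_Main
    "HOL-Library.Landau_Symbols"
    "Graph_Theory.Graph_Theory"
begin

text \<open>
  Finite simple undirected graphs are the loop-free symmetric digraphs of the locale
  \<^locale>\<open>pair_graph\<close>. Each undirected edge is thus a pair of opposite arcs, and edges are
  counted as two-element vertex sets.
\<close>

definition edges :: "'a pair_pre_digraph \<Rightarrow> 'a set set" where
  "edges G = (\<lambda>(u, v). {u, v}) ` parcs G"

section \<open>Minors\<close>

definition delete_edge :: "'a pair_pre_digraph \<Rightarrow> 'a \<Rightarrow> 'a \<Rightarrow> 'a pair_pre_digraph" where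
  "delete_edge G u v = \<lparr> pverts = pverts G, parcs = parcs G - {(u, v), (v, u)} \<rparr>"

definition delete_vertex :: "'a pair_pre_digraph \<Rightarrow> 'a \<Rightarrow> 'a pair_pre_digraph" where
  "delete_vertex G v =
     \<lparr> pverts = pverts G - {v}, parcs = {(x, y) \<in> parcs G. x \<noteq> v \<and> y \<noteq> v} \<rparr>"

text \<open>
  Contraction merges \<open>v\<close> into \<open>u\<close>; the loop arising from the contracted edge is dropped and
  parallel edges are identified.
\<close>

definition contract_edge :: "'a pair_pre_digraph \<Rightarrow> 'a \<Rightarrow> 'a \<Rightarrow> 'a pair_pre_digraph" where
  "contract_edge G u v =
     (let f = (\<lambda>x. if x = v then u else x) in
      \<lparr> pverts = f ` pverts G,
        parcs = {(f x, f y) | x y. (x, y) \<in> parcs G \<and> f x \<noteq> f y} \<rparr>)"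

inductive minor_step :: "'a pair_pre_digraph \<Rightarrow> 'a pair_pre_digraph \<Rightarrow> bool" where
  contract: "(u, v) \<in> parcs G \<Longrightarrow> minor_step G (contract_edge G u v)"
| del_edge: "(u, v) \<in> parcs G \<Longrightarrow> minor_step G (delete_edge G u v)"
| del_vertex: "v \<in> pverts G \<Longrightarrow> minor_step G (delete_vertex G v)"

definition is_minor :: "'b pair_pre_digraph \<Rightarrow> 'a pair_pre_digraph \<Rightarrow> bool" where
  "is_minor H G \<longleftrightarrow>
     (\<exists>H'. minor_step\<^sup>*\<^sup>* G H' \<and> digraph_iso (with_proj H') (with_proj H))"

text \<open>
  The predicate \<^const>\<open>complete_digraph\<close> holds of every copy of the complete graph; \<^const>\<open>is_minor\<close>
  does not distinguish isomorphic copies.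
\<close>

definition excludes_complete_minor :: "nat \<Rightarrow> 'a pair_pre_digraph \<Rightarrow> bool" where
  "excludes_complete_minor h G \<longleftrightarrow>
     (\<forall>H :: nat pair_pre_digraph. complete_digraph h (with_proj H) \<longrightarrow> \<not> is_minor H G)"

section \<open>Region intersection graphs\<close>

text \<open>
  Connectedness of an induced subgraph is \<^const>\<open>Digraph_Component.connected\<close>, which includes
  nonemptiness, so every region is nonempty.
\<close>

definition rig :: "'b pair_pre_digraph \<Rightarrow> 'a pair_pre_digraph set" where
  "rig G0 = {G. pair_graph G \<and>
     (\<exists>R :: 'a \<Rightarrow> 'b set.
        (\<forall>u \<in> pverts G. R u \<subseteq> pverts G0 \<and>
           Digraph_Component.connected (with_proj G0 \<restriction> R u)) \<and>
        (\<forall>u \<in> pverts G. \<forall>v \<in> pverts G. u \<noteq> v \<longrightarrow>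
           ((u, v) \<in> parcs G \<longleftrightarrow> R u \<inter> R v \<noteq> {})))}"

section \<open>Balanced separators\<close>

text \<open>
  In a symmetric digraph the strongly connected components, given as vertex sets by
  \<^const>\<open>pre_digraph.sccs_verts\<close>, are the connected components of the undirected graph.

  A one-vertex graph has no edges, yet its only balanced separator is its whole vertex set, of
  size 1. Bounds on separator size in terms of the number of edges must exclude this graph.
\<close>

definition balanced_separator :: "'a pair_pre_digraph \<Rightarrow> 'a set \<Rightarrow> bool" where
  "balanced_separator G S \<longleftrightarrow> S \<subseteq> pverts G \<and>
     (\<forall>C \<in> pre_digraph.sccs_verts (with_proj G \<restriction> (pverts G - S)).
        real (card C) \<le> 2 / 3 * real (card (pverts G)))"

end

(*
  Weight each vertex by its degree plus one. Minimise the weighted square congestion F of a random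
  path system joining all pairs of vertices of G. If F is small, a random drawing of a complete
  graph on about h sqrt(log h) vertices along these paths has few crossings between the paths; after
  discarding crossed edges it is a dense graph that is a minor of G0, and dense graphs have K_h
  minors. So F is at least of order 1 / (h^2 log h), and the optimality condition turns the minimiser
  into vertex weights under which the average distance is at least of order
  1 / (h sqrt(log h) sqrt m) times the total weight.

  Cutting the regions h times into random annuli of width D, in the manner of Klein, Plotkin and Rao,
  removes regions of expected number at most h/D times the total weight. Excluding K_h leaves in each
  remaining cluster fewer than h points at mutual distance above a constant times h D. Taking D to be
  the average distance divided by a constant times h costs a factor h^2, and the resulting sparse
  cuts are iterated until no part is larger than two thirds of the graph.
*)
theory Submission
  imports Defs "HOL-Library.FuncSet" "HOL-Real_Asymp.Real_Asymp"
begin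

section \<open>Connectivity and clique minors\<close>

text \<open>Regions overlap in the host, so a minor of \<open>G\<close> need not be a minor of
  \<open>G0\<close>: many regions through one point make a clique over a tree. Vertex sets of
  \<open>G\<close> yield disjoint connected sets of the host only if no region of one meets a region
  of the other. A conflict between two paths is therefore a touching pair of vertices rather than a
  common vertex. If a random path contains \<open>x\<close> with probability p(x), the probability
  of a conflict is at most the sum of deg(x) p(x)^2, where deg counts \<open>x\<close> itself. This
  dictates the degree weights, and it is how edges enter: the weights deg(x) p(x) obtained from
  optimality are summed by Cauchy-Schwarz against the total degree, which is of order
  \<open>m\<close>.

  The factor h^3 is paid once, when cutting along the clusters is itself balanced. Every other round
  makes a cut whose cost is proportional, with a factor h^2, to the number of vertices it removes.
  These costs add up to the same order as a single cut, so the iteration loses no logarithm. The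
  root of log h is the group size s needed in dense graphs, where s^2 must reach log_2 (2h).\<close>

definition reach :: "('v \<Rightarrow> 'v \<Rightarrow> bool) \<Rightarrow> 'v set \<Rightarrow> 'v \<Rightarrow> 'v \<Rightarrow> bool" where
  "reach E A = (\<lambda>x y. E x y \<and> x \<in> A \<and> y \<in> A)\<^sup>*\<^sup>*"

text \<open>Holds of the empty set as well, so \<open>clique_model\<close> and
  \<open>minor_model\<close> ask for nonempty sets separately.\<close>

definition conn :: "('v \<Rightarrow> 'v \<Rightarrow> bool) \<Rightarrow> 'v set \<Rightarrow> bool" where
  "conn E A \<longleftrightarrow> (\<forall>x\<in>A. \<forall>y\<in>A. reach E A x y)"

text \<open>Always contains \<open>x\<close>; for \<open>x\<close> outside \<open>A\<close> it is
  just \<open>{x}\<close>.\<close>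

definition comp :: "('v \<Rightarrow> 'v \<Rightarrow> bool) \<Rightarrow> 'v set \<Rightarrow> 'v \<Rightarrow> 'v set" where
  "comp E A x = {y. reach E A x y}"

lemma reach_refl [simp]: "reach E A x x"
  by (simp add: reach_def)

lemma reach_trans [trans]: "reach E A x y \<Longrightarrow> reach E A y z \<Longrightarrow> reach E A x z"
  unfolding reach_def by (rule rtranclp_trans)

lemma reach_edge: "E x y \<Longrightarrow> x \<in> A \<Longrightarrow> y \<in> A \<Longrightarrow> reach E A x y"
  unfolding reach_def by blast

lemma reach_induct [consumes 1, case_names base step]:
  assumes "reach E A x y" "P x"
    and "\<And>u v. reach E A x u \<Longrightarrow> P u \<Longrightarrow> E u v \<Longrightarrow> u \<in> A \<Longrightarrow> v \<in> A \<Longrightarrow> P v"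
  shows "P y"
  using assms(1) unfolding reach_def
proof (induction rule: rtranclp_induct)
  case base
  show ?case by (rule assms(2))
next
  case (step u v)
  then show ?case using assms(3)[of u v] unfolding reach_def by blast
qed

lemma reach_mono: "reach E A x y \<Longrightarrow> A \<subseteq> B \<Longrightarrow> reach E B x y"
  by (induction rule: reach_induct) (auto intro: reach_trans reach_edge)

lemma reach_in: "reach E A x y \<Longrightarrow> x \<in> A \<Longrightarrow> y \<in> A"
  by (induction rule: reach_induct) auto

lemma reach_sym: "reach E A x y \<Longrightarrow> symp E \<Longrightarrow> reach E A y x"
proof (induction rule: reach_induct)
  case (step u v)
  then have "reach E A v u" by (auto intro: reach_edge dest: sympD)
  then show ?case using step by (blast intro: reach_trans)
qed simp

lemma reach_rel_mono:
  assumes "reach E A x y" and "\<And>u v. u \<in> A \<Longrightarrow> v \<in> A \<Longrightarrow> E u v \<Longrightarrow> E' u v"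
  shows "reach E' A x y"
  using assms(1) by (induction rule: reach_induct) (auto intro: assms(2) reach_trans reach_edge)

text \<open>By induction along the walk: either it has stayed in \<open>T\<close> so far, or a first
  edge out of \<open>T\<close> has been recorded. Such an edge later links a maximal connected set
  to whatever stops its growth.\<close>

lemma reach_first_exit:
  assumes "reach E A x y" "x \<in> A" "x \<in> T" "y \<notin> T"
  obtains u v where "u \<in> A \<inter> T" "v \<in> A - T" "E u v" "reach E (A \<inter> T) x u"
proof -
  have "reach E (A \<inter> T) x y \<or> (\<exists>u v. u \<in> A \<inter> T \<and> v \<in> A - T \<and> E u v \<and> reach E (A \<inter> T) x u)"
    using assms(1)
  proof (induction rule: reach_induct)
    case base
    show ?case by simp
  next
    case (step u v)
    show ?case
    proof (cases "reach E (A \<inter> T) x u")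
      case True
      with assms(2,3) have "u \<in> A \<inter> T" by (auto dest: reach_in)
      with True step.hyps show ?thesis
        by (cases "v \<in> T") (blast intro: reach_trans reach_edge)+
    next
      case False
      with step show ?thesis by blast
    qed
  qed
  with assms that show thesis by (meson IntI IntD2 reach_in)
qed

lemma connD: "conn E A \<Longrightarrow> x \<in> A \<Longrightarrow> y \<in> A \<Longrightarrow> reach E A x y"
  by (simp add: conn_def)

lemma connI_from:
  assumes "symp E" "\<And>y. y \<in> A \<Longrightarrow> reach E A x y"
  shows "conn E A"
  unfolding conn_def using assms by (meson reach_sym reach_trans)

lemma conn_singleton [simp]: "conn E {x}"
  by (simp add: conn_def)

lemma conn_Un:
  assumes "symp E" "conn E A" "conn E B" "a \<in> A" "b \<in> B" "a = b \<or> E a b"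
  shows "conn E (A \<union> B)"
proof (rule connI_from[where x = a])
  fix y assume y: "y \<in> A \<union> B"
  have ab: "reach E (A \<union> B) a b"
    using assms by (auto intro: reach_edge)
  show "reach E (A \<union> B) a y"
  proof (cases "y \<in> A")
    case True
    then show ?thesis using assms by (meson connD reach_mono sup_ge1)
  next
    case False
    with y have "reach E (A \<union> B) b y" using assms by (meson UnE connD reach_mono sup_ge2)
    with ab show ?thesis by (rule reach_trans)
  qed
qed (rule assms)

lemma conn_UN:
  assumes "symp E" "conn E C" "c \<in> C"
    and "\<And>i. i \<in> I \<Longrightarrow> conn E (B i)" "\<And>i. i \<in> I \<Longrightarrow> C \<inter> B i \<noteq> {}"
  shows "conn E (C \<union> (\<Union>i\<in>I. B i))"
proof (rule connI_from[where x = c])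
  fix y assume y: "y \<in> C \<union> (\<Union>i\<in>I. B i)"
  show "reach E (C \<union> (\<Union>i\<in>I. B i)) c y"
  proof (cases "y \<in> C")
    case True
    then show ?thesis using assms(2,3) by (meson connD reach_mono sup_ge1)
  next
    case False
    with y obtain i z where i: "i \<in> I" "y \<in> B i" "z \<in> C" "z \<in> B i" using assms(5) by blast
    have "reach E (C \<union> (\<Union>i\<in>I. B i)) c z"
      using assms(2,3) i by (meson connD reach_mono sup_ge1)
    moreover have "reach E (B i) z y" using assms(4) i by (meson connD)
    then have "reach E (C \<union> (\<Union>i\<in>I. B i)) z y" by (rule reach_mono) (use i in blast)
    ultimately show ?thesis by (rule reach_trans)
  qed
qed (rule assms)

lemma reach_comp:
  assumes "reach E A x y"
  shows "reach E (comp E A x) x y"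
  using assms
proof (induction rule: reach_induct)
  case (step u v)
  then have "u \<in> comp E A x" "v \<in> comp E A x"
    by (auto simp: comp_def intro: reach_trans reach_edge)
  with step show ?case by (blast intro: reach_trans reach_edge)
qed simp

lemma conn_comp: "symp E \<Longrightarrow> conn E (comp E A x)"
  by (rule connI_from[where x = x]) (auto simp: comp_def dest: reach_comp[unfolded comp_def])

lemma comp_self [simp]: "x \<in> comp E A x"
  by (simp add: comp_def)

lemma comp_subset: "x \<in> A \<Longrightarrow> comp E A x \<subseteq> A"
  by (auto simp: comp_def dest: reach_in)

lemma comp_eq: "symp E \<Longrightarrow> y \<in> comp E A x \<Longrightarrow> comp E A y = comp E A x"
  by (auto simp: comp_def intro: reach_trans reach_sym)

lemma conn_subset_comp: "conn E B \<Longrightarrow> x \<in> B \<Longrightarrow> B \<subseteq> A \<Longrightarrow> B \<subseteq> comp E A x"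
  by (auto simp: comp_def dest: connD intro: reach_mono)

lemma conn_rel_mono:
  assumes "conn E A" and "\<And>u v. u \<in> A \<Longrightarrow> v \<in> A \<Longrightarrow> E u v \<Longrightarrow> E' u v"
  shows "conn E' A"
  using assms unfolding conn_def by (blast intro: reach_rel_mono)

definition clique_model :: "('v \<Rightarrow> 'v \<Rightarrow> bool) \<Rightarrow> 'v set \<Rightarrow> nat \<Rightarrow> (nat \<Rightarrow> 'v set) \<Rightarrow> bool" where
  "clique_model E V h M \<longleftrightarrow>
     (\<forall>i<h. M i \<noteq> {} \<and> M i \<subseteq> V \<and> conn E (M i)) \<and>
     (\<forall>i<h. \<forall>j<i. M i \<inter> M j = {} \<and> (\<exists>x\<in>M i. \<exists>y\<in>M j. E x y))"

lemma clique_modelI: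
  assumes "\<And>i. i < h \<Longrightarrow> M i \<noteq> {}" "\<And>i. i < h \<Longrightarrow> M i \<subseteq> V" "\<And>i. i < h \<Longrightarrow> conn E (M i)"
    and "\<And>i j. j < i \<Longrightarrow> i < h \<Longrightarrow> M i \<inter> M j = {}"
    and "\<And>i j. j < i \<Longrightarrow> i < h \<Longrightarrow> \<exists>x\<in>M i. \<exists>y\<in>M j. E x y"
  shows "clique_model E V h M"
  using assms by (auto simp: clique_model_def)

lemma clique_model_disjoint:
  assumes M: "clique_model E V h M" and "j < h" "k < h" "j \<noteq> k"
  shows "M j \<inter> M k = {}"
proof -
  consider "j < k" | "k < j" using assms(4) by linarith
  then show ?thesis
  proof cases
    case 1
    then have "M k \<inter> M j = {}" using assms by (simp add: clique_model_def)
    then show ?thesis by (simp add: Int_commute)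
  next
    case 2
    then show ?thesis using assms by (simp add: clique_model_def)
  qed
qed

section \<open>From clique models to sequences of minor steps\<close>

abbreviation arc_rel :: "'a pair_pre_digraph \<Rightarrow> 'a \<Rightarrow> 'a \<Rightarrow> bool" where
  "arc_rel G \<equiv> \<lambda>x y. (x, y) \<in> parcs G"

lemma delete_vertex_simps [simp]:
  "pverts (delete_vertex G v) = pverts G - {v}"
  "(x, y) \<in> parcs (delete_vertex G v) \<longleftrightarrow> (x, y) \<in> parcs G \<and> x \<noteq> v \<and> y \<noteq> v"
  by (auto simp: delete_vertex_def)

lemma contract_edge_simps:
  assumes "u \<in> pverts G" "u \<noteq> v"
  shows "pverts (contract_edge G u v) = pverts G - {v}"
    "(x, y) \<in> parcs (contract_edge G u v) \<longleftrightarrow>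
       (\<exists>x' y'. (x', y') \<in> parcs G \<and> x = (if x' = v then u else x') \<and>
          y = (if y' = v then u else y') \<and> x \<noteq> y)"
  using assms by (auto simp: contract_edge_def Let_def)

lemma reach_contract_edge:
  assumes "u \<in> pverts G" "u \<noteq> v" "u \<in> A" "reach (arc_rel G) A x y"
  shows "reach (arc_rel (contract_edge G u v)) (A - {v})
           (if x = v then u else x) (if y = v then u else y)"
  using assms(4)
proof (induction rule: reach_induct)
  case (step a b)
  let ?f = "\<lambda>x. if x = v then u else x"
  have "reach (arc_rel (contract_edge G u v)) (A - {v}) (?f a) (?f b)"
  proof (cases "?f a = ?f b")
    case False
    have "(?f a, ?f b) \<in> parcs (contract_edge G u v)"
      unfolding contract_edge_simps(2)[OF assms(1,2)] using step False by blast
    then show ?thesis using step assms by (intro reach_edge) auto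
  qed simp
  then show ?case using step by (blast intro: reach_trans)
qed simp

text \<open>Both ends lie in \<open>M i\<close>, so only that branch set loses a point. Arcs and
  walks are carried along by the map that sends \<open>v\<close> to \<open>u\<close>.\<close>

lemma clique_model_contract_edge:
  assumes M: "clique_model (arc_rel G) (pverts G) h M" and "i < h"
    and uv: "u \<in> M i" "v \<in> M i" "u \<noteq> v"
  shows "clique_model (arc_rel (contract_edge G u v)) (pverts G - {v}) h (\<lambda>j. M j - {v})"
proof -
  have uG: "u \<in> pverts G" using M uv \<open>i < h\<close> by (auto simp: clique_model_def)
  note disj = clique_model_disjoint[OF M]
  have nv: "M j - {v} = M j" if "j < h" "j \<noteq> i" for j
    using disj[OF that(1) \<open>i < h\<close> that(2)] uv by auto
  show ?thesis
  proof (rule clique_modelI)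
    fix j assume j: "j < h"
    with M have Mj: "M j \<noteq> {}" "M j \<subseteq> pverts G" "conn (arc_rel G) (M j)"
      by (simp_all add: clique_model_def)
    show "M j - {v} \<noteq> {}"
      using Mj(1) uv nv[OF j] by (cases "j = i") blast+
    show "M j - {v} \<subseteq> pverts G - {v}" using Mj(2) by blast
    show "conn (arc_rel (contract_edge G u v)) (M j - {v})"
      unfolding conn_def
    proof (intro ballI)
      fix x y assume xy: "x \<in> M j - {v}" "y \<in> M j - {v}"
      have r: "reach (arc_rel G) (M j) x y" using Mj(3) xy by (simp add: conn_def)
      show "reach (arc_rel (contract_edge G u v)) (M j - {v}) x y"
      proof (cases "j = i")
        case True
        then show ?thesis using reach_contract_edge[OF uG uv(3) _ r] uv xy by auto
      next
        case False
        have e: "(a, b) \<in> parcs (contract_edge G u v)" if "(a, b) \<in> parcs G" "a \<in> M j" "b \<in> M j" "a \<noteq> b" for a b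
        proof -
          have "a \<noteq> v" "b \<noteq> v" using nv[OF j False] that by blast+
          then show ?thesis unfolding contract_edge_simps(2)[OF uG uv(3)]
            using that by (intro exI[of _ a] exI[of _ b]) simp
        qed
        from r have "reach (arc_rel (contract_edge G u v)) (M j) x y"
        proof (induction rule: reach_induct)
          case (step a b)
          show ?case
          proof (cases "a = b")
            case True
            with step.IH show ?thesis by simp
          next
            case False
            with step e have "(a, b) \<in> parcs (contract_edge G u v)" by blast
            with step show ?thesis
              by (blast intro: reach_trans reach_edge)
          qed
        qed simp
        then show ?thesis using nv[OF j False] by simp
      qed
    qed
  next
    fix j k assume jk: "k < j" "j < h"
    then show "(M j - {v}) \<inter> (M k - {v}) = {}" using disj[of j k] by auto
    obtain x y where xy: "x \<in> M j" "y \<in> M k" "(x, y) \<in> parcs G"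
      using M jk unfolding clique_model_def by blast
    let ?f = "\<lambda>x. if x = v then u else x"
    have "?f x \<in> M j - {v}" using xy uv nv[of j] jk by (cases "j = i") auto
    moreover have "?f y \<in> M k - {v}" using xy uv nv[of k] jk by (cases "k = i") auto
    moreover have "?f x \<noteq> ?f y" using calculation disj[of j k] jk by auto
    then have "(?f x, ?f y) \<in> parcs (contract_edge G u v)"
      unfolding contract_edge_simps(2)[OF uG uv(3)]
      using xy(3) by (intro exI[of _ x] exI[of _ y]) simp
    ultimately show "\<exists>x\<in>M j - {v}. \<exists>y\<in>M k - {v}. (x, y) \<in> parcs (contract_edge G u v)" by blast
  qed
qed

text \<open>Induction on the number of vertices: a vertex outside all branch sets is deleted, an arc
  inside a branch set is contracted. If neither exists, connectedness makes the branch sets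
  singletons, they exhaust the vertices, and pairwise adjacency makes the graph complete.\<close>

lemma clique_model_imp_minor_steps:
  assumes "finite (pverts G)" "clique_model (arc_rel G) (pverts G) h M"
    and "\<forall>(x, y) \<in> parcs G. (y, x) \<in> parcs G \<and> x \<noteq> y \<and> x \<in> pverts G"
  shows "\<exists>H. minor_step\<^sup>*\<^sup>* G H \<and> complete_digraph h (with_proj H)"
  using assms
proof (induction "card (pverts G)" arbitrary: G M rule: less_induct)
  case less
  note M = less.prems(2)
  note G = less.prems(3)
  note disj = clique_model_disjoint[OF M]
  have adj: "\<exists>x\<in>M j. \<exists>y\<in>M k. (x, y) \<in> parcs G" if "j < h" "k < h" "j \<noteq> k" for j k
  proof (cases "k < j")
    case True
    then show ?thesis using M that by (auto simp: clique_model_def)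
  next
    case False
    with that have "j < k" by simp
    with M that have "\<exists>x\<in>M k. \<exists>y\<in>M j. (x, y) \<in> parcs G"
      by (simp add: clique_model_def)
    then show ?thesis using G by blast
  qed
  consider (del) v where "v \<in> pverts G" "\<forall>i<h. v \<notin> M i"
    | (con) i a b where "i < h" "a \<in> M i" "b \<in> M i" "a \<noteq> b" "(a, b) \<in> parcs G"
    | (fin) "pverts G = (\<Union>i<h. M i)" "\<forall>i<h. \<forall>a\<in>M i. \<forall>b\<in>M i. a = b"
  proof -
    have edge: "\<exists>a b. a \<in> M i \<and> b \<in> M i \<and> a \<noteq> b \<and> (a, b) \<in> parcs G"
      if "i < h" "a \<in> M i" "b \<in> M i" "a \<noteq> b" for i a b
    proof -
      have r: "reach (arc_rel G) (M i) a b" using M that by (auto simp: clique_model_def conn_def)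
      have b: "b \<notin> {a}" using that by simp
      show ?thesis by (rule reach_first_exit[OF r that(2) singletonI b]) blast
    qed
    have sub: "(\<Union>i<h. M i) \<subseteq> pverts G" using M by (auto simp: clique_model_def)
    show thesis
    proof (cases "pverts G \<subseteq> (\<Union>i<h. M i)")
      case False
      then obtain v where "v \<in> pverts G" "v \<notin> (\<Union>i<h. M i)" by blast
      then show thesis by (intro that(1)) auto
    next
      case True
      show thesis
      proof (cases "\<forall>i<h. \<forall>a\<in>M i. \<forall>b\<in>M i. a = b")
        case all: True
        show thesis by (rule that(3)[OF equalityI[OF True sub] all])
      next
        case False
        then obtain i a b where "i < h" "a \<in> M i" "b \<in> M i" "a \<noteq> b" by blast
        from edge[OF this] obtain a' b' where "a' \<in> M i" "b' \<in> M i" "a' \<noteq> b'" "(a', b') \<in> parcs G"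
          by (elim exE conjE)
        with \<open>i < h\<close> show thesis by (rule that(2))
      qed
    qed
  qed
  then show ?case
  proof cases
    case del
    have "clique_model (arc_rel (delete_vertex G v)) (pverts (delete_vertex G v)) h M"
    proof (rule clique_modelI)
      fix i assume i: "i < h"
      with M del show "M i \<noteq> {}" "M i \<subseteq> pverts (delete_vertex G v)"
        by (auto simp: clique_model_def)
      have "conn (arc_rel G) (M i)" using M i by (auto simp: clique_model_def)
      then show "conn (arc_rel (delete_vertex G v)) (M i)"
        by (rule conn_rel_mono) (use del i in auto)
    next
      fix i j assume ij: "j < i" "i < h"
      with M show "M i \<inter> M j = {}" by (auto simp: clique_model_def)
      obtain x y where "x \<in> M i" "y \<in> M j" "(x, y) \<in> parcs G"
        using M ij unfolding clique_model_def by blast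
      moreover have "x \<noteq> v" "y \<noteq> v" using del ij calculation by auto
      ultimately show "\<exists>x\<in>M i. \<exists>y\<in>M j. (x, y) \<in> parcs (delete_vertex G v)" by auto
    qed
    moreover have "card (pverts (delete_vertex G v)) < card (pverts G)"
      using card_Diff1_less[OF less.prems(1) del(1)] by simp
    moreover have "\<forall>(x, y) \<in> parcs (delete_vertex G v).
        (y, x) \<in> parcs (delete_vertex G v) \<and> x \<noteq> y \<and> x \<in> pverts (delete_vertex G v)"
      using G by auto
    ultimately obtain H where "minor_step\<^sup>*\<^sup>* (delete_vertex G v) H" "complete_digraph h (with_proj H)"
      using less.hyps[of "delete_vertex G v" M] less.prems(1) by auto
    then show ?thesis using minor_step.del_vertex[OF del(1)]
      by (meson converse_rtranclp_into_rtranclp)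
  next
    case con
    let ?G = "contract_edge G a b"
    have aG: "a \<in> pverts G" and bG: "b \<in> pverts G" using G con by auto
    note sm = contract_edge_simps[OF aG con(4)]
    have "clique_model (arc_rel ?G) (pverts ?G) h (\<lambda>j. M j - {b})"
      unfolding sm(1) using clique_model_contract_edge[OF M con(1-4)] .
    moreover have "card (pverts ?G) < card (pverts G)"
      using card_Diff1_less[OF less.prems(1) bG] by (simp add: sm)
    moreover have "\<forall>(x, y) \<in> parcs ?G. (y, x) \<in> parcs ?G \<and> x \<noteq> y \<and> x \<in> pverts ?G"
    proof (clarsimp simp only: split_paired_all)
      fix x y assume "(x, y) \<in> parcs ?G"
      then obtain x' y' where xy: "(x', y') \<in> parcs G" "x = (if x' = b then a else x')"
          "y = (if y' = b then a else y')" "x \<noteq> y"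
        unfolding sm(2) by blast
      then have "(y', x') \<in> parcs G" "x' \<in> pverts G" using G by auto
      then show "(y, x) \<in> parcs ?G \<and> x \<noteq> y \<and> x \<in> pverts ?G"
        unfolding sm using xy aG con(4) by (metis Diff_iff singletonD)
    qed
    ultimately obtain H where "minor_step\<^sup>*\<^sup>* ?G H" "complete_digraph h (with_proj H)"
      using less.hyps[of ?G "\<lambda>j. M j - {b}"] less.prems(1) sm(1) by auto
    then show ?thesis using minor_step.contract[OF con(5)]
      by (meson converse_rtranclp_into_rtranclp)
  next
    case fin
    have "\<exists>m. \<forall>i<h. M i = {m i}"
    proof -
      have "\<forall>i<h. \<exists>m. M i = {m}" using M fin(2) unfolding clique_model_def by blast
      then show ?thesis by metis
    qed
    then obtain m where m: "\<And>i. i < h \<Longrightarrow> M i = {m i}" by blast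
    have inj: "inj_on m {..<h}"
    proof (rule inj_onI)
      fix i j assume "i \<in> {..<h}" "j \<in> {..<h}" "m i = m j"
      then show "i = j" using disj[of i j] m by auto
    qed
    have V: "pverts G = m ` {..<h}" using fin(1) m by auto
    then have "card (pverts G) = h" using inj by (simp add: card_image)
    moreover have "parcs G = {(u, v). (u, v) \<in> pverts G \<times> pverts G \<and> u \<noteq> v}"
    proof (intro equalityI subsetI; clarsimp)
      fix x y assume "(x, y) \<in> parcs G"
      then show "x \<in> pverts G \<and> y \<in> pverts G \<and> x \<noteq> y" using G by blast
    next
      fix x y assume "x \<in> pverts G" "y \<in> pverts G" "x \<noteq> y"
      then obtain i j where "i < h" "j < h" "x = m i" "y = m j" "i \<noteq> j" unfolding V by auto
      then show "(x, y) \<in> parcs G" using adj[of i j] m by auto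
    qed
    ultimately have "complete_digraph h (with_proj G)"
      using less.prems(1) by (auto simp: complete_digraph_pair_def)
    then show ?thesis by blast
  qed
qed

text \<open>The vertex type is \<open>nat\<close> because \<open>excludes_complete_minor\<close>
  quantifies over complete graphs on \<open>nat\<close>; the graph reached by minor steps can then
  serve as its own isomorphic copy.\<close>

lemma excludes_complete_minor_no_model:
  fixes G :: "nat pair_pre_digraph"
  assumes "pair_graph G" "excludes_complete_minor h G"
  shows "\<not> clique_model (arc_rel G) (pverts G) h M"
proof
  assume M: "clique_model (arc_rel G) (pverts G) h M"
  interpret pair_graph G by fact
  have "\<forall>(x, y) \<in> parcs G. (y, x) \<in> parcs G \<and> x \<noteq> y \<and> x \<in> pverts G"
  proof (clarify)
    fix x y assume xy: "(x, y) \<in> parcs G"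
    have "(y, x) \<in> parcs G" using pair_sym_arcs xy by (simp add: symmetric_def symD)
    moreover have "x \<noteq> y" using pair_no_loops[OF xy] by simp
    moreover have "x \<in> pverts G" using xy by (rule in_arcsD1)
    ultimately show "(y, x) \<in> parcs G \<and> x \<noteq> y \<and> x \<in> pverts G" by simp
  qed
  then obtain H where H: "minor_step\<^sup>*\<^sup>* G H" "complete_digraph h (with_proj H)"
    using clique_model_imp_minor_steps[OF pair_finite_verts M] by blast
  interpret H: pair_graph H using H(2) by (rule pair_graphI_complete)
  let ?f = "\<lparr>iso_verts = id, iso_arcs = id, iso_head = snd, iso_tail = fst\<rparr>"
  have "pre_digraph.digraph_isomorphism (with_proj H) ?f"
    by (auto simp: pre_digraph.digraph_isomorphism_def H.wf_digraph)
  moreover have "with_proj H = app_iso ?f (with_proj H)"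
    by (simp add: app_iso_def with_proj_def)
  ultimately have "is_minor H G"
    unfolding is_minor_def digraph_iso_def using H(1) by blast
  with H(2) assms(2) show False by (auto simp: excludes_complete_minor_def)
qed

section \<open>Clique minors of dense graphs\<close>

lemma card_filter_eq_sum: "finite A \<Longrightarrow> card {x \<in> A. P x} = (\<Sum>x\<in>A. of_bool (P x))"
  by (simp add: of_bool_def flip: sum.inter_filter)

text \<open>
  A random \<open>s\<close>-tuple of free vertices has at most \<open>4\<^sup>-\<^sup>s |N|\<close> common non-neighbours except with
  probability below \<open>1/4\<close>. This makes a later tuple miss an earlier group with probability at most
  \<open>2\<^sup>-\<^sup>s\<^sup>2\<close>, so groups of size about \<open>\<surd>log h\<close> suffice; \<open>Z i\<close> stands for the common non-neighbours
  of the \<open>i\<close>-th earlier group.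
\<close>

lemma dense_group_step:
  fixes gd :: "'i \<Rightarrow> 'i \<Rightarrow> bool" and k s :: nat
  assumes fin: "finite N" and sym: "symp gd" and "N \<noteq> {}"
    and nb: "\<And>x. x \<in> N \<Longrightarrow> 32 * card {y \<in> N. \<not> gd x y} \<le> card N"
    and s: "s \<ge> 1" and k: "2 * k \<le> 2 ^ (s\<^sup>2)"
    and U: "U \<subseteq> N" "4 * card U \<le> card N"
    and Z: "\<And>i. i < k \<Longrightarrow> finite (Z i) \<and> card (Z i) * 4 ^ s \<le> card N"
  shows "\<exists>A. A \<noteq> {} \<and> A \<subseteq> N - U \<and> conn gd A \<and> card A \<le> 2 * s \<and>
            card {b \<in> N. \<forall>a\<in>A. \<not> gd a b} * 4 ^ s \<le> card N \<and> (\<forall>i<k. \<not> A \<subseteq> Z i)"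
proof -
  define m q where "m = real (card N)" and "q = real (card (N - U))"
  have m0: "m > 0" using fin \<open>N \<noteq> {}\<close> by (simp add: m_def card_gt_0_iff)
  have finQ: "finite (N - U)" using fin by simp
  have "card (N - U) = card N - card U" using U fin by (meson card_Diff_subset finite_subset)
  then have mq: "m \<le> 2 * q" using U(2) by (simp add: m_def q_def)
  then have q0: "q > 0" using m0 by simp
  define T where "T = {..<s} \<rightarrow>\<^sub>E (N - U)"
  have finT: "finite T" unfolding T_def using finQ by (intro finite_PiE) auto
  have cT: "real (card T) = q ^ s" by (simp add: T_def card_PiE q_def)
  define F where "F t = {b \<in> N. \<forall>l<s. \<not> gd (t l) b}" for t
  define B1 where "B1 = {t \<in> T. m < card (F t) * 4 ^ s}"
  define B2 where "B2 i = {..<s} \<rightarrow>\<^sub>E (Z i \<inter> (N - U))" for i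
  have TPi: "{t \<in> T. \<forall>l<s. \<not> gd (t l) b} = {..<s} \<rightarrow>\<^sub>E {x \<in> N - U. \<not> gd x b}" for b
    unfolding T_def by (intro set_eqI) (simp add: PiE_iff, blast)
  \<comment> \<open>Double counting of pairs of a tuple \<open>t\<close> and a vertex of
    \<open>F t\<close>. With the bound \<open>small\<close>, Markov's inequality then limits
    \<open>B1\<close> to a quarter of all tuples.\<close>
  have "(\<Sum>t\<in>T. card (F t)) = (\<Sum>t\<in>T. \<Sum>b\<in>N. of_bool (\<forall>l<s. \<not> gd (t l) b))"
    unfolding F_def by (simp only: card_filter_eq_sum[OF fin])
  also have "\<dots> = (\<Sum>b\<in>N. \<Sum>t\<in>T. of_bool (\<forall>l<s. \<not> gd (t l) b))"
    by (rule sum.swap)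
  also have "\<dots> = (\<Sum>b\<in>N. card {t \<in> T. \<forall>l<s. \<not> gd (t l) b})"
    by (intro sum.cong refl card_filter_eq_sum[OF finT, symmetric])
  also have "\<dots> = (\<Sum>b\<in>N. card ({..<s} \<rightarrow>\<^sub>E {x \<in> N - U. \<not> gd x b}))"
    by (simp only: TPi)
  also have "\<dots> = (\<Sum>b\<in>N. card {x \<in> N - U. \<not> gd x b} ^ s)"
    by (simp add: card_PiE)
  finally have sumF: "(\<Sum>t\<in>T. card (F t)) = (\<Sum>b\<in>N. card {x \<in> N - U. \<not> gd x b} ^ s)" .
  have small: "real (card {x \<in> N - U. \<not> gd x b}) \<le> m / 32" if "b \<in> N" for b
  proof -
    have "card {x \<in> N - U. \<not> gd x b} \<le> card {y \<in> N. \<not> gd b y}"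
      using fin sym by (intro card_mono) (auto dest: sympD)
    with nb[OF that] have "32 * card {x \<in> N - U. \<not> gd x b} \<le> card N" by linarith
    then have "real (32 * card {x \<in> N - U. \<not> gd x b}) \<le> real (card N)" by (rule of_nat_mono)
    then show ?thesis by (simp add: m_def)
  qed
  have "real (\<Sum>b\<in>N. card {x \<in> N - U. \<not> gd x b} ^ s) \<le> (\<Sum>b\<in>N. (m / 32) ^ s)"
    unfolding of_nat_sum of_nat_power by (intro sum_mono power_mono small) auto
  also have "\<dots> = m * (m / 32) ^ s" by (simp add: m_def)
  finally have le: "real (\<Sum>t\<in>T. card (F t)) \<le> m * (m / 32) ^ s" using sumF by simp
  have "card B1 * (m / 4 ^ s) = (\<Sum>t\<in>B1. m / 4 ^ s)" by simp
  also have "\<dots> \<le> (\<Sum>t\<in>B1. real (card (F t)))"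
    by (intro sum_mono) (auto simp: B1_def field_simps)
  also have "\<dots> \<le> (\<Sum>t\<in>T. real (card (F t)))"
    using finT by (intro sum_mono2) (auto simp: B1_def)
  also have "\<dots> \<le> m * (m / 32) ^ s" using le by simp
  finally have "card B1 * (m / 4 ^ s) * (4 ^ s / m) \<le> m * (m / 32) ^ s * (4 ^ s / m)"
    using m0 by (intro mult_right_mono) auto
  then have "card B1 \<le> (m / 32) ^ s * 4 ^ s" using m0 by simp
  also have "\<dots> = (m / 8) ^ s" by (simp flip: power_mult_distrib)
  also have "\<dots> \<le> (q / 4) ^ s" using mq m0 by (intro power_mono) auto
  also have "\<dots> = q ^ s / 4 ^ s" by (rule power_divide)
  also have "\<dots> \<le> q ^ s / 4"
  proof -
    have "(4::real) ^ 1 \<le> 4 ^ s" using s by (intro power_increasing) auto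
    then show ?thesis using q0 by (intro divide_left_mono) auto
  qed
  finally have B1: "card B1 \<le> q ^ s / 4" .
  have p4: "((4::real) ^ s) ^ s = 2 ^ s\<^sup>2 * 2 ^ s\<^sup>2"
  proof -
    have "((4::real) ^ s) ^ s = (2 * 2) ^ (s * s)" unfolding power_mult by simp
    then show ?thesis by (simp only: power_mult_distrib power2_eq_square)
  qed
  \<comment> \<open>Each coordinate falls into \<open>Z i\<close> with probability at most
    \<open>2 / 4 ^ s\<close>, hence all \<open>s\<close> of them with probability at most 2 to the
    power s - 2 s^2, which is at most 2 to the power -s^2.\<close>
  have B2: "card (B2 i) \<le> q ^ s / 2 ^ s\<^sup>2" if "i < k" for i
  proof -
    have "card (Z i \<inter> (N - U)) \<le> card (Z i)" using Z[OF that] by (intro card_mono) auto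
    then have "card (Z i \<inter> (N - U)) * 4 ^ s \<le> card N" using Z[OF that] by (meson le_trans mult_le_mono1)
    then have "real (card (Z i \<inter> (N - U)) * 4 ^ s) \<le> real (card N)" by (rule of_nat_mono)
    then have "real (card (Z i \<inter> (N - U))) \<le> m / 4 ^ s" by (simp add: m_def field_simps)
    also have "\<dots> \<le> (2 * q) / 4 ^ s" using mq by (intro divide_right_mono) auto
    finally have "real (card (Z i \<inter> (N - U))) ^ s \<le> ((2 * q) / 4 ^ s) ^ s"
      by (intro power_mono) auto
    also have "\<dots> = q ^ s * (2 ^ s / (2 ^ s\<^sup>2 * 2 ^ s\<^sup>2))"
      unfolding power_divide p4 by (simp add: power_mult_distrib)
    also have "\<dots> \<le> q ^ s * (1 / 2 ^ s\<^sup>2)"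
    proof -
      have "(2::real) ^ s \<le> 2 ^ s\<^sup>2" using s by (intro power_increasing) (auto simp: power2_eq_square)
      then have "2 ^ s / (2 ^ s\<^sup>2 * 2 ^ s\<^sup>2) \<le> 2 ^ s\<^sup>2 / (2 ^ s\<^sup>2 * (2::real) ^ s\<^sup>2)"
        by (intro divide_right_mono) auto
      then show ?thesis using q0 by (intro mult_left_mono) auto
    qed
    finally show ?thesis by (simp add: B2_def card_PiE)
  qed
  have finB2: "finite (B2 i)" for i unfolding B2_def using finQ by (intro finite_PiE) auto
  \<comment> \<open>Union bound: \<open>B1\<close> takes at most 1/4 of the tuples and, by the bound
    on \<open>k\<close>, the sets \<open>B2 i\<close> together at most 1/2.\<close>
  have "card (B1 \<union> (\<Union>i<k. B2 i)) \<le> card B1 + (\<Sum>i<k. card (B2 i))"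
    using card_Un_le[of B1 "\<Union>i<k. B2 i"] card_UN_le[of "{..<k}" B2, OF finite_lessThan] by linarith
  then have "real (card (B1 \<union> (\<Union>i<k. B2 i))) \<le> real (card B1) + (\<Sum>i<k. real (card (B2 i)))"
    by (simp flip: of_nat_sum of_nat_add)
  also have "\<dots> \<le> q ^ s / 4 + (\<Sum>i<k. q ^ s / 2 ^ s\<^sup>2)"
    using B1 B2 by (intro add_mono sum_mono) auto
  also have "\<dots> = q ^ s / 4 + q ^ s * (k / 2 ^ s\<^sup>2)" by simp
  also have "\<dots> \<le> q ^ s / 4 + q ^ s * (1 / 2)"
  proof -
    have "real (2 * k) \<le> real (2 ^ s\<^sup>2)" using k by (rule of_nat_mono)
    then have "real k / 2 ^ s\<^sup>2 \<le> 1 / 2" by (simp add: field_simps)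
    then show ?thesis using q0 by (intro add_left_mono mult_left_mono) auto
  qed
  also have "\<dots> < q ^ s" using q0 by simp
  finally have "card (B1 \<union> (\<Union>i<k. B2 i)) < card T" using cT by simp
  moreover have "finite (B1 \<union> (\<Union>i<k. B2 i))" using finT finB2 by (auto simp: B1_def)
  ultimately have "\<not> T \<subseteq> B1 \<union> (\<Union>i<k. B2 i)" by (meson card_mono leD)
  then obtain t where t: "t \<in> T" "t \<notin> B1" "\<And>i. i < k \<Longrightarrow> t \<notin> B2 i" by blast
  have tQ: "t l \<in> N - U" if "l < s" for l using t(1) that by (auto simp: T_def)
  \<comment> \<open>The tuple need not be connected: common neighbours of \<open>t l\<close> and \<open>t 0\<close> join it up.\<close>
  have "\<exists>c. c \<in> N - U \<and> gd (t l) c \<and> gd (t 0) c" if l: "l < s" for l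
  proof (rule ccontr)
    assume "\<not> ?thesis"
    then have "N \<subseteq> U \<union> ({y \<in> N. \<not> gd (t l) y} \<union> {y \<in> N. \<not> gd (t 0) y})" by auto
    then have "card N \<le> card (U \<union> ({y \<in> N. \<not> gd (t l) y} \<union> {y \<in> N. \<not> gd (t 0) y}))"
      using fin U(1) by (intro card_mono) (auto intro: finite_subset)
    also have "\<dots> \<le> card U + (card {y \<in> N. \<not> gd (t l) y} + card {y \<in> N. \<not> gd (t 0) y})"
      by (meson add_left_mono card_Un_le le_trans)
    finally have "card N \<le> card U + (card {y \<in> N. \<not> gd (t l) y} + card {y \<in> N. \<not> gd (t 0) y})" .
    moreover have "32 * card {y \<in> N. \<not> gd (t l) y} \<le> card N" "32 * card {y \<in> N. \<not> gd (t 0) y} \<le> card N"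
      using nb tQ l by auto
    moreover have "card N > 0" using fin \<open>N \<noteq> {}\<close> by (simp add: card_gt_0_iff)
    ultimately show False using U(2) by linarith
  qed
  then obtain c where c: "\<And>l. l < s \<Longrightarrow> c l \<in> N - U \<and> gd (t l) (c l) \<and> gd (t 0) (c l)" by metis
  define A where "A = t ` {..<s} \<union> c ` {..<s}"
  have "conn gd A"
  proof (rule connI_from[OF sym, where x = "t 0"])
    fix y assume "y \<in> A"
    then obtain l where l: "l < s" "y = t l \<or> y = c l" by (auto simp: A_def)
    have *: "t l \<in> A" "c l \<in> A" "t 0 \<in> A" using l s by (auto simp: A_def)
    have "reach gd A (t 0) (c l)" using c[OF l(1)] * by (intro reach_edge) auto
    moreover have "reach gd A (c l) (t l)" using c[OF l(1)] * sym by (intro reach_edge) (auto dest: sympD)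
    ultimately show "reach gd A (t 0) y" using l(2) by (auto intro: reach_trans)
  qed
  moreover have "card A \<le> 2 * s"
  proof -
    have "card A \<le> card (t ` {..<s}) + card (c ` {..<s})" unfolding A_def by (rule card_Un_le)
    also have "\<dots> \<le> s + s" using card_image_le[of "{..<s}" t] card_image_le[of "{..<s}" c] by simp
    finally show ?thesis by simp
  qed
  moreover have "card {b \<in> N. \<forall>a\<in>A. \<not> gd a b} * 4 ^ s \<le> card N"
  proof -
    have "card {b \<in> N. \<forall>a\<in>A. \<not> gd a b} \<le> card (F t)"
      using fin unfolding F_def A_def by (intro card_mono) auto
    then have "card {b \<in> N. \<forall>a\<in>A. \<not> gd a b} * 4 ^ s \<le> card (F t) * 4 ^ s" by simp
    also have "real (card (F t) * 4 ^ s) \<le> real (card N)" using t(1,2) by (simp add: B1_def m_def)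
    then have "card (F t) * 4 ^ s \<le> card N" by (simp only: of_nat_le_iff)
    finally show ?thesis .
  qed
  moreover have "\<not> A \<subseteq> Z i" if "i < k" for i
  proof
    assume "A \<subseteq> Z i"
    then have "t \<in> B2 i" using t(1) unfolding B2_def T_def A_def by (auto simp: PiE_iff)
    with t(3)[OF that] show False by blast
  qed
  moreover have "t 0 \<in> A" using s by (auto simp: A_def)
  then have "A \<noteq> {}" by blast
  moreover have "A \<subseteq> N - U" using tQ c by (auto simp: A_def)
  ultimately show ?thesis by blast
qed

text \<open>The groups are chosen greedily. Those already chosen use at most
  \<open>2 * h * s\<close> vertices, a quarter of \<open>N\<close>. The bound on their common
  non-neighbours is carried along, because these sets are the \<open>Z i\<close> that the next group
  must not lie in.\<close>

lemma dense_clique_model: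
  fixes gd :: "'i \<Rightarrow> 'i \<Rightarrow> bool" and h s :: nat
  assumes fin: "finite N" and sym: "symp gd"
    and nb: "\<And>x. x \<in> N \<Longrightarrow> 32 * card {y \<in> N. \<not> gd x y} \<le> card N"
    and s: "s \<ge> 1" and h: "2 * h \<le> 2 ^ (s\<^sup>2)" and N: "8 * h * s \<le> card N"
  shows "\<exists>M. clique_model gd N h M"
proof -
  have "\<exists>M. clique_model gd N k M \<and> (\<forall>i<k. card (M i) \<le> 2 * s \<and>
      card {b \<in> N. \<forall>a\<in>M i. \<not> gd a b} * 4 ^ s \<le> card N)" if "k \<le> h" for k
    using that
  proof (induction k)
    case 0
    show ?case by (simp add: clique_model_def)
  next
    case (Suc k)
    then obtain M where M: "clique_model gd N k M"
      "\<And>i. i < k \<Longrightarrow> card (M i) \<le> 2 * s"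
      "\<And>i. i < k \<Longrightarrow> card {b \<in> N. \<forall>a\<in>M i. \<not> gd a b} * 4 ^ s \<le> card N" by auto
    define U where "U = (\<Union>i<k. M i)"
    have U: "U \<subseteq> N" using M(1) by (auto simp: U_def clique_model_def)
    have "card U \<le> (\<Sum>i<k. card (M i))" unfolding U_def by (rule card_UN_le) simp
    also have "\<dots> \<le> (\<Sum>i<k. 2 * s)" using M(2) by (intro sum_mono) auto
    also have "\<dots> \<le> 2 * h * s" using Suc.prems by simp
    finally have cU: "4 * card U \<le> card N" using N by simp
    have "N \<noteq> {}" using N s Suc.prems by auto
    moreover have "2 * k \<le> 2 ^ s\<^sup>2" using h Suc.prems by simp
    ultimately obtain A where A: "A \<noteq> {}" "A \<subseteq> N - U" "conn gd A" "card A \<le> 2 * s"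
        "card {b \<in> N. \<forall>a\<in>A. \<not> gd a b} * 4 ^ s \<le> card N"
        "\<And>i. i < k \<Longrightarrow> \<not> A \<subseteq> {b \<in> N. \<forall>a\<in>M i. \<not> gd a b}"
      using dense_group_step[OF fin sym _ nb s _ U cU, of k "\<lambda>i. {b \<in> N. \<forall>a\<in>M i. \<not> gd a b}"]
        M(3) fin by auto
    define M' where "M' = M(k := A)"
    have M'k: "M' k = A" and M'i: "\<And>i. i < k \<Longrightarrow> M' i = M i" by (auto simp: M'_def)
    have "clique_model gd N (Suc k) M'"
    proof (rule clique_modelI)
      fix i assume i: "i < Suc k"
      have "M' i \<noteq> {} \<and> M' i \<subseteq> N \<and> conn gd (M' i)"
      proof (cases "i = k")
        case True
        have "A \<subseteq> N" using A(2) by blast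
        with A(1,3) True show ?thesis by (simp add: M'k)
      next
        case False
        with M(1) i M'i show ?thesis by (simp add: clique_model_def)
      qed
      then show "M' i \<noteq> {}" "M' i \<subseteq> N" "conn gd (M' i)" by blast+
    next
      fix i j assume ij: "j < i" "i < Suc k"
      show "M' i \<inter> M' j = {}"
      proof (cases "i = k")
        case True
        then show ?thesis using A(2) ij M'k M'i by (auto simp: U_def)
      next
        case False
        then show ?thesis using M(1) ij M'i by (simp add: clique_model_def)
      qed
      show "\<exists>x\<in>M' i. \<exists>y\<in>M' j. gd x y"
      proof (cases "i = k")
        case True
        then have "\<not> A \<subseteq> {b \<in> N. \<forall>a\<in>M j. \<not> gd a b}" using A(6) ij by simp
        then obtain b a where "b \<in> A" "a \<in> M j" "gd a b" using A(2) by blast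
        then have "gd b a" using sym by (metis sympD)
        moreover have "M' i = A" "M' j = M j" using True M'k M'i ij by simp_all
        ultimately show ?thesis using \<open>a \<in> M j\<close> \<open>b \<in> A\<close> by blast
      next
        case False
        then show ?thesis using M(1) ij M'i by (simp add: clique_model_def)
      qed
    qed
    moreover have "\<forall>i<Suc k. card (M' i) \<le> 2 * s \<and> card {b \<in> N. \<forall>a\<in>M' i. \<not> gd a b} * 4 ^ s \<le> card N"
      
    proof (intro allI impI)
      fix i assume "i < Suc k"
      then show "card (M' i) \<le> 2 * s \<and> card {b \<in> N. \<forall>a\<in>M' i. \<not> gd a b} * 4 ^ s \<le> card N"
        using A(4,5) M(2,3) M'k M'i by (cases "i = k") simp_all
    qed
    ultimately show ?case by blast
  qed
  then show ?thesis by blast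
qed

section \<open>Congestion of random paths\<close>

text \<open>
  An almost minimal \<open>mu\<close> satisfies the first-order optimality condition up to a factor \<open>2\<close>, which
  replaces convex duality and avoids a compactness argument.
\<close>

lemma approx_minimizer:
  fixes a :: "'i \<Rightarrow> 'v \<Rightarrow> real" and d :: "'v \<Rightarrow> real"
  assumes I: "finite I" "I \<noteq> {}" and V: "finite V"
    and a: "\<And>i v. i \<in> I \<Longrightarrow> v \<in> V \<Longrightarrow> 0 \<le> a i v \<and> a i v \<le> 1"
    and d: "\<And>v. v \<in> V \<Longrightarrow> 0 \<le> d v" and c: "c > 0"
    and lower: "\<And>mu. (\<And>i. i \<in> I \<Longrightarrow> 0 \<le> mu i) \<Longrightarrow> sum mu I = 1 \<Longrightarrow>
        c \<le> (\<Sum>v\<in>V. d v * (\<Sum>i\<in>I. mu i * a i v)\<^sup>2)"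
  obtains mu where "\<And>i. i \<in> I \<Longrightarrow> 0 \<le> mu i" "sum mu I = (1::real)"
    "\<And>j. j \<in> I \<Longrightarrow> (\<Sum>v\<in>V. d v * (\<Sum>i\<in>I. mu i * a i v)\<^sup>2) / 2
        \<le> (\<Sum>v\<in>V. d v * (\<Sum>i\<in>I. mu i * a i v) * a j v)"
proof -
  define P where "P = {mu :: 'i \<Rightarrow> real. (\<forall>i\<in>I. 0 \<le> mu i) \<and> sum mu I = 1}"
  define pp where "pp mu v = (\<Sum>i\<in>I. mu i * a i v)" for mu :: "'i \<Rightarrow> real" and v
  define F where "F mu = (\<Sum>v\<in>V. d v * (pp mu v)\<^sup>2)" for mu
  define m where "m = Inf (F ` P)"
  define S where "S = (\<Sum>v\<in>V. d v)"
  have S0: "S \<ge> 0" unfolding S_def by (intro sum_nonneg d)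
  have Fc: "c \<le> F mu" if "mu \<in> P" for mu
    using lower[of mu] that by (auto simp: P_def F_def pp_def)
  obtain i0 where i0: "i0 \<in> I" using I by blast
  have "(\<lambda>i. if i = i0 then 1 else 0) \<in> P" using i0 I by (auto simp: P_def)
  then have ne: "F ` P \<noteq> {}" by blast
  have bdd: "bdd_below (F ` P)" by (rule bdd_belowI2[of _ c]) (rule Fc)
  have "c \<le> m" unfolding m_def using ne Fc by (intro cInf_greatest) auto
  then have m0: "m > 0" using c by simp
  have mF: "m \<le> F mu" if "mu \<in> P" for mu
    unfolding m_def using that bdd by (intro cInf_lower) auto
  \<comment> \<open>The step length is chosen for the second-order term: towards a point mass it is
    at most \<open>t\<^sup>2 * S\<close>, and \<open>t * S\<close> is at most
    \<open>m / 2\<close>.\<close>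
  define t where "t = min 1 (m / (2 * (S + 1)))"
  have t: "0 < t" "t \<le> 1" using m0 S0 by (auto simp: t_def)
  have "t * S \<le> m / (2 * (S + 1)) * S" using S0 by (intro mult_right_mono) (auto simp: t_def)
  also have "\<dots> = m / 2 * (S / (S + 1))" using S0 by simp
  also have "\<dots> \<le> m / 2 * 1" using S0 m0 by (intro mult_left_mono) auto
  finally have tS: "t * S \<le> m / 2" by simp
  \<comment> \<open>The error is itself proportional to \<open>t\<close>, so that it survives
    division by the step length. This needs \<open>m > 0\<close>, which is what the lower bound
    \<open>c\<close> provides.\<close>
  have "Inf (F ` P) < m + t * m / 2" using t m0 by (simp add: m_def)
  then obtain mu where mu: "mu \<in> P" "F mu < m + t * m / 2"
    using cInf_lessD[OF ne] by blast
  have pp01: "0 \<le> pp mu v \<and> pp mu v \<le> 1" if "v \<in> V" for v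
  proof
    show "0 \<le> pp mu v" unfolding pp_def using mu a that by (intro sum_nonneg mult_nonneg_nonneg) (auto simp: P_def)
    have "pp mu v \<le> (\<Sum>i\<in>I. mu i * 1)"
      unfolding pp_def using mu a that by (intro sum_mono mult_left_mono) (auto simp: P_def)
    then show "pp mu v \<le> 1" using mu by (simp add: P_def)
  qed
  have "F mu / 2 \<le> (\<Sum>v\<in>V. d v * pp mu v * a j v)" if j: "j \<in> I" for j
  proof -
    \<comment> \<open>A move from \<open>mu\<close> towards the point mass at \<open>j\<close>;
      \<open>F nu\<close> cannot fall below the infimum \<open>m\<close>, and expanding it in
      \<open>t\<close> gives the first-order condition.\<close>
    define nu where "nu i = (1 - t) * mu i + t * (if i = j then 1 else 0)" for i
    have "sum nu I = (1 - t) * sum mu I + t"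
      unfolding nu_def sum.distrib sum_distrib_left[symmetric] using I(1) j by simp
    then have nuP: "nu \<in> P" using mu t by (auto simp: P_def nu_def)
    have ppnu: "pp nu v = pp mu v + t * (a j v - pp mu v)" for v
    proof -
      have "pp nu v = (\<Sum>i\<in>I. (1 - t) * (mu i * a i v) + t * (if i = j then a i v else 0))"
        unfolding pp_def nu_def by (intro sum.cong refl) (simp add: algebra_simps)
      also have "\<dots> = (1 - t) * pp mu v + t * a j v"
        unfolding sum.distrib sum_distrib_left[symmetric] pp_def using I(1) j by simp
      finally show ?thesis by (simp add: algebra_simps)
    qed
    have "F nu = (\<Sum>v\<in>V. d v * (pp mu v)\<^sup>2 + 2 * t * (d v * pp mu v * a j v - d v * (pp mu v)\<^sup>2)
        + t\<^sup>2 * (d v * (a j v - pp mu v)\<^sup>2))"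
      unfolding F_def ppnu by (intro sum.cong refl) (simp add: power2_eq_square algebra_simps)
    also have "\<dots> = F mu + 2 * t * ((\<Sum>v\<in>V. d v * pp mu v * a j v) - F mu)
        + t\<^sup>2 * (\<Sum>v\<in>V. d v * (a j v - pp mu v)\<^sup>2)"
      unfolding F_def sum.distrib sum_distrib_left[symmetric] sum_subtractf ..
    also have "(\<Sum>v\<in>V. d v * (a j v - pp mu v)\<^sup>2) \<le> (\<Sum>v\<in>V. d v * 1)"
    proof (intro sum_mono mult_left_mono d)
      fix v assume v: "v \<in> V"
      have "\<bar>a j v - pp mu v\<bar> \<le> 1" using pp01[OF v] a[OF j v] by linarith
      then show "(a j v - pp mu v)\<^sup>2 \<le> 1" by (simp add: abs_square_le_1)
    qed
    then have "t\<^sup>2 * (\<Sum>v\<in>V. d v * (a j v - pp mu v)\<^sup>2) \<le> t\<^sup>2 * S"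
      by (intro mult_left_mono) (auto simp: S_def)
    finally have up: "F nu \<le> F mu + 2 * t * ((\<Sum>v\<in>V. d v * pp mu v * a j v) - F mu) + t\<^sup>2 * S" by simp
    have "t\<^sup>2 * S \<le> t * (m / 2)" using tS t by (simp add: power2_eq_square mult.assoc)
    then have "- (t * m / 2) \<le> 2 * t * ((\<Sum>v\<in>V. d v * pp mu v * a j v) - F mu) + t * m / 2"
      using up mF[OF nuP] mu(2) by simp
    then have "t * (- m) \<le> t * (2 * ((\<Sum>v\<in>V. d v * pp mu v * a j v) - F mu))" by (simp add: algebra_simps)
    then have "- m \<le> 2 * ((\<Sum>v\<in>V. d v * pp mu v * a j v) - F mu)"
      using t(1) by (simp only: mult_le_cancel_left_pos)
    then show ?thesis using mF[OF mu(1)] by simp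
  qed
  then show thesis using that[of mu] mu(1) by (auto simp: P_def F_def pp_def)
qed

section \<open>Independent random choices as weighted finite sums\<close>

text \<open>Fubini for one coordinate. When \<open>q\<close> sums to 1 on \<open>A\<close>, such
  sums over functions are expectations over independent coordinates with distribution
  \<open>q\<close>.\<close>

lemma sum_PiE_peel:
  fixes q :: "'x \<Rightarrow> real"
  assumes "finite J" "a \<in> J"
  shows "(\<Sum>g\<in>J \<rightarrow>\<^sub>E A. (\<Prod>j\<in>J. q (g j)) * H g) =
    (\<Sum>x\<in>A. q x * (\<Sum>g\<in>(J - {a}) \<rightarrow>\<^sub>E A. (\<Prod>j\<in>J - {a}. q (g j)) * H (g(a := x))))"
proof -
  define K where "K = J - {a}"
  have J: "J = insert a K" and aK: "a \<notin> K" and K: "finite K" using assms by (auto simp: K_def)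
  have "(\<Sum>g\<in>J \<rightarrow>\<^sub>E A. (\<Prod>j\<in>J. q (g j)) * H g) =
      (\<Sum>(x, g)\<in>A \<times> (K \<rightarrow>\<^sub>E A). (\<Prod>j\<in>J. q ((g(a := x)) j)) * H (g(a := x)))"
    unfolding J PiE_insert_eq
    by (subst sum.reindex) (auto simp: case_prod_beta intro!: inj_combinator[OF aK])
  also have "\<dots> = (\<Sum>x\<in>A. \<Sum>g\<in>K \<rightarrow>\<^sub>E A. (\<Prod>j\<in>J. q ((g(a := x)) j)) * H (g(a := x)))"
    by (rule sum.cartesian_product[symmetric])
  also have "\<dots> = (\<Sum>x\<in>A. q x * (\<Sum>g\<in>K \<rightarrow>\<^sub>E A. (\<Prod>j\<in>K. q (g j)) * H (g(a := x))))"
    unfolding sum_distrib_left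
  proof (intro sum.cong refl)
    fix x g
    have "(\<Prod>j\<in>J. q ((g(a := x)) j)) = q x * (\<Prod>j\<in>K. q ((g(a := x)) j))"
      unfolding J using K aK by simp
    also have "(\<Prod>j\<in>K. q ((g(a := x)) j)) = (\<Prod>j\<in>K. q (g j))"
      using aK by (intro prod.cong refl) auto
    finally show "(\<Prod>j\<in>J. q ((g(a := x)) j)) * H (g(a := x)) = q x * ((\<Prod>j\<in>K. q (g j)) * H (g(a := x)))"
      by simp
  qed
  finally show ?thesis unfolding K_def .
qed

lemma sum_PiE_total:
  fixes q :: "'x \<Rightarrow> real"
  assumes "finite J" "sum q A = 1"
  shows "(\<Sum>g\<in>J \<rightarrow>\<^sub>E A. (\<Prod>j\<in>J. q (g j))) = 1"
  using assms(1)
proof (induction J rule: finite_induct)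
  case (insert a K)
  have "(\<Sum>g\<in>insert a K \<rightarrow>\<^sub>E A. (\<Prod>j\<in>insert a K. q (g j))) = (\<Sum>x\<in>A. q x * 1)"
    using sum_PiE_peel[where J = "insert a K" and a = a and q = q and A = A and H = "\<lambda>_. 1"] insert by simp
  then show ?case using assms(2) by simp
qed simp

lemma sum_PiE_pair:
  fixes q :: "'x \<Rightarrow> real"
  assumes "finite J" and J: "a \<in> J" "b \<in> J" "a \<noteq> b"
    and H: "\<And>g x. H (g(a := x)) = H g" "\<And>g x. H (g(b := x)) = H g"
  shows "(\<Sum>g\<in>J \<rightarrow>\<^sub>E A. (\<Prod>j\<in>J. q (g j)) * (\<phi> (g a) (g b) * H g)) =
    (\<Sum>x\<in>A. q x * (\<Sum>y\<in>A. q y * \<phi> x y)) *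
    (\<Sum>g\<in>(J - {a} - {b}) \<rightarrow>\<^sub>E A. (\<Prod>j\<in>J - {a} - {b}. q (g j)) * H g)" (is "?L = _ * ?R")
proof -
  have "?L = (\<Sum>x\<in>A. q x * (\<Sum>g\<in>(J - {a}) \<rightarrow>\<^sub>E A. (\<Prod>j\<in>J - {a}. q (g j)) * (\<phi> x (g b) * H g)))"
    using sum_PiE_peel[where J = J and a = a and q = q and A = A and H = "\<lambda>g. \<phi> (g a) (g b) * H g"]
      assms by simp
  also have "\<dots> = (\<Sum>x\<in>A. q x * (\<Sum>y\<in>A. q y * (\<phi> x y * ?R)))"
  proof (intro sum.cong refl arg_cong2[where f = "(*)"])
    fix x
    have "(\<Sum>g\<in>(J - {a}) \<rightarrow>\<^sub>E A. (\<Prod>j\<in>J - {a}. q (g j)) * (\<phi> x (g b) * H g)) =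
      (\<Sum>y\<in>A. q y * (\<Sum>g\<in>(J - {a} - {b}) \<rightarrow>\<^sub>E A. (\<Prod>j\<in>J - {a} - {b}. q (g j)) * (\<phi> x y * H g)))"
      using sum_PiE_peel[where J = "J - {a}" and a = b and q = q and A = A and H = "\<lambda>g. \<phi> x (g b) * H g"]
        assms by (simp del: Diff_insert Diff_insert2)
    also have "\<dots> = (\<Sum>y\<in>A. q y * (\<phi> x y * ?R))"
      unfolding sum_distrib_left by (intro sum.cong refl) (simp add: mult_ac)
    finally show "(\<Sum>g\<in>(J - {a}) \<rightarrow>\<^sub>E A. (\<Prod>j\<in>J - {a}. q (g j)) * (\<phi> x (g b) * H g)) =
      (\<Sum>y\<in>A. q y * (\<phi> x y * ?R))" .
  qed
  also have "\<dots> = (\<Sum>x\<in>A. q x * (\<Sum>y\<in>A. q y * \<phi> x y)) * ?R"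
    unfolding mult.assoc[symmetric] sum_distrib_right[symmetric] ..
  finally show ?thesis .
qed

text \<open>Independence: the two factors depend on disjoint pairs of coordinates, so the
  expectation of the product splits, and the remaining coordinates integrate to 1.\<close>

lemma sum_PiE_two_pairs:
  fixes q :: "'x \<Rightarrow> real"
  assumes J: "finite J" and q: "sum q A = 1"
    and mem: "a \<in> J" "b \<in> J" "c \<in> J" "e \<in> J" and dist: "distinct [a, b, c, e]"
  shows "(\<Sum>g\<in>J \<rightarrow>\<^sub>E A. (\<Prod>j\<in>J. q (g j)) * (\<phi> (g a) (g b) * \<psi> (g c) (g e))) =
    (\<Sum>x\<in>A. q x * (\<Sum>y\<in>A. q y * \<phi> x y)) * (\<Sum>x\<in>A. q x * (\<Sum>y\<in>A. q y * \<psi> x y))"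
proof -
  let ?K = "J - {a} - {b}"
  have K: "finite ?K" "finite (?K - {c} - {e})" "c \<in> ?K" "e \<in> ?K" "c \<noteq> e" using J mem dist by auto
  have "(\<Sum>g\<in>J \<rightarrow>\<^sub>E A. (\<Prod>j\<in>J. q (g j)) * (\<phi> (g a) (g b) * \<psi> (g c) (g e))) =
    (\<Sum>x\<in>A. q x * (\<Sum>y\<in>A. q y * \<phi> x y)) * (\<Sum>g\<in>?K \<rightarrow>\<^sub>E A. (\<Prod>j\<in>?K. q (g j)) * \<psi> (g c) (g e))"
    by (rule sum_PiE_pair[OF J]) (use mem dist in auto)
  also have "(\<Sum>g\<in>?K \<rightarrow>\<^sub>E A. (\<Prod>j\<in>?K. q (g j)) * \<psi> (g c) (g e)) =
      (\<Sum>x\<in>A. q x * (\<Sum>y\<in>A. q y * \<psi> x y)) *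
      (\<Sum>g\<in>(?K - {c} - {e}) \<rightarrow>\<^sub>E A. (\<Prod>j\<in>?K - {c} - {e}. q (g j)) * 1)"
    using sum_PiE_pair[where J = ?K and a = c and b = e and q = q and A = A and \<phi> = \<psi> and H = "\<lambda>_. 1"] K
    by (simp del: Diff_insert Diff_insert2)
  also have "(\<Sum>g\<in>(?K - {c} - {e}) \<rightarrow>\<^sub>E A. (\<Prod>j\<in>?K - {c} - {e}. q (g j)) * 1) = 1"
    using sum_PiE_total[OF K(2) q] by simp
  finally show ?thesis by simp
qed

text \<open>
  Each edge \<open>{i, j}\<close> of a complete graph is drawn as two half-edges \<open>(i, j)\<close> and \<open>(j, i)\<close> that run from
  the vertex points to a common midpoint. Two half-edges may meet harmlessly if they have the same
  vertex or the same midpoint; all other pairs have disjoint sets of random endpoints.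
\<close>

definition crossing_candidates :: "nat \<Rightarrow> ((nat \<times> nat) \<times> (nat \<times> nat)) set" where
  "crossing_candidates r = {((i, j), (k, l)). i < r \<and> j < r \<and> k < r \<and> l < r \<and> i \<noteq> j \<and> k \<noteq> l \<and>
     i \<noteq> k \<and> {i, j} \<noteq> {k, l}}"

text \<open>First-moment argument. Points and midpoints are uniform in \<open>V\<close>, selectors
  follow \<open>mu\<close>, and all are independent, so \<open>p x\<close> is the probability that a
  given half-edge contains \<open>x\<close>. The four coordinates behind a candidate are distinct;
  hence it is a conflict with probability at most the sum of \<open>p x * p y\<close> over touching
  pairs, which \<open>F\<close> bounds.\<close>

lemma exists_few_conflicts:
  fixes sel :: "'i \<Rightarrow> 'v \<Rightarrow> 'v \<Rightarrow> 'v set" and mu :: "'i \<Rightarrow> real" and tch :: "'v \<Rightarrow> 'v \<Rightarrow> bool"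
  assumes V: "finite V" "V \<noteq> {}" and I: "finite I" and mu: "\<And>i. i \<in> I \<Longrightarrow> 0 \<le> mu i" "sum mu I = 1"
    and sym: "symp tch" and sel: "\<And>i u v. i \<in> I \<Longrightarrow> u \<in> V \<Longrightarrow> v \<in> V \<Longrightarrow> sel i u v \<subseteq> V"
  defines "p \<equiv> \<lambda>x. \<Sum>i\<in>I. mu i * (real (card {(u, v) \<in> V \<times> V. x \<in> sel i u v}) / (real (card V))\<^sup>2)"
  defines "F \<equiv> \<Sum>x\<in>V. real (card {y \<in> V. tch x y}) * (p x)\<^sup>2"
  shows "\<exists>z s w. (\<forall>i<r. z i \<in> V \<and> s i \<in> I) \<and> (\<forall>i<r. \<forall>j<r. w i j \<in> V \<and> w i j = w j i) \<and>
    real (card {e \<in> crossing_candidates r. case e of ((i, j), (k, l)) \<Rightarrow>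
      \<exists>x\<in>sel (s i) (z i) (w i j). \<exists>y\<in>sel (s k) (z k) (w k l). tch x y}) \<le> real r ^ 4 * F"
proof -
  define n where "n = real (card V)"
  have n0: "n > 0" using V by (simp add: n_def card_gt_0_iff)
  \<comment> \<open>Coordinate \<open>(i, i)\<close> holds the point and the selector of vertex \<open>i\<close>; coordinate \<open>(i, j)\<close> with
    \<open>i < j\<close> holds the midpoint of \<open>{i, j}\<close>, and its selector component is ignored.\<close>
  define J where "J = {(i, j). i \<le> j \<and> j < r}"
  have "J \<subseteq> {..<r} \<times> {..<r}" by (auto simp: J_def)
  then have finJ: "finite J" by (rule finite_subset) simp
  define A where "A = V \<times> I"
  have finA: "finite A" using V I by (simp add: A_def)
  have sumA: "sum f A = (\<Sum>v\<in>V. \<Sum>i\<in>I. f (v, i))" for f :: "'v \<times> 'i \<Rightarrow> real"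
    unfolding A_def sum.cartesian_product by (simp add: case_prod_beta)
  define q where "q a = mu (snd a) / n" for a :: "'v \<times> 'i"
  have q0: "0 \<le> q a" if "a \<in> A" for a using that mu(1) n0 by (auto simp: A_def q_def)
  have q1: "sum q A = 1"
  proof -
    have "sum q A = (\<Sum>v\<in>V. \<Sum>i\<in>I. mu i / n)"
      unfolding sumA q_def by simp
    also have "\<dots> = 1" using n0 mu(2) by (simp add: n_def flip: sum_divide_distrib)
    finally show ?thesis .
  qed
  define \<phi> where "\<phi> x a b = (of_bool (x \<in> sel (snd a) (fst a) (fst b)) :: real)" for x :: 'v and a b :: "'v \<times> 'i"
  have p_eq: "(\<Sum>a\<in>A. q a * (\<Sum>b\<in>A. q b * \<phi> x a b)) = p x" for x
  proof -
    have "(\<Sum>b\<in>A. q b * \<phi> x a b) = (\<Sum>v\<in>V. of_bool (x \<in> sel (snd a) (fst a) v)) / n" for a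
    proof -
      have "(\<Sum>b\<in>A. q b * \<phi> x a b) = (\<Sum>v\<in>V. \<Sum>i\<in>I. mu i / n * of_bool (x \<in> sel (snd a) (fst a) v))"
        unfolding sumA q_def \<phi>_def by simp
      also have "\<dots> = (\<Sum>v\<in>V. of_bool (x \<in> sel (snd a) (fst a) v)) / n"
        unfolding sum_distrib_right[symmetric] sum_divide_distrib[symmetric] mu(2) by (simp add: sum_divide_distrib)
      finally show ?thesis .
    qed
    then have "(\<Sum>a\<in>A. q a * (\<Sum>b\<in>A. q b * \<phi> x a b)) =
        (\<Sum>u\<in>V. \<Sum>i\<in>I. mu i / n * ((\<Sum>v\<in>V. of_bool (x \<in> sel i u v)) / n))"
      unfolding sumA q_def by simp
    also have "\<dots> = (\<Sum>i\<in>I. \<Sum>u\<in>V. mu i / n * ((\<Sum>v\<in>V. of_bool (x \<in> sel i u v)) / n))"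
      by (rule sum.swap)
    also have "\<dots> = (\<Sum>i\<in>I. mu i * ((\<Sum>u\<in>V. \<Sum>v\<in>V. of_bool (x \<in> sel i u v)) / n\<^sup>2))"
      by (intro sum.cong refl) (simp add: sum_distrib_left sum_divide_distrib power2_eq_square)
    also have "\<dots> = p x"
      unfolding p_def n_def
    proof (intro sum.cong refl arg_cong2[where f = "(*)"] arg_cong2[where f = "(/)"])
      fix i
      have "{(u, v) \<in> V \<times> V. x \<in> sel i u v} = {a \<in> V \<times> V. x \<in> sel i (fst a) (snd a)}" by auto
      then have "card {(u, v) \<in> V \<times> V. x \<in> sel i u v} = (\<Sum>a\<in>V \<times> V. of_bool (x \<in> sel i (fst a) (snd a)))"
        using card_filter_eq_sum[of "V \<times> V" "\<lambda>a. x \<in> sel i (fst a) (snd a)"] V(1) by simp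
      then show "(\<Sum>u\<in>V. \<Sum>v\<in>V. of_bool (x \<in> sel i u v)) = real (card {(u, v) \<in> V \<times> V. x \<in> sel i u v})"
        by (simp add: sum.cartesian_product case_prod_beta)
    qed
    finally show ?thesis .
  qed
  \<comment> \<open>Ordering the two indices gives both halves of an edge the same midpoint
    coordinate.\<close>
  define P where "P g i j = sel (snd (g (i, i))) (fst (g (i, i))) (fst (g (min i j, max i j)))"
    for g :: "nat \<times> nat \<Rightarrow> 'v \<times> 'i" and i j
  define Q where "Q g i j k l \<longleftrightarrow> (\<exists>x\<in>P g i j. \<exists>y\<in>P g k l. tch x y)" for g i j k l
  let ?N = "crossing_candidates r"
  have Nsub: "?N \<subseteq> ({..<r} \<times> {..<r}) \<times> ({..<r} \<times> {..<r})" by (auto simp: crossing_candidates_def)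
  then have finN: "finite ?N" by (rule finite_subset) simp
  have "card ?N \<le> card (({..<r} \<times> {..<r}) \<times> ({..<r} \<times> {..<r}))" using Nsub by (intro card_mono) auto
  also have "\<dots> = r ^ 4" by (simp add: card_cartesian_product power4_eq_xxxx)
  finally have cN: "card ?N \<le> r ^ 4" .
  let ?G = "J \<rightarrow>\<^sub>E A"
  let ?w = "\<lambda>g. \<Prod>j\<in>J. q (g j)"
  have w0: "0 \<le> ?w g" if "g \<in> ?G" for g
    using that by (intro prod_nonneg q0) (auto simp: PiE_iff)
  have PV: "P g i j \<subseteq> V" if "g \<in> ?G" "i < r" "j < r" for g i j
  proof -
    have "(i, i) \<in> J" "(min i j, max i j) \<in> J" using that by (auto simp: J_def)
    then have "g (i, i) \<in> A" "g (min i j, max i j) \<in> A" using that(1) by (auto simp: PiE_iff)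
    then show ?thesis unfolding P_def by (intro sel) (auto simp: A_def)
  qed
  have F_ge: "(\<Sum>x\<in>V. \<Sum>y\<in>V. of_bool (tch x y) * (p x * p y)) \<le> F"
  proof -
    \<comment> \<open>\<open>p x * p y\<close> is at most the mean of the two squares; by symmetry
      of \<open>tch\<close> each half of the resulting sum is \<open>F / 2\<close>.\<close>
    have "(\<Sum>x\<in>V. \<Sum>y\<in>V. of_bool (tch x y) * (p x * p y)) \<le>
        (\<Sum>x\<in>V. \<Sum>y\<in>V. of_bool (tch x y) * ((p x)\<^sup>2 / 2) + of_bool (tch y x) * ((p y)\<^sup>2 / 2))"
    proof (intro sum_mono)
      fix x y
      have "p x * p y \<le> (p x)\<^sup>2 / 2 + (p y)\<^sup>2 / 2"
        using zero_le_power2[of "p x - p y"] by (simp add: power2_eq_square algebra_simps)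
      moreover have "tch x y = tch y x" using sym by (auto dest: sympD)
      ultimately show "of_bool (tch x y) * (p x * p y) \<le>
          of_bool (tch x y) * ((p x)\<^sup>2 / 2) + of_bool (tch y x) * ((p y)\<^sup>2 / 2)" by auto
    qed
    also have "\<dots> = (\<Sum>x\<in>V. \<Sum>y\<in>V. of_bool (tch x y) * ((p x)\<^sup>2 / 2)) + (\<Sum>x\<in>V. \<Sum>y\<in>V. of_bool (tch y x) * ((p y)\<^sup>2 / 2))"
      by (simp only: sum.distrib)
    also have "(\<Sum>x\<in>V. \<Sum>y\<in>V. of_bool (tch y x) * ((p y)\<^sup>2 / 2)) = (\<Sum>y\<in>V. \<Sum>x\<in>V. of_bool (tch y x) * ((p y)\<^sup>2 / 2))"
      by (rule sum.swap)
    also have "(\<Sum>x\<in>V. \<Sum>y\<in>V. of_bool (tch x y) * ((p x)\<^sup>2 / 2)) = F / 2"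
      unfolding F_def sum_divide_distrib
    proof (intro sum.cong refl)
      fix x
      have "real (card {y \<in> V. tch x y}) = (\<Sum>y\<in>V. of_bool (tch x y))"
        using card_filter_eq_sum[OF V(1), of "tch x"] by simp
      then show "(\<Sum>y\<in>V. of_bool (tch x y) * ((p x)\<^sup>2 / 2)) = real (card {y \<in> V. tch x y}) * (p x)\<^sup>2 / 2"
        by (simp add: sum_distrib_right)
    qed
    finally show ?thesis by simp
  qed
  have pair: "(\<Sum>g\<in>?G. ?w g * of_bool (Q g i j k l)) \<le> F" if N: "((i, j), (k, l)) \<in> ?N" for i j k l
  proof -
    have ij: "i < r" "j < r" "k < r" "l < r" "i \<noteq> j" "k \<noteq> l" "i \<noteq> k" "{i, j} \<noteq> {k, l}"
      using N by (auto simp: crossing_candidates_def)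
    let ?a = "(i, i)" and ?b = "(min i j, max i j)" and ?c = "(k, k)" and ?e = "(min k l, max k l)"
    have mem: "?a \<in> J" "?b \<in> J" "?c \<in> J" "?e \<in> J" using ij by (auto simp: J_def)
    have "?b \<noteq> ?e"
    proof
      assume "?b = ?e"
      then have "{min i j, max i j} = {min k l, max k l}" by simp
      then show False using ij(8) by (auto simp: min_def max_def split: if_splits)
    qed
    moreover have "?a \<noteq> ?b" "?a \<noteq> ?e" "?c \<noteq> ?b" "?c \<noteq> ?e"
      using ij by (auto simp: min_def max_def split: if_splits)
    ultimately have dist: "distinct [?a, ?b, ?c, ?e]" using ij by auto
    have "(\<Sum>g\<in>?G. ?w g * of_bool (Q g i j k l)) \<le>
        (\<Sum>g\<in>?G. \<Sum>x\<in>V. \<Sum>y\<in>V. of_bool (tch x y) * (?w g * (\<phi> x (g ?a) (g ?b) * \<phi> y (g ?c) (g ?e))))"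
    proof (intro sum_mono)
      fix g assume g: "g \<in> ?G"
      let ?t = "\<lambda>x y. of_bool (tch x y) * (?w g * (\<phi> x (g ?a) (g ?b) * \<phi> y (g ?c) (g ?e)))"
      have t0: "0 \<le> ?t x y" for x y using w0[OF g] by (auto simp: \<phi>_def)
      show "?w g * of_bool (Q g i j k l) \<le> (\<Sum>x\<in>V. \<Sum>y\<in>V. ?t x y)"
      proof (cases "Q g i j k l")
        case False
        then show ?thesis using t0 by (simp add: sum_nonneg)
      next
        case True
        then obtain x y where xy: "x \<in> P g i j" "y \<in> P g k l" "tch x y" unfolding Q_def by blast
        then have xyV: "x \<in> V" "y \<in> V" using PV[OF g] ij by blast+
        have "?w g * of_bool (Q g i j k l) = ?t x y"
          using True xy unfolding P_def by (simp add: \<phi>_def)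
        also have "\<dots> \<le> (\<Sum>y\<in>V. ?t x y)" using t0 xyV V(1) by (intro member_le_sum) auto
        also have "\<dots> \<le> (\<Sum>x\<in>V. \<Sum>y\<in>V. ?t x y)"
          using xyV V(1) by (intro member_le_sum[of x V "\<lambda>x. \<Sum>y\<in>V. ?t x y"] sum_nonneg t0) auto
        finally show ?thesis .
      qed
    qed
    also have "\<dots> = (\<Sum>x\<in>V. \<Sum>g\<in>?G. \<Sum>y\<in>V. of_bool (tch x y) * (?w g * (\<phi> x (g ?a) (g ?b) * \<phi> y (g ?c) (g ?e))))"
      by (rule sum.swap)
    also have "\<dots> = (\<Sum>x\<in>V. \<Sum>y\<in>V. \<Sum>g\<in>?G. of_bool (tch x y) * (?w g * (\<phi> x (g ?a) (g ?b) * \<phi> y (g ?c) (g ?e))))"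
      by (intro sum.cong refl sum.swap)
    also have "\<dots> = (\<Sum>x\<in>V. \<Sum>y\<in>V. of_bool (tch x y) * (p x * p y))"
      unfolding sum_distrib_left[symmetric] sum_PiE_two_pairs[OF finJ q1 mem dist] p_eq ..
    also note F_ge
    finally show ?thesis .
  qed
  have "\<exists>g\<in>?G. (\<Sum>((i, j), (k, l))\<in>?N. of_bool (Q g i j k l)) \<le> real r ^ 4 * F"
  proof (rule ccontr)
    assume "\<not> ?thesis"
    then have gt: "real r ^ 4 * F < (\<Sum>((i, j), (k, l))\<in>?N. of_bool (Q g i j k l))" if "g \<in> ?G" for g
      using that by (auto simp: not_le)
    have tot: "(\<Sum>g\<in>?G. ?w g) = 1" by (rule sum_PiE_total[OF finJ q1])
    have "\<exists>g\<in>?G. 0 < ?w g"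
    proof (rule ccontr)
      assume "\<not> ?thesis"
      then have "(\<Sum>g\<in>?G. ?w g) \<le> 0" by (intro sum_nonpos) auto
      then show False using tot by simp
    qed
    then obtain g0 where g0: "g0 \<in> ?G" "0 < ?w g0" by blast
    have finG: "finite ?G" using finJ finA by (intro finite_PiE) auto
    have "real r ^ 4 * F = (\<Sum>g\<in>?G. ?w g * (real r ^ 4 * F))"
      unfolding sum_distrib_right[symmetric] tot by simp
    also have "\<dots> < (\<Sum>g\<in>?G. ?w g * (\<Sum>((i, j), (k, l))\<in>?N. of_bool (Q g i j k l)))"
    proof (rule sum_strict_mono_ex1[OF finG])
      show "\<forall>g\<in>?G. ?w g * (real r ^ 4 * F) \<le> ?w g * (\<Sum>((i, j), (k, l))\<in>?N. of_bool (Q g i j k l))"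
        using gt w0 by (intro ballI mult_left_mono) (auto intro: less_imp_le)
      show "\<exists>g\<in>?G. ?w g * (real r ^ 4 * F) < ?w g * (\<Sum>((i, j), (k, l))\<in>?N. of_bool (Q g i j k l))"
        using g0 gt[OF g0(1)] by (intro bexI[of _ g0] mult_strict_left_mono) auto
    qed
    also have "\<dots> = (\<Sum>g\<in>?G. \<Sum>e\<in>?N. ?w g * (case e of ((i, j), (k, l)) \<Rightarrow> of_bool (Q g i j k l)))"
      by (intro sum.cong refl) (simp add: sum_distrib_left case_prod_beta)
    also have "\<dots> = (\<Sum>e\<in>?N. \<Sum>g\<in>?G. ?w g * (case e of ((i, j), (k, l)) \<Rightarrow> of_bool (Q g i j k l)))"
      by (rule sum.swap)
    also have "\<dots> \<le> (\<Sum>e\<in>?N. F)"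
    proof (rule sum_mono)
      fix e assume "e \<in> ?N"
      moreover obtain i j k l where "e = ((i, j), (k, l))" by (metis surj_pair)
      ultimately show "(\<Sum>g\<in>?G. ?w g * (case e of ((i, j), (k, l)) \<Rightarrow> of_bool (Q g i j k l))) \<le> F"
        using pair[of i j k l] by simp
    qed
    also have "\<dots> = real (card ?N) * F" by simp
    also have "\<dots> \<le> real r ^ 4 * F"
    proof (rule mult_right_mono)
      show "real (card ?N) \<le> real r ^ 4" using cN by (metis of_nat_le_iff of_nat_power)
      show "0 \<le> F" unfolding F_def by (intro sum_nonneg) auto
    qed
    finally show False by simp
  qed
  then obtain g where g: "g \<in> ?G" "(\<Sum>((i, j), (k, l))\<in>?N. of_bool (Q g i j k l)) \<le> real r ^ 4 * F" by blast
  have mem: "g (i, j) \<in> V \<times> I" if "i \<le> j" "j < r" for i j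
    using g(1) that by (auto simp: PiE_iff J_def A_def)
  have "real (card {e \<in> ?N. case e of ((i, j), (k, l)) \<Rightarrow> Q g i j k l}) =
      (\<Sum>((i, j), (k, l))\<in>?N. of_bool (Q g i j k l))"
    unfolding card_filter_eq_sum[OF finN] of_nat_sum by (intro sum.cong refl) (auto split: prod.splits)
  with g(2) have "real (card {e \<in> ?N. case e of ((i, j), (k, l)) \<Rightarrow> Q g i j k l}) \<le> real r ^ 4 * F" by simp
  then show ?thesis
    unfolding Q_def P_def
    using mem by (intro exI[of _ "\<lambda>i. fst (g (i, i))"] exI[of _ "\<lambda>i. snd (g (i, i))"]
        exI[of _ "\<lambda>i j. fst (g (min i j, max i j))"])
      (auto simp: mem_Times_iff min.commute max.commute)
qed

section \<open>Annuli of the weighted region metric\<close>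

text \<open>The regions act as strings of integer length \<open>w\<close>. By \<open>cover\<close>,
  crossing a host edge costs no more than one region, so points joined in the host are at finite
  distance.\<close>

locale strings =
  fixes E :: "'b \<Rightarrow> 'b \<Rightarrow> bool" and V :: "'a set" and R :: "'a \<Rightarrow> 'b set" and w :: "'a \<Rightarrow> nat"
  assumes symE: "symp E"
    and cover: "\<And>y z. E y z \<Longrightarrow> \<exists>v\<in>V. y \<in> R v \<and> z \<in> R v"
    and w_pos: "\<And>v. v \<in> V \<Longrightarrow> w v > 0"
    and conn_R: "\<And>v. v \<in> V \<Longrightarrow> conn E (R v)"
begin

text \<open>
  A step of cost \<open>w v\<close> moves inside one connected piece of \<open>R v \<inter> Y\<close>. If \<open>Y\<close> cuts \<open>R v\<close> into several
  pieces, each of them is a step of its own. This lets the annulus argument run in the host graph,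
  where branch sets only have to be disjoint, although the weights live on the regions.
\<close>

inductive hop :: "'b set \<Rightarrow> 'b \<Rightarrow> nat \<Rightarrow> 'b \<Rightarrow> bool" for Y x where
  hop_refl: "x \<in> Y \<Longrightarrow> hop Y x 0 x"
| hop_step: "hop Y x n y \<Longrightarrow> v \<in> V \<Longrightarrow> y \<in> R v \<Longrightarrow> reach E (R v \<inter> Y) y z \<Longrightarrow> hop Y x (n + w v) z"

text \<open>Without any \<open>hop\<close> between the points, \<open>LEAST\<close> yields an
  unspecified number; distances are used only inside sets with \<open>conn E Y\<close>.\<close>

definition hdist :: "'b set \<Rightarrow> 'b \<Rightarrow> 'b \<Rightarrow> nat" where
  "hdist Y x y = (LEAST n. hop Y x n y)"

lemma hop_in: "hop Y x n y \<Longrightarrow> x \<in> Y \<and> y \<in> Y"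
  by (induction rule: hop.induct) (auto dest: reach_in)

lemma hop_single:
  "v \<in> V \<Longrightarrow> y \<in> R v \<Longrightarrow> y \<in> Y \<Longrightarrow> reach E (R v \<inter> Y) y z \<Longrightarrow> hop Y y (w v) z"
  using hop_step[OF hop_refl, of y Y v z] by simp

lemma hop_trans: "hop Y y m z \<Longrightarrow> hop Y x n y \<Longrightarrow> hop Y x (n + m) z"
proof (induction rule: hop.induct)
  case (hop_step m u v z)
  then show ?case using hop.hop_step[of Y x "n + m" u v z] by (simp add: add.assoc)
qed simp

lemma hop_sym: "hop Y x n y \<Longrightarrow> hop Y y n x"
proof (induction rule: hop.induct)
  case (hop_step n y v z)
  have y: "y \<in> R v \<inter> Y" using hop_step hop_in by blast
  then have z: "z \<in> R v \<inter> Y" using hop_step.hyps(4) by (meson reach_in)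
  have "reach E (R v \<inter> Y) z y" using hop_step.hyps(4) symE by (rule reach_sym)
  then have "hop Y z (w v) y" using z hop_step.hyps(2) by (intro hop_single) auto
  then show ?case using hop_trans[OF hop_step.IH, of z "w v"] by (simp add: add.commute)
qed (rule hop_refl)

lemma hop_mono: "hop Y x n y \<Longrightarrow> Y \<subseteq> Y' \<Longrightarrow> hop Y' x n y"
proof (induction rule: hop.induct)
  case (hop_step n y v z)
  then have "reach E (R v \<inter> Y') y z" by (meson Int_mono reach_mono subset_refl)
  then show ?case using hop_step by (intro hop.hop_step) auto
qed (auto intro: hop_refl)

lemma hop_reach:
  assumes "reach E Y x y" "x \<in> Y"
  shows "\<exists>n. hop Y x n y"
  using assms(1)
proof (induction rule: reach_induct)
  case base
  show ?case using assms(2) hop_refl by blast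
next
  case (step u v)
  then obtain n where n: "hop Y x n u" by blast
  obtain s where s: "s \<in> V" "u \<in> R s" "v \<in> R s" using cover step by blast
  have "reach E (R s \<inter> Y) u v" using s step by (intro reach_edge) auto
  then show ?case using hop_step[OF n s(1,2)] by blast
qed

lemma hdist_le: "hop Y x n y \<Longrightarrow> hdist Y x y \<le> n"
  unfolding hdist_def by (rule Least_le)

lemma hop_hdist:
  assumes "conn E Y" "x \<in> Y" "y \<in> Y"
  shows "hop Y x (hdist Y x y) y"
proof -
  obtain n where "hop Y x n y" using hop_reach[OF connD[OF assms] assms(2)] by blast
  then show ?thesis unfolding hdist_def by (rule LeastI)
qed

lemma hdist_hop_le:
  assumes "conn E Y" "z \<in> Y" "hop Y x n y"
  shows "hdist Y z y \<le> hdist Y z x + n"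
  using hop_trans[OF assms(3) hop_hdist[OF assms(1,2)]] hop_in[OF assms(3)] by (auto intro: hdist_le)

text \<open>A prefix of a cheapest walk is cheapest: a cheaper way to its last stop would shorten
  the whole walk.\<close>

lemma hdist_pred:
  assumes Y: "conn E Y" "r \<in> Y" "x \<in> Y" and pos: "hdist Y r x > 0"
  obtains y v where "v \<in> V" "y \<in> Y" "y \<in> R v" "reach E (R v \<inter> Y) y x"
    "hdist Y r x = hdist Y r y + w v"
proof -
  from hop_hdist[OF Y] show thesis
  proof (cases rule: hop.cases)
    case hop_refl
    then show thesis using pos by simp
  next
    case (hop_step n y v)
    have y: "y \<in> Y" using hop_in hop_step by blast
    have "hop Y y (w v) x" using hop_step y by (intro hop_single)
    then have "hdist Y r x \<le> hdist Y r y + w v" using hdist_hop_le[OF Y(1,2)] by blast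
    moreover have "hdist Y r y \<le> n" using hop_step hdist_le by blast
    ultimately show thesis using that[of v y] hop_step y by linarith
  qed
qed

text \<open>Descent along predecessors to the root. The last step runs in a piece all of whose
  points cost at most \<open>hdist Y r y\<close>, so it does not leave the sublevel set; positive
  weights make the induction terminate.\<close>

lemma conn_sublevel:
  assumes Y: "conn E Y" "r \<in> Y"
  shows "conn E {y \<in> Y. hdist Y r y < t}"
proof (rule connI_from[OF symE, where x = r])
  fix y assume "y \<in> {y \<in> Y. hdist Y r y < t}"
  then show "reach E {y \<in> Y. hdist Y r y < t} r y"
  proof (induction "hdist Y r y" arbitrary: y rule: less_induct)
    case less
    then have y: "y \<in> Y" "hdist Y r y < t" by auto
    show ?case
    proof (cases "hdist Y r y = 0")
      case True
      then have "hop Y r 0 y" using hop_hdist[OF Y y(1)] by simp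
      then have "y = r"
      proof (cases rule: hop.cases)
        case (hop_step n u v)
        then show ?thesis using w_pos[of v] by simp
      qed auto
      then show ?thesis by simp
    next
      case False
      then have pos: "hdist Y r y > 0" by simp
      obtain u v where u: "v \<in> V" "u \<in> Y" "u \<in> R v" "reach E (R v \<inter> Y) u y"
          "hdist Y r y = hdist Y r u + w v"
        by (rule hdist_pred[OF Y y(1) pos])
      have "reach E {y \<in> Y. hdist Y r y < t} r u"
        using less.hyps[of u] u w_pos[OF u(1)] y(2) by simp
      moreover have "comp E (R v \<inter> Y) u \<subseteq> {y \<in> Y. hdist Y r y < t}"
      proof
        fix z assume "z \<in> comp E (R v \<inter> Y) u"
        then have "hop Y u (w v) z" using u by (intro hop_single) (auto simp: comp_def)
        from hdist_hop_le[OF Y this] hop_in[OF this] show "z \<in> {y \<in> Y. hdist Y r y < t}"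
          using u(5) y(2) by simp
      qed
      then have "reach E {y \<in> Y. hdist Y r y < t} u y"
        by (rule reach_mono[OF reach_comp[OF u(4)]])
      ultimately show ?thesis by (rule reach_trans)
    qed
  qed
qed

text \<open>Distances in the conclusion are measured inside \<open>\<Gamma>\<close> itself, so the bound survives in every
  subset of \<open>Y\<close> that contains \<open>\<Gamma>\<close>, in particular in the annulus component around \<open>x\<close>.\<close>

lemma descend:
  assumes Y: "conn E Y" "r \<in> Y" and w: "\<And>v. v \<in> V \<Longrightarrow> w v \<le> D"
    and x: "x \<in> Y" "hdist Y r x \<ge> t" "t > 0"
  shows "\<exists>\<Gamma> z. x \<in> \<Gamma> \<and> \<Gamma> \<subseteq> Y \<and> conn E \<Gamma> \<and>
    (\<forall>p\<in>\<Gamma>. t \<le> hdist Y r p \<and> hdist Y r p \<le> hdist Y r x \<and>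
       (\<exists>n. n + t \<le> hdist Y r x + D \<and> hop \<Gamma> x n p)) \<and>
    z \<in> Y \<and> hdist Y r z < t \<and> t \<le> hdist Y r z + D \<and> (\<exists>p\<in>\<Gamma>. E p z)"
  using x
proof (induction "hdist Y r x" arbitrary: x rule: less_induct)
  case less
  let ?f = "hdist Y r"
  have pos: "?f x > 0" using less.prems by simp
  obtain y v where y: "v \<in> V" "y \<in> Y" "y \<in> R v" "reach E (R v \<inter> Y) y x" "?f x = ?f y + w v"
    by (rule hdist_pred[OF Y less.prems(1) pos])
  have xy: "reach E (R v \<inter> Y) x y" using y(4) symE by (rule reach_sym)
  have xR: "x \<in> R v" using reach_in[OF y(4)] y(2,3) by simp
  define T where "T = {p. t \<le> ?f p}"
  \<comment> \<open>The part of the last piece around \<open>x\<close> that stays at level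
    \<open>t\<close> or above. It lies no higher than \<open>x\<close>, since one step from the
    predecessor \<open>y\<close> reaches all of it.\<close>
  define B where "B = comp E (R v \<inter> Y \<inter> T) x"
  have xB: "x \<in> R v \<inter> Y \<inter> T" using xR less.prems by (simp add: T_def)
  have BR: "B \<subseteq> R v \<inter> Y \<inter> T" unfolding B_def using xB by (rule comp_subset)
  have cB: "conn E B" unfolding B_def by (rule conn_comp[OF symE])
  have hopB: "hop B x (w v) p" if "p \<in> B" for p
  proof (rule hop_single[OF y(1) xR])
    show "x \<in> B" by (simp add: B_def)
    have "reach E B x p" using cB that \<open>x \<in> B\<close> by (meson connD)
    then show "reach E (R v \<inter> B) x p" by (rule reach_mono) (use BR in auto)
  qed
  have fB: "t \<le> ?f p \<and> ?f p \<le> ?f x" if "p \<in> B" for p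
  proof -
    have "reach E (R v \<inter> Y) x p" using that unfolding B_def comp_def by (auto intro: reach_mono)
    then have "reach E (R v \<inter> Y) y p" using y(4) by (blast intro: reach_trans)
    then have "hop Y y (w v) p" using y by (intro hop_single)
    from hdist_hop_le[OF Y this] have "?f p \<le> ?f x" using y(5) by simp
    then show ?thesis using BR that by (auto simp: T_def)
  qed
  show ?case
  proof (cases "y \<in> B")
    case True
    \<comment> \<open>The predecessor is joined to \<open>x\<close> within \<open>B\<close>, so the
      descent continues from \<open>y\<close>. The step costs exactly the drop in level, hence the
      bound on \<open>n\<close> carries over.\<close>
    have "?f y < ?f x" using y(5) w_pos[OF y(1)] by simp
    moreover have "t \<le> ?f y" using fB[OF True] by simp
    ultimately obtain \<Gamma> z where G: "y \<in> \<Gamma>" "\<Gamma> \<subseteq> Y" "conn E \<Gamma>"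
      "\<And>p. p \<in> \<Gamma> \<Longrightarrow> t \<le> ?f p \<and> ?f p \<le> ?f y \<and> (\<exists>n. n + t \<le> ?f y + D \<and> hop \<Gamma> y n p)"
      "z \<in> Y" "?f z < t" "t \<le> ?f z + D" "\<exists>p\<in>\<Gamma>. E p z"
      using less.hyps[OF _ y(2) _ less.prems(3)] by blast
    have "conn E (B \<union> \<Gamma>)" using conn_Un[OF symE cB G(3) True G(1)] by simp
    moreover have "\<exists>n. n + t \<le> ?f x + D \<and> hop (B \<union> \<Gamma>) x n p" if pBG: "p \<in> B \<union> \<Gamma>" for p
    proof (cases "p \<in> B")
      case True
      then have "hop (B \<union> \<Gamma>) x (w v) p" using hopB hop_mono by (meson sup_ge1)
      moreover have "w v + t \<le> ?f x + D" using w[OF y(1)] less.prems(2) by simp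
      ultimately show ?thesis by blast
    next
      case False
      then obtain n where n: "n + t \<le> ?f y + D" "hop \<Gamma> y n p" using G(4)[of p] pBG by blast
      have "hop (B \<union> \<Gamma>) y n p" using n(2) by (rule hop_mono) simp
      moreover have "hop (B \<union> \<Gamma>) x (w v) y" using hopB[OF True] by (rule hop_mono) simp
      ultimately have "hop (B \<union> \<Gamma>) x (w v + n) p" by (rule hop_trans)
      then show ?thesis using n(1) y(5) by (intro exI[of _ "w v + n"]) simp
    qed
    moreover have "t \<le> ?f p \<and> ?f p \<le> ?f x" if "p \<in> B \<union> \<Gamma>" for p
    proof (cases "p \<in> B")
      case False
      with that have "p \<in> \<Gamma>" by simp
      from G(4)[OF this] \<open>?f y < ?f x\<close> show ?thesis by linarith
    qed (rule fB)
    moreover have "x \<in> B \<union> \<Gamma>" "B \<union> \<Gamma> \<subseteq> Y" using BR G by (auto simp: B_def)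
    ultimately show ?thesis using G(5-8) by (intro exI[of _ "B \<union> \<Gamma>"] exI[of _ z]) blast
  next
    case False
    then have nT: "\<not> reach E (R v \<inter> Y \<inter> T) x y" by (simp add: B_def comp_def)
    \<comment> \<open>The walk from \<open>x\<close> to \<open>y\<close> leaves \<open>B\<close>,
      and by maximality of \<open>B\<close> its exit point \<open>z\<close> is below level
      \<open>t\<close>. One step of cost \<open>w v\<close> leads from \<open>z\<close> back to
      \<open>B\<close>, so \<open>z\<close> is at most \<open>D\<close> below
      \<open>t\<close>.\<close>
    have "\<exists>p z. p \<in> B \<and> z \<in> R v \<inter> Y \<and> z \<notin> T \<and> E p z"
    proof (rule reach_first_exit[OF xy, of B])
      show "x \<in> R v \<inter> Y" using xB by blast
      show "x \<in> B" by (simp add: B_def)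
      show "y \<notin> B" by fact
      fix p z assume pz: "p \<in> R v \<inter> Y \<inter> B" "z \<in> R v \<inter> Y - B" "E p z"
      have "z \<notin> T"
      proof
        assume "z \<in> T"
        then have "reach E (R v \<inter> Y \<inter> T) p z" using pz BR by (intro reach_edge) auto
        then have "z \<in> B" using pz(1) by (auto simp: B_def comp_def intro: reach_trans)
        then show False using pz by blast
      qed
      then show "\<exists>p z. p \<in> B \<and> z \<in> R v \<inter> Y \<and> z \<notin> T \<and> E p z" using pz by blast
    qed
    then obtain p z where pz: "p \<in> B" "z \<in> R v \<inter> Y" "z \<notin> T" "E p z" by blast
    have "hop Y z (w v) p" using pz BR y(1) symE by (intro hop_single reach_edge) (auto dest: sympD)
    then have "?f p \<le> ?f z + D" using hdist_hop_le[OF Y, of z "w v" p] w[OF y(1)] by linarith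
    then have "t \<le> ?f z + D" using fB[OF pz(1)] by linarith
    moreover have "w v + t \<le> ?f x + D" using w[OF y(1)] less.prems(2) by simp
    ultimately show ?thesis using pz hopB fB cB BR xB
      by (intro exI[of _ B] exI[of _ z]) (auto simp: T_def B_def not_le)
  qed
qed

lemma hop_edge:
  assumes "E y z" "y \<in> Y" "z \<in> Y" and "\<And>v. v \<in> V \<Longrightarrow> w v \<le> D"
  shows "\<exists>n\<le>D. hop Y y n z"
proof -
  obtain v where v: "v \<in> V" "y \<in> R v" "z \<in> R v" using cover assms(1) by blast
  then have "reach E (R v \<inter> Y) y z" using assms by (intro reach_edge) auto
  then have "hop Y y (w v) z" using v assms by (intro hop_single)
  then show ?thesis using assms(4)[OF v(1)] by blast
qed

text \<open>Three descents in succession, to the levels \<open>lo\<close>, \<open>lo - 2 * D\<close>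
  and \<open>lo - 5 * D\<close>. Only the first can meet \<open>Y'\<close>, which keeps the set
  close to \<open>x\<close> there. The handover point \<open>x'\<close> is where the second ends,
  and the third ends next to the set called \<open>U i\<close> below. Descents and connecting edges
  cost 2, 1, 3, 1 and 4 times \<open>D\<close>, in all \<open>11 * D\<close>.\<close>

lemma level_step:
  assumes Y: "conn E Y" "r \<in> Y" and w: "\<And>v. v \<in> V \<Longrightarrow> w v \<le> D" and D: "D > 0"
    and lo: "5 * D < lo" and hi: "hi \<le> lo + D"
    and Y': "\<And>y. y \<in> Y' \<Longrightarrow> lo \<le> hdist Y r y \<and> hdist Y r y < hi"
      "\<And>y z. y \<in> Y' \<Longrightarrow> z \<in> Y \<Longrightarrow> E y z \<Longrightarrow> lo \<le> hdist Y r z \<Longrightarrow> hdist Y r z < hi \<Longrightarrow> z \<in> Y'"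
    and x: "x \<in> Y'" "x \<in> Y"
  shows "\<exists>\<Gamma> x'. x \<in> \<Gamma> \<and> x' \<in> \<Gamma> \<and> \<Gamma> \<subseteq> Y \<and> conn E \<Gamma> \<and>
    lo \<le> hdist Y r x' + 3 * D \<and> hdist Y r x' + 2 * D < lo \<and>
    (\<forall>p\<in>\<Gamma>. lo \<le> hdist Y r p + 5 * D \<and> (\<exists>n\<le>11 * D. hop Y x n p)) \<and>
    (\<forall>p\<in>\<Gamma> \<inter> Y'. \<exists>n<2 * D. hop Y' x n p) \<and>
    (\<exists>p\<in>\<Gamma>. \<exists>z\<in>Y. hdist Y r z + 5 * D < lo \<and> E p z)"
proof -
  let ?f = "hdist Y r"
  have fx: "lo \<le> ?f x" "?f x < lo + D" using Y'(1)[OF x(1)] hi by auto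
  have lo0: "lo > 0" using lo by simp
  obtain G1 z1 p1 where G1: "x \<in> G1" "G1 \<subseteq> Y" "conn E G1"
      "\<And>p. p \<in> G1 \<Longrightarrow> lo \<le> ?f p \<and> ?f p \<le> ?f x \<and> (\<exists>n. n + lo \<le> ?f x + D \<and> hop G1 x n p)"
      "z1 \<in> Y" "?f z1 < lo" "lo \<le> ?f z1 + D" "p1 \<in> G1" "E p1 z1"
    using descend[OF Y w x(2) fx(1) lo0] by blast
  have t2: "lo - 2 * D \<le> ?f z1" "0 < lo - 2 * D" using G1(7) lo by auto
  obtain G2 z2 p2 where G2: "z1 \<in> G2" "G2 \<subseteq> Y" "conn E G2"
      "\<And>p. p \<in> G2 \<Longrightarrow> lo - 2 * D \<le> ?f p \<and> ?f p \<le> ?f z1 \<and>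
        (\<exists>n. n + (lo - 2 * D) \<le> ?f z1 + D \<and> hop G2 z1 n p)"
      "z2 \<in> Y" "?f z2 < lo - 2 * D" "lo - 2 * D \<le> ?f z2 + D" "p2 \<in> G2" "E p2 z2"
    using descend[OF Y w G1(5) t2] by blast
  have t3: "lo - 5 * D \<le> ?f z2" "0 < lo - 5 * D" using G2(7) lo by auto
  obtain G3 z3 p3 where G3: "z2 \<in> G3" "G3 \<subseteq> Y" "conn E G3"
      "\<And>p. p \<in> G3 \<Longrightarrow> lo - 5 * D \<le> ?f p \<and> ?f p \<le> ?f z2 \<and>
        (\<exists>n. n + (lo - 5 * D) \<le> ?f z2 + D \<and> hop G3 z2 n p)"
      "z3 \<in> Y" "?f z3 < lo - 5 * D" "p3 \<in> G3" "E p3 z3"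
    using descend[OF Y w G2(5) t3] by blast
  define G where "G = G1 \<union> G2 \<union> G3"
  have "conn E (G1 \<union> G2)" using conn_Un[OF symE G1(3) G2(3) G1(8) G2(1)] G1(9) by simp
  then have cG: "conn E G" unfolding G_def using conn_Un[OF symE _ G3(3) _ G3(1), of "G1 \<union> G2" p2] G2(8,9) by simp
  have h1: "\<exists>n<2 * D. hop G1 x n p" if "p \<in> G1" for p
  proof -
    obtain n where n: "n + lo \<le> ?f x + D" "hop G1 x n p" using G1(4)[OF \<open>p \<in> G1\<close>] by blast
    then show ?thesis using fx by (intro exI[of _ n]) simp
  qed
  have hz1: "\<exists>n\<le>3 * D. hop Y x n z1"
  proof -
    obtain n where n: "n < 2 * D" "hop G1 x n p1" using h1[OF G1(8)] by blast
    have "p1 \<in> Y" using G1(2,8) by blast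
    then obtain m where m: "m \<le> D" "hop Y p1 m z1" using hop_edge[OF G1(9) _ G1(5) w] by blast
    have "hop Y x n p1" using n(2) G1(2) by (rule hop_mono)
    then have "hop Y x (n + m) z1" using hop_trans[OF m(2)] by blast
    then show ?thesis using n(1) m(1) by (intro exI[of _ "n + m"]) simp
  qed
  have h2: "\<exists>n\<le>6 * D. hop Y x n p" if "p \<in> G2" for p
  proof -
    obtain n where n: "n + (lo - 2 * D) \<le> ?f z1 + D" "hop G2 z1 n p" using G2(4)[OF \<open>p \<in> G2\<close>] by blast
    obtain m where m: "m \<le> 3 * D" "hop Y x m z1" using hz1 by blast
    have "hop Y z1 n p" using n(2) G2(2) by (rule hop_mono)
    then have "hop Y x (m + n) p" using m(2) by (rule hop_trans)
    moreover have "n \<le> 3 * D" using n(1) G1(6) lo by linarith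
    ultimately show ?thesis using m(1) by (intro exI[of _ "m + n"]) simp
  qed
  have hz2: "\<exists>n\<le>7 * D. hop Y x n z2"
  proof -
    obtain n where n: "n \<le> 6 * D" "hop Y x n p2" using h2[OF G2(8)] by blast
    have "p2 \<in> Y" using G2(2,8) by blast
    then obtain m where m: "m \<le> D" "hop Y p2 m z2" using hop_edge[OF G2(9) _ G2(5) w] by blast
    have "hop Y x (n + m) z2" using hop_trans[OF m(2) n(2)] .
    then show ?thesis using n(1) m(1) by (intro exI[of _ "n + m"]) simp
  qed
  have h3: "\<exists>n\<le>11 * D. hop Y x n p" if "p \<in> G3" for p
  proof -
    obtain n where n: "n + (lo - 5 * D) \<le> ?f z2 + D" "hop G3 z2 n p" using G3(4)[OF \<open>p \<in> G3\<close>] by blast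
    obtain m where m: "m \<le> 7 * D" "hop Y x m z2" using hz2 by blast
    have "hop Y z2 n p" using n(2) G3(2) by (rule hop_mono)
    then have "hop Y x (m + n) p" using m(2) by (rule hop_trans)
    moreover have "n \<le> 4 * D" using n(1) G2(6) lo by linarith
    ultimately show ?thesis using m(1) by (intro exI[of _ "m + n"]) simp
  qed
  have G1Y': "G1 \<subseteq> Y'"
  proof
    fix p assume "p \<in> G1"
    then have "reach E G1 x p" using G1(1,3) by (meson connD)
    then show "p \<in> Y'"
    proof (induction rule: reach_induct)
      case (step u v)
      have "v \<in> Y" using step G1(2) by blast
      moreover have "lo \<le> ?f v" "?f v < hi" using G1(4)[OF step.hyps(4)] Y'(1)[OF x(1)] by auto
      ultimately show ?case using Y'(2)[OF step.IH] step.hyps by blast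
    qed (rule x(1))
  qed
  have far: "p \<notin> Y'" if "p \<in> G2 \<union> G3" for p
  proof
    assume "p \<in> Y'"
    then have "lo \<le> ?f p" using Y'(1) by blast
    moreover have "?f p < lo"
      using that G2(4)[of p] G3(4)[of p] G1(6) G2(6) by (elim UnE) linarith+
    ultimately show False by simp
  qed
  have a1: "\<exists>n\<le>11 * D. hop Y x n p" if "p \<in> G" for p
  proof -
    consider "p \<in> G1" | "p \<in> G2" | "p \<in> G3" using \<open>p \<in> G\<close> by (auto simp: G_def)
    then show ?thesis
    proof cases
      case 1
      then obtain n where "n < 2 * D" "hop G1 x n p" using h1 by blast
      then have "hop Y x n p" "n \<le> 11 * D" using G1(2) hop_mono by auto
      then show ?thesis by blast
    next
      case 2
      then obtain n where "n \<le> 6 * D" "hop Y x n p" using h2 by blast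
      then have "n \<le> 11 * D" by simp
      with \<open>hop Y x n p\<close> show ?thesis by blast
    qed (rule h3)
  qed
  have a2: "lo \<le> ?f p + 5 * D" if "p \<in> G" for p
  proof -
    consider "p \<in> G1" | "p \<in> G2" | "p \<in> G3" using \<open>p \<in> G\<close> by (auto simp: G_def)
    then show ?thesis
    proof cases
      case 1
      from G1(4)[OF this] show ?thesis by linarith
    next
      case 2
      from G2(4)[OF this] show ?thesis by linarith
    next
      case 3
      from G3(4)[OF this] show ?thesis by linarith
    qed
  qed
  have a3: "\<exists>n<2 * D. hop Y' x n p" if "p \<in> G \<inter> Y'" for p
  proof -
    have "p \<in> G1" using that far by (auto simp: G_def)
    then obtain n where "n < 2 * D" "hop G1 x n p" using h1 by blast
    then show ?thesis using hop_mono[OF _ G1Y'] by blast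
  qed
  have "x \<in> G" "z2 \<in> G" "G \<subseteq> Y" "p3 \<in> G" using G1 G2 G3 by (auto simp: G_def)
  moreover have "lo \<le> ?f z2 + 3 * D" "?f z2 + 2 * D < lo" "?f z3 + 5 * D < lo"
    using G2(6,7) G3(6) by linarith+
  ultimately show ?thesis using a1 a2 a3 cG G3(5,8)
    by (intro exI[of _ G] exI[of _ z2]) blast
qed

text \<open>
  The Klein-Plotkin-Rao construction: \<open>U i\<close> is the part of level \<open>i\<close> well below the annulus, and \<open>B b\<close>
  descends from the far point \<open>y b\<close> through all levels, touching every \<open>U i\<close>. At each level it stops
  midway between the annulus and \<open>U i\<close>, so that the start of the next, coarser piece, which may still
  run inside \<open>Y i\<close>, avoids everything built at deeper levels. The sets \<open>B b \<union> U b\<close> are then pairwise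
  disjoint and adjacent.
\<close>

lemma annuli_clique_model:
  fixes Y :: "nat \<Rightarrow> 'b set" and lo hi :: "nat \<Rightarrow> nat"
  assumes w: "\<And>v. v \<in> V \<Longrightarrow> w v \<le> D" and D: "D > 0" and h: "h \<ge> 2"
    and Yc: "\<And>i. i < h \<Longrightarrow> conn E (Y i)" and r: "\<And>i. i < h \<Longrightarrow> r i \<in> Y i"
    and hi: "\<And>i. i < h \<Longrightarrow> hi i \<le> lo i + D"
    and Ysub: "\<And>i. i < h \<Longrightarrow> Y (Suc i) \<subseteq> Y i"
    and ann: "\<And>i y. i < h \<Longrightarrow> y \<in> Y (Suc i) \<Longrightarrow> lo i \<le> hdist (Y i) (r i) y \<and> hdist (Y i) (r i) y < hi i"
    and cl: "\<And>i y z. i < h \<Longrightarrow> y \<in> Y (Suc i) \<Longrightarrow> z \<in> Y i \<Longrightarrow> E y z \<Longrightarrow>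
        lo i \<le> hdist (Y i) (r i) z \<Longrightarrow> hdist (Y i) (r i) z < hi i \<Longrightarrow> z \<in> Y (Suc i)"
    and y: "\<And>b. b < h \<Longrightarrow> y b \<in> Y h"
    and far: "\<And>b c n. b < h \<Longrightarrow> c < h \<Longrightarrow> b \<noteq> c \<Longrightarrow> hop (Y 0) (y b) n (y c) \<Longrightarrow> 22 * h * D < n"
  shows "\<exists>M. clique_model E (Y 0) h M"
proof -
  let ?f = "\<lambda>i. hdist (Y i) (r i)"
  have mono: "Y j \<subseteq> Y i" if "i \<le> j" "j \<le> h" for i j
    using that
  proof (induction j rule: dec_induct)
    case (step n)
    then show ?case using Ysub[of n] by auto
  qed simp
  \<comment> \<open>Two far points share this annulus and are joined through the root
    \<open>r i\<close>, so twice its outer radius exceeds \<open>22 * h * D\<close>. This leaves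
    room for a descent by \<open>5 * D\<close>.\<close>
  have lo: "5 * D < lo i" if i: "i < h" for i
  proof -
    have y01: "y 0 \<in> Y (Suc i)" "y 1 \<in> Y (Suc i)" using y[of 0] y[of 1] h mono[of "Suc i" h] i by auto
    then have "y 0 \<in> Y i" "y 1 \<in> Y i" using Ysub[OF i] by auto
    then have "hop (Y i) (r i) (?f i (y 0)) (y 0)" "hop (Y i) (r i) (?f i (y 1)) (y 1)"
      using hop_hdist[OF Yc[OF i] r[OF i]] by auto
    then have "hop (Y i) (y 0) (?f i (y 0) + ?f i (y 1)) (y 1)" by (meson hop_sym hop_trans)
    then have "hop (Y 0) (y 0) (?f i (y 0) + ?f i (y 1)) (y 1)"
      by (rule hop_mono) (use mono[of 0 i] i in auto)
    then have "22 * h * D < ?f i (y 0) + ?f i (y 1)" using far[of 0 1] h by auto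
    also have "\<dots> < 2 * (lo i + D)" using ann[OF i y01(1)] ann[OF i y01(2)] hi[OF i] by auto
    finally have "22 * h * D < 2 * (lo i + D)" .
    moreover have "22 * (2 * D) \<le> 22 * h * D" using h by simp
    ultimately have "22 * (2 * D) < 2 * (lo i + D)" by (rule le_less_trans[rotated])
    then show ?thesis by simp
  qed
  define St where "St i x \<Gamma> x' \<longleftrightarrow> x \<in> \<Gamma> \<and> x' \<in> \<Gamma> \<and> \<Gamma> \<subseteq> Y i \<and> conn E \<Gamma> \<and>
    lo i \<le> ?f i x' + 3 * D \<and> ?f i x' + 2 * D < lo i \<and>
    (\<forall>p\<in>\<Gamma>. lo i \<le> ?f i p + 5 * D \<and> (\<exists>n\<le>11 * D. hop (Y i) x n p)) \<and>
    (\<forall>p\<in>\<Gamma> \<inter> Y (Suc i). \<exists>n<2 * D. hop (Y (Suc i)) x n p) \<and>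
    (\<exists>p\<in>\<Gamma>. \<exists>z\<in>Y i. ?f i z + 5 * D < lo i \<and> E p z)" for i x \<Gamma> x'
  have "\<exists>\<Gamma> x'. St i x \<Gamma> x'" if i: "i < h" and x: "x \<in> Y (Suc i)" for i x
    unfolding St_def
    by (rule level_step[OF Yc[OF i] r[OF i] w D lo[OF i] hi[OF i] ann[OF i] cl[OF i] x subsetD[OF Ysub[OF i] x]])
  then obtain \<Gamma> nx where stp: "\<And>i x. i < h \<Longrightarrow> x \<in> Y (Suc i) \<Longrightarrow> St i x (\<Gamma> i x) (nx i x)"
    by metis
  \<comment> \<open>The recursion runs outwards from the innermost set: \<open>xs b h\<close> is
    \<open>y b\<close>, and \<open>xs b i\<close> is the point of \<open>Y i\<close> that level
    \<open>i\<close> hands over to level \<open>i - 1\<close>.\<close>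
  define X where "X b = rec_nat (y b) (\<lambda>k x. nx (h - Suc k) x)" for b
  define xs where "xs b i = X b (h - i)" for b i
  have xs_h: "xs b h = y b" for b by (simp add: xs_def X_def)
  have xs_i: "xs b i = nx i (xs b (Suc i))" if "i < h" for b i
  proof -
    have "h - i = Suc (h - Suc i)" "h - Suc (h - Suc i) = i" using that by auto
    then show ?thesis by (simp add: xs_def X_def)
  qed
  have xsY: "xs b i \<in> Y i" if "i \<le> h" "b < h" for b i
    using that(1)
  proof (induction i rule: inc_induct)
    case base
    show ?case using y that by (simp add: xs_h)
  next
    case (step n)
    from stp[OF step.hyps(2) step.IH, unfolded St_def] have "nx n (xs b (Suc n)) \<in> Y n" by (blast intro: subsetD)
    then show ?case using xs_i[OF step.hyps(2)] by simp
  qed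
  define Gm where "Gm b i = \<Gamma> i (xs b (Suc i))" for b i
  have Gm: "xs b (Suc i) \<in> Gm b i" "xs b i \<in> Gm b i" "Gm b i \<subseteq> Y i" "conn E (Gm b i)"
      "lo i \<le> ?f i (xs b i) + 3 * D" "?f i (xs b i) + 2 * D < lo i"
      "\<And>p. p \<in> Gm b i \<Longrightarrow> lo i \<le> ?f i p + 5 * D"
      "\<And>p. p \<in> Gm b i \<Longrightarrow> \<exists>n\<le>11 * D. hop (Y i) (xs b (Suc i)) n p"
      "\<And>p. p \<in> Gm b i \<Longrightarrow> p \<in> Y (Suc i) \<Longrightarrow> \<exists>n<2 * D. hop (Y (Suc i)) (xs b (Suc i)) n p"
      "\<exists>p\<in>Gm b i. \<exists>z\<in>Y i. ?f i z + 5 * D < lo i \<and> E p z"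
    if "i < h" "b < h" for b i
  proof -
    have "xs b (Suc i) \<in> Y (Suc i)" using xsY that by simp
    note st = stp[OF that(1) this, folded Gm_def xs_i[OF that(1)], unfolded St_def]
    show "xs b (Suc i) \<in> Gm b i" "xs b i \<in> Gm b i" "Gm b i \<subseteq> Y i" "conn E (Gm b i)"
      "lo i \<le> ?f i (xs b i) + 3 * D" "?f i (xs b i) + 2 * D < lo i"
      "\<exists>p\<in>Gm b i. \<exists>z\<in>Y i. ?f i z + 5 * D < lo i \<and> E p z"
      using st by simp_all
    fix p assume "p \<in> Gm b i"
    then show "lo i \<le> ?f i p + 5 * D" "\<exists>n\<le>11 * D. hop (Y i) (xs b (Suc i)) n p"
      "p \<in> Y (Suc i) \<Longrightarrow> \<exists>n<2 * D. hop (Y (Suc i)) (xs b (Suc i)) n p"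
      using st by simp_all
  qed
  have distG: "\<exists>n\<le>(h - i) * (11 * D). hop (Y 0) (y b) n p" if i: "i < h" and b: "b < h" and p: "p \<in> Gm b i"
      and IH: "\<exists>n\<le>(h - Suc i) * (11 * D). hop (Y 0) (y b) n (xs b (Suc i))" for b i p
  proof -
    obtain n where n: "n \<le> (h - Suc i) * (11 * D)" "hop (Y 0) (y b) n (xs b (Suc i))" using IH by blast
    obtain m where m: "m \<le> 11 * D" "hop (Y i) (xs b (Suc i)) m p" using Gm(8)[OF i b p] by blast
    have "hop (Y 0) (xs b (Suc i)) m p" by (rule hop_mono[OF m(2)]) (use mono[of 0 i] i in auto)
    then have "hop (Y 0) (y b) (n + m) p" using n(2) by (rule hop_trans)
    moreover have "h - i = Suc (h - Suc i)" using i by simp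
    then have "n + m \<le> (h - i) * (11 * D)" using n(1) m(1) by simp
    ultimately show ?thesis by blast
  qed
  have distX: "\<exists>n\<le>(h - i) * (11 * D). hop (Y 0) (y b) n (xs b i)" if "i \<le> h" and b: "b < h" for b i
    using that(1)
  proof (induction i rule: inc_induct)
    case base
    have "hop (Y 0) (y b) 0 (y b)" using y[OF b] mono[of 0 h] by (intro hop_refl) auto
    then show ?case by (auto simp: xs_h)
  next
    case (step n)
    then show ?case using distG[OF _ b Gm(2)[OF _ b]] by blast
  qed
  have distB: "\<exists>n\<le>11 * h * D. hop (Y 0) (y b) n p" if i: "i < h" and b: "b < h" and p: "p \<in> Gm b i" for b i p
  proof -
    obtain n where n: "n \<le> (h - i) * (11 * D)" "hop (Y 0) (y b) n p"
      using distG[OF i b p] distX[of "Suc i" b] i b by auto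
    have "(h - i) * (11 * D) \<le> h * (11 * D)" by (rule mult_le_mono1) simp
    also have "\<dots> = 11 * h * D" by simp
    finally have "n \<le> 11 * h * D" using n(1) by (rule order_trans[rotated])
    with n(2) show ?thesis by blast
  qed
  define B where "B b = (\<Union>i<h. Gm b i)" for b
  define U where "U i = {p \<in> Y i. ?f i p < lo i - 5 * D}" for i
  have cB: "conn E (B b)" if b: "b < h" for b
  proof (rule connI_from[OF symE, where x = "y b"])
    have sub: "Gm b i \<subseteq> B b" if "i < h" for i using that by (auto simp: B_def)
    have rx: "reach E (B b) (y b) (xs b i)" if "i \<le> h" for i
      using that
    proof (induction i rule: inc_induct)
      case (step n)
      have "reach E (Gm b n) (xs b (Suc n)) (xs b n)"
        using Gm(1,2,4)[OF step.hyps(2) b] by (meson connD)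
      then have "reach E (B b) (xs b (Suc n)) (xs b n)" using sub[OF step.hyps(2)] by (rule reach_mono)
      with step.IH show ?case by (rule reach_trans)
    qed (simp add: xs_h)
    fix p assume "p \<in> B b"
    then obtain i where i: "i < h" "p \<in> Gm b i" by (auto simp: B_def)
    have "reach E (Gm b i) (xs b (Suc i)) p" using Gm(1,4)[OF i(1) b] i(2) by (meson connD)
    then have "reach E (B b) (xs b (Suc i)) p" using sub[OF i(1)] by (rule reach_mono)
    with rx[of "Suc i"] i(1) show "reach E (B b) (y b) p" by (simp add: reach_trans)
  qed
  have GU: "Gm b i \<inter> U j = {}" if i: "i < h" and j: "j < h" and b: "b < h" for i j b
  proof (rule ccontr)
    assume "Gm b i \<inter> U j \<noteq> {}"
    then obtain p where p: "p \<in> Gm b i" "p \<in> Y j" "?f j p < lo j - 5 * D" by (auto simp: U_def)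
    have pi: "p \<in> Y i" using Gm(3)[OF i b] p by blast
    consider "j = i" | "j < i" | "i < j" by linarith
    then show False
    proof cases
      case 1
      then show False using Gm(7)[OF i b p(1)] p(3) by simp
    next
      case 2
      then have "p \<in> Y (Suc j)" using mono[of "Suc j" i] i pi by auto
      then show False using ann[OF j] p(3) by fastforce
    next
      case 3
      \<comment> \<open>Inside \<open>Y (Suc i)\<close> the piece stays within less than
        \<open>2 * D\<close> of \<open>xs b (Suc i)\<close>, whose level there is between
        \<open>lo - 3 * D\<close> and \<open>lo - 2 * D\<close>. So \<open>p\<close> lies strictly
        between \<open>lo - 5 * D\<close> and \<open>lo\<close>, which misses both
        \<open>U (Suc i)\<close> and \<open>Y (Suc (Suc i))\<close>.\<close>
      then have ps: "p \<in> Y (Suc i)" and sh: "Suc i < h" using mono[of "Suc i" j] j p by auto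
      obtain n where n: "n < 2 * D" "hop (Y (Suc i)) (xs b (Suc i)) n p" using Gm(9)[OF i b p(1) ps] by blast
      have f1: "?f (Suc i) p \<le> ?f (Suc i) (xs b (Suc i)) + n"
        by (rule hdist_hop_le[OF Yc[OF sh] r[OF sh] n(2)])
      have f2: "?f (Suc i) (xs b (Suc i)) \<le> ?f (Suc i) p + n"
        by (rule hdist_hop_le[OF Yc[OF sh] r[OF sh] hop_sym[OF n(2)]])
      show False
      proof (cases "j = Suc i")
        case True
        then show False using f2 n(1) Gm(5)[OF sh b] p(3) lo[OF sh] by simp
      next
        case False
        then have "p \<in> Y (Suc (Suc i))" using mono[of "Suc (Suc i)" j] j p(2) 3 by auto
        then have "lo (Suc i) \<le> ?f (Suc i) p" using ann[OF sh] by blast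
        then show False using f1 n(1) Gm(6)[OF sh b] by simp
      qed
    qed
  qed
  have UU: "U i \<inter> U j = {}" if "j < i" "i < h" for i j
  proof -
    have "U i \<subseteq> Y (Suc j)" using mono[of "Suc j" i] that by (auto simp: U_def)
    moreover have "U j \<inter> Y (Suc j) = {}" using ann[of j] that by (fastforce simp: U_def)
    ultimately show ?thesis by blast
  qed
  \<comment> \<open>Each \<open>B b\<close> stays within \<open>11 * h * D\<close> of
    \<open>y b\<close>, half of the assumed separation.\<close>
  have BB: "B b \<inter> B c = {}" if bc: "b < h" "c < h" "b \<noteq> c" for b c
  proof (rule ccontr)
    assume "B b \<inter> B c \<noteq> {}"
    then obtain p i j where p: "i < h" "j < h" "p \<in> Gm b i" "p \<in> Gm c j" by (auto simp: B_def)
    obtain n m where nm: "n \<le> 11 * h * D" "hop (Y 0) (y b) n p" "m \<le> 11 * h * D" "hop (Y 0) (y c) m p"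
      using distB[OF p(1) bc(1) p(3)] distB[OF p(2) bc(2) p(4)] by blast
    have "hop (Y 0) (y b) (n + m) (y c)" using hop_trans[OF hop_sym[OF nm(4)] nm(2)] .
    then have "22 * h * D < n + m" by (rule far[OF bc])
    then show False using nm(1,3) by simp
  qed
  have BUadj: "\<exists>p\<in>B b. \<exists>z\<in>U i. E p z" if i: "i < h" and b: "b < h" for b i
  proof -
    obtain p z where pz: "p \<in> Gm b i" "z \<in> Y i" "?f i z + 5 * D < lo i" "E p z" using Gm(10)[OF i b] by blast
    have "p \<in> B b" using i pz(1) by (auto simp: B_def)
    moreover have "z \<in> U i" using pz(2,3) by (simp add: U_def)
    ultimately show ?thesis using pz(4) by blast
  qed
  have "clique_model E (Y 0) h (\<lambda>b. B b \<union> U b)"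
  proof (rule clique_modelI)
    fix b assume b: "b < h"
    obtain p z where pz: "p \<in> B b" "z \<in> U b" "E p z" using BUadj[OF b b] by blast
    then show "B b \<union> U b \<noteq> {}" by blast
    have "conn E (U b)" unfolding U_def using conn_sublevel[OF Yc[OF b] r[OF b]] .
    then show "conn E (B b \<union> U b)" using conn_Un[OF symE cB[OF b] _ pz(1,2)] pz(3) by blast
    have "Gm b i \<subseteq> Y 0" if "i < h" for i using Gm(3)[OF that b] mono[of 0 i] that by auto
    moreover have "U b \<subseteq> Y 0" using mono[of 0 b] b by (auto simp: U_def)
    ultimately show "B b \<union> U b \<subseteq> Y 0" unfolding B_def by blast
  next
    fix b c assume bc: "c < b" "b < h"
    then have ch: "c < h" by simp
    have "B a \<inter> U j = {}" if "j < h" "a < h" for a j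
    proof (rule equals0I)
      fix p assume "p \<in> B a \<inter> U j"
      then obtain i where "i < h" "p \<in> Gm a i" "p \<in> U j" by (auto simp: B_def)
      then show False using GU[OF _ that] by blast
    qed
    then have "B b \<inter> U c = {}" "B c \<inter> U b = {}" using bc ch by simp_all
    moreover have "B b \<inter> B c = {}" using BB bc ch by simp
    moreover have "U b \<inter> U c = {}" using UU bc by simp
    ultimately show "(B b \<union> U b) \<inter> (B c \<union> U c) = {}" by blast
    show "\<exists>x\<in>B b \<union> U b. \<exists>z\<in>B c \<union> U c. E x z" using BUadj[OF ch bc(2)] by blast
  qed
  then show ?thesis by blast
qed

end

section \<open>Random offsets and iterated annuli\<close>

text \<open>Each \<open>j\<close> determines \<open>b\<close> modulo \<open>D\<close> and so
  accounts for at most one offset. This bounds how many offsets cut a region spanning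
  \<open>w\<close> levels.\<close>

lemma card_offsets_le:
  fixes D w lo :: nat
  assumes "D > 0"
  shows "card {b \<in> {..<D}. \<exists>j\<in>{1..w}. D dvd lo + j + b} \<le> w"
proof -
  have "{b \<in> {..<D}. \<exists>j\<in>{1..w}. D dvd lo + j + b} = (\<Union>j\<in>{1..w}. {b \<in> {..<D}. D dvd lo + j + b})"
    by blast
  also have "card \<dots> \<le> (\<Sum>j\<in>{1..w}. card {b \<in> {..<D}. D dvd lo + j + b})"
    by (rule card_UN_le) simp
  also have "\<dots> \<le> (\<Sum>j\<in>{1..w}. 1)"
  proof (rule sum_mono)
    fix j
    have "b = b'" if "b < D" "b' < D" "D dvd lo + j + b" "D dvd lo + j + b'" "b \<le> b'" for b b'
    proof -
      have "D dvd (lo + j + b') - (lo + j + b)" using that by (intro dvd_diff_nat)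
      then have "D dvd b' - b" by simp
      then have "b' - b = 0" using that(1,2) by (meson dvd_imp_le less_imp_diff_less not_le gr0I)
      then show ?thesis using that(5) by simp
    qed
    then have "b = b'" if "b < D" "b' < D" "D dvd lo + j + b" "D dvd lo + j + b'" for b b'
      using that nat_le_linear[of b b'] by metis
    then have "card {b \<in> {..<D}. D dvd lo + j + b} \<le> Suc 0"
      by (subst card_le_Suc0_iff_eq) auto
    then show "card {b \<in> {..<D}. D dvd lo + j + b} \<le> 1" by simp
  qed
  finally show ?thesis by simp
qed

text \<open>The annulus number changes only on passing a multiple of \<open>D\<close>, and such a
  passage would be one of the sums \<open>lo + j + b\<close>.\<close>

lemma div_eq_if_no_multiple:
  fixes D w lo b f :: nat
  assumes "D > 0" "lo \<le> f" "f \<le> lo + w" "\<And>j. j \<in> {1..w} \<Longrightarrow> \<not> D dvd lo + j + b"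
  shows "(f + b) div D = (lo + b) div D"
proof (rule ccontr)
  assume ne: "(f + b) div D \<noteq> (lo + b) div D"
  have "(lo + b) div D \<le> (f + b) div D" using assms(2) by (intro div_le_mono) simp
  with ne have lt: "(lo + b) div D < (f + b) div D" by simp
  define M where "M = (f + b) div D * D"
  have M1: "M \<le> f + b" by (simp add: M_def)
  have M2: "lo + b < M"
  proof (rule ccontr)
    assume "\<not> lo + b < M"
    then have "(f + b) div D * D \<le> lo + b" by (simp add: M_def)
    then have "(f + b) div D \<le> (lo + b) div D" using assms(1) by (simp add: less_eq_div_iff_mult_less_eq)
    with lt show False by simp
  qed
  have "D dvd lo + (M - (lo + b)) + b" using M2 by (simp add: M_def)
  moreover have "M - (lo + b) \<in> {1..w}" using M1 M2 assms(3) by auto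
  ultimately show False using assms(4) by blast
qed

lemma div_eq_iff_between:
  fixes D x q :: nat
  assumes "D > 0"
  shows "x div D = q \<longleftrightarrow> q * D \<le> x \<and> x < q * D + D"
proof -
  have "x div D = q \<longleftrightarrow> q \<le> x div D \<and> x div D < Suc q" by auto
  then show ?thesis using assms
    by (simp add: less_eq_div_iff_mult_less_eq div_less_iff_less_mult add.commute)
qed

lemma exists_le_average:
  fixes f :: "nat \<Rightarrow> nat"
  assumes "D > 0" "(\<Sum>b<D. f b) \<le> W"
  shows "\<exists>b<D. f b * D \<le> W"
proof (rule ccontr)
  assume "\<not> ?thesis"
  then have "(\<Sum>b<D. W) < (\<Sum>b<D. f b * D)"
    using assms(1) by (intro sum_strict_mono) auto
  also have "\<dots> = (\<Sum>b<D. f b) * D" by (simp add: sum_distrib_right)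
  also have "\<dots> \<le> W * D" using assms(2) by simp
  finally show False by simp
qed

locale finite_strings = strings E V R w for E :: "'b \<Rightarrow> 'b \<Rightarrow> bool" and V :: "'a set" and R w +
  fixes D :: nat
  assumes finV: "finite V" and D_pos: "D > 0"
begin

text \<open>The choice depends on the set alone, so all points of a cluster are measured from the
  same root; \<open>cluster_eq\<close> relies on this.\<close>

definition origin :: "'b set \<Rightarrow> 'b" where
  "origin Y = (SOME y. y \<in> Y)"

definition level :: "'b set \<Rightarrow> 'b \<Rightarrow> nat" where
  "level Y = hdist Y (origin Y)"

abbreviation X :: "'b set" where
  "X \<equiv> \<Union> (R ` V)"

text \<open>A partition encoded by the class of each point. The offset \<open>a i\<close> shifts the
  annuli of round \<open>i\<close>.\<close>

primrec cluster :: "(nat \<Rightarrow> nat) \<Rightarrow> nat \<Rightarrow> 'b \<Rightarrow> 'b set" where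
  "cluster a 0 y = comp E X y"
| "cluster a (Suc i) y = comp E {z \<in> cluster a i y.
     (level (cluster a i y) z + a i) div D = (level (cluster a i y) y + a i) div D} y"

lemma cluster_self: "y \<in> cluster a i y"
  by (cases i) auto

lemma cluster_Suc_subset: "cluster a (Suc i) y \<subseteq> cluster a i y"
  using comp_subset[of y "{z \<in> cluster a i y.
     (level (cluster a i y) z + a i) div D = (level (cluster a i y) y + a i) div D}" E] cluster_self
  by (auto simp del: comp_subset)

lemma cluster_conn: "conn E (cluster a i y)"
  by (cases i) (simp_all add: conn_comp symE)

lemma cluster_eq: "z \<in> cluster a i y \<Longrightarrow> cluster a i z = cluster a i y"
proof (induction i)
  case 0
  then show ?case by (simp add: comp_eq[OF symE])
next
  case (Suc i)
  let ?A = "\<lambda>y. {z \<in> cluster a i y.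
     (level (cluster a i y) z + a i) div D = (level (cluster a i y) y + a i) div D}"
  have "z \<in> cluster a i y" using Suc.prems cluster_Suc_subset by blast
  then have eq: "cluster a i z = cluster a i y" by (rule Suc.IH)
  have zA: "z \<in> ?A y" using Suc.prems comp_subset[of y "?A y" E] cluster_self by auto
  then have "?A z = ?A y" unfolding eq by auto
  then show ?case using comp_eq[OF symE] Suc.prems by simp
qed

lemma cluster_cong: "(\<And>j. j < i \<Longrightarrow> a j = a' j) \<Longrightarrow> cluster a i y = cluster a' i y"
  by (induction i) simp_all

lemma origin_in: "origin (cluster a i y) \<in> cluster a i y"
  unfolding origin_def using cluster_self by (rule someI)

definition uncut :: "(nat \<Rightarrow> nat) \<Rightarrow> nat \<Rightarrow> 'a \<Rightarrow> bool" where
  "uncut a i v \<longleftrightarrow> (\<forall>y\<in>R v. R v \<subseteq> cluster a i y)"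

lemma uncut_0: "v \<in> V \<Longrightarrow> uncut a 0 v"
  unfolding uncut_def by (auto intro!: conn_subset_comp[OF conn_R, THEN subsetD])

text \<open>A region is connected, so a single hop of cost \<open>w v\<close> from its lowest point
  reaches all of it. Its levels thus span at most \<open>w v\<close>, and only offsets that put a
  boundary into this span cut it.\<close>

lemma card_cutting_offsets:
  assumes v: "v \<in> V" "uncut a k v"
  shows "card {b \<in> {..<D}. \<not> uncut (a(k := b)) (Suc k) v} \<le> w v"
proof (cases "R v = {}")
  case True
  then show ?thesis by (simp add: uncut_def)
next
  case False
  then obtain y0 where y0: "y0 \<in> R v" by blast
  define Y where "Y = cluster a k y0"
  have RY: "R v \<subseteq> Y" using v(2) y0 by (auto simp: Y_def uncut_def)
  have cY: "cluster a k y = Y" if "y \<in> R v" for y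
    using RY that cluster_eq by (auto simp: Y_def)
  obtain z0 where z0: "z0 \<in> R v" "\<And>z. z \<in> R v \<Longrightarrow> level Y z0 \<le> level Y z"
    using ex_has_least_nat[of "\<lambda>z. z \<in> R v" y0 "level Y"] y0 by blast
  have osc: "level Y z \<le> level Y z0 + w v" if "z \<in> R v" for z
  proof -
    have "reach E (R v \<inter> Y) z0 z" using conn_R[OF v(1)] RY z0(1) that by (simp add: Int_absorb2 connD)
    then have "hop Y z0 (w v) z" using v(1) z0(1) RY by (intro hop_single) auto
    then show ?thesis unfolding level_def Y_def
      using hdist_hop_le[OF cluster_conn origin_in] by (simp add: Y_def)
  qed
  have "uncut (a(k := b)) (Suc k) v" if b: "\<not> (\<exists>j\<in>{1..w v}. D dvd level Y z0 + j + b)" for b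
    unfolding uncut_def
  proof
    fix y assume y: "y \<in> R v"
    have "(level Y z + b) div D = (level Y z0 + b) div D" if "z \<in> R v" for z
      using D_pos z0(2)[OF that] osc[OF that] b by (intro div_eq_if_no_multiple[where w = "w v"]) auto
    then have "R v \<subseteq> {z \<in> Y. (level Y z + b) div D = (level Y y + b) div D}" using RY y by auto
    moreover have "cluster (a(k := b)) k y = Y"
      using cluster_cong[of k "a(k := b)" a y] cY[OF y] by simp
    ultimately show "R v \<subseteq> cluster (a(k := b)) (Suc k) y"
      using conn_subset_comp[OF conn_R[OF v(1)] y] by simp
  qed
  then have "card {b \<in> {..<D}. \<not> uncut (a(k := b)) (Suc k) v}
      \<le> card {b \<in> {..<D}. \<exists>j\<in>{1..w v}. D dvd level Y z0 + j + b}"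
    by (intro card_mono) auto
  also have "\<dots> \<le> w v" by (rule card_offsets_le[OF D_pos])
  finally show ?thesis .
qed

text \<open>Offsets are fixed one round at a time. By averaging over \<open>D\<close> choices, each
  round cuts at most \<open>sum w V / D\<close> of the regions that are still whole.\<close>

lemma exists_offsets: "\<exists>a. card {v \<in> V. \<not> uncut a k v} * D \<le> k * sum w V"
proof (induction k)
  case 0
  have "{v \<in> V. \<not> uncut a 0 v} = {}" for a using uncut_0 by blast
  then show ?case by (simp only: card.empty mult_0 order_refl ex_simps simp_thms)
next
  case (Suc k)
  then obtain a where a: "card {v \<in> V. \<not> uncut a k v} * D \<le> k * sum w V" by blast
  define U where "U = {v \<in> V. uncut a k v}"
  have finU: "finite U" using finV by (simp add: U_def)
  have "(\<Sum>b<D. card {v \<in> U. \<not> uncut (a(k := b)) (Suc k) v}) =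
      (\<Sum>v\<in>U. card {b \<in> {..<D}. \<not> uncut (a(k := b)) (Suc k) v})"
    by (simp only: card_filter_eq_sum[OF finU] card_filter_eq_sum[OF finite_lessThan] sum.swap[of _ U])
  also have "\<dots> \<le> sum w U" by (intro sum_mono card_cutting_offsets) (auto simp: U_def)
  also have "\<dots> \<le> sum w V" using finV by (intro sum_mono2) (auto simp: U_def)
  finally obtain b where b: "card {v \<in> U. \<not> uncut (a(k := b)) (Suc k) v} * D \<le> sum w V"
    using exists_le_average[OF D_pos] by blast
  have "{v \<in> V. \<not> uncut (a(k := b)) (Suc k) v} \<subseteq>
      {v \<in> V. \<not> uncut a k v} \<union> {v \<in> U. \<not> uncut (a(k := b)) (Suc k) v}"
    by (auto simp: U_def)
  then have "card {v \<in> V. \<not> uncut (a(k := b)) (Suc k) v} \<le>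
      card {v \<in> V. \<not> uncut a k v} + card {v \<in> U. \<not> uncut (a(k := b)) (Suc k) v}"
    using finV finU by (intro order_trans[OF card_mono card_Un_le]) auto
  then have "card {v \<in> V. \<not> uncut (a(k := b)) (Suc k) v} * D \<le>
      (card {v \<in> V. \<not> uncut a k v} + card {v \<in> U. \<not> uncut (a(k := b)) (Suc k) v}) * D"
    by (rule mult_le_mono1)
  also have "\<dots> \<le> Suc k * sum w V" using a b by (simp add: add_mult_distrib)
  finally show ?case by blast
qed

lemma far_points_clique_model:
  assumes w: "\<And>v. v \<in> V \<Longrightarrow> w v \<le> D" and h: "h \<ge> 2"
    and p: "\<And>b. b < h \<Longrightarrow> p b \<in> cluster a h y"
    and far: "\<And>b c n. b < h \<Longrightarrow> c < h \<Longrightarrow> b \<noteq> c \<Longrightarrow> hop X (p b) n (p c) \<Longrightarrow> 22 * h * D < n"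
    and y: "y \<in> X"
  shows "\<exists>M. clique_model E X h M"
proof -
  let ?Y = "\<lambda>i. cluster a i y"
  let ?q = "\<lambda>i. (level (?Y i) y + a i) div D"
  have Y0: "?Y 0 \<subseteq> X" using comp_subset[OF y] by simp
  have ann: "level (?Y i) z + a i < ?q i * D + D \<and> ?q i * D \<le> level (?Y i) z + a i \<longleftrightarrow>
      (level (?Y i) z + a i) div D = ?q i" for i z
    using div_eq_iff_between[OF D_pos] by blast
  let ?A = "\<lambda>i. {z \<in> ?Y i. (level (?Y i) z + a i) div D = ?q i}"
  have in_ann: "z \<in> ?A i" if "z \<in> ?Y (Suc i)" for z i
    using that comp_subset[of y "?A i" E] cluster_self by auto
  have "\<exists>M. clique_model E (?Y 0) h M"
  \<comment> \<open>Subtraction truncates at 0 when the innermost annulus starts below level 0. This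
    does not change which natural numbers are levels of the annulus.\<close>
  proof (rule annuli_clique_model[where r = "\<lambda>i. origin (?Y i)" and lo = "\<lambda>i. ?q i * D - a i"
        and hi = "\<lambda>i. ?q i * D + D - a i" and y = p, OF w D_pos h cluster_conn origin_in])
    show "?q i * D + D - a i \<le> ?q i * D - a i + D" for i by simp
    show "?Y (Suc i) \<subseteq> ?Y i" for i by (rule cluster_Suc_subset)
    show "?q i * D - a i \<le> hdist (?Y i) (origin (?Y i)) z \<and> hdist (?Y i) (origin (?Y i)) z < ?q i * D + D - a i"
      if "z \<in> ?Y (Suc i)" for i z
      using in_ann[OF that] ann[of i z] unfolding level_def by auto
    show "z \<in> ?Y (Suc i)"
      if "u \<in> ?Y (Suc i)" "z \<in> ?Y i" "E u z" "?q i * D - a i \<le> hdist (?Y i) (origin (?Y i)) z"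
        "hdist (?Y i) (origin (?Y i)) z < ?q i * D + D - a i" for i u z
    proof -
      have "z \<in> ?A i" using ann[of i z] that(2,4,5) unfolding level_def by auto
      then have "reach E (?A i) u z" using in_ann[OF that(1)] that(3) by (intro reach_edge)
      moreover have "reach E (?A i) y u" using that(1) by (simp add: comp_def)
      ultimately have "reach E (?A i) y z" by (blast intro: reach_trans)
      then show ?thesis by (simp add: comp_def)
    qed
    show "22 * h * D < n" if "b < h" "c < h" "b \<noteq> c" "hop (?Y 0) (p b) n (p c)" for b c n
      using far[OF that(1-3)] hop_mono[OF that(4) Y0] by blast
  qed (use p in auto)
  then obtain M where "clique_model E (?Y 0) h M" by blast
  then have "clique_model E X h M" using Y0 unfolding clique_model_def by (meson order_trans)
  then show ?thesis by blast
qed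

end

section \<open>Congestion and clique minors\<close>

text \<open>Half-edges at the same vertex may overlap, since they go into one branch set, and the
  two halves of an edge are meant to meet. All other encounters with the halves of
  \<open>{i, j}\<close> are excluded.\<close>

definition good_pair :: "(nat \<Rightarrow> nat \<Rightarrow> 'b set) \<Rightarrow> nat \<Rightarrow> nat \<Rightarrow> nat \<Rightarrow> bool" where
  "good_pair A r i j \<longleftrightarrow> i < r \<and> j < r \<and> i \<noteq> j \<and>
     (\<forall>k<r. \<forall>l<r. k \<noteq> l \<longrightarrow> {i, j} \<noteq> {k, l} \<longrightarrow>
        (i \<noteq> k \<longrightarrow> A i j \<inter> A k l = {}) \<and> (j \<noteq> k \<longrightarrow> A j i \<inter> A k l = {}))"

lemma good_pair_sym: "good_pair A r i j \<Longrightarrow> good_pair A r j i"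
  unfolding good_pair_def by (auto simp: insert_commute)

lemma good_pairD:
  assumes "good_pair A r i j" "k < r" "l < r" "k \<noteq> l" "{i, j} \<noteq> {k, l}" "i \<noteq> k"
  shows "A i j \<inter> A k l = {}"
  using assms unfolding good_pair_def by blast

definition minor_model :: "('v \<Rightarrow> 'v \<Rightarrow> bool) \<Rightarrow> 'v set \<Rightarrow> ('i \<Rightarrow> 'i \<Rightarrow> bool) \<Rightarrow> 'i set \<Rightarrow> ('i \<Rightarrow> 'v set) \<Rightarrow> bool" where
  "minor_model E X gd N B \<longleftrightarrow> (\<forall>i\<in>N. B i \<noteq> {} \<and> conn E (B i) \<and> B i \<subseteq> X) \<and>
     (\<forall>i\<in>N. \<forall>j\<in>N. i \<noteq> j \<longrightarrow> B i \<inter> B j = {}) \<and>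
     (\<forall>i\<in>N. \<forall>j\<in>N. gd i j \<longrightarrow> (\<exists>x\<in>B i. \<exists>y\<in>B j. E x y))"

text \<open>The branch set of \<open>i\<close> is \<open>Z i\<close> with its half-edges from good
  pairs. For different vertices these are disjoint except for the two halves of one edge, where one
  half is trimmed back to an edge into the other.\<close>

lemma drawing_model:
  fixes E :: "'b \<Rightarrow> 'b \<Rightarrow> bool" and A :: "nat \<Rightarrow> nat \<Rightarrow> 'b set"
  assumes sym: "symp E" and r: "r \<ge> 3"
    and Z: "\<And>i. i < r \<Longrightarrow> conn E (Z i)" "\<And>i. i < r \<Longrightarrow> Z i \<noteq> {}"
    and A: "\<And>i j. i < r \<Longrightarrow> j < r \<Longrightarrow> i \<noteq> j \<Longrightarrow> conn E (A i j) \<and> Z i \<subseteq> A i j \<and> A i j \<inter> A j i \<noteq> {}"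
    and AX: "\<And>i j. i < r \<Longrightarrow> j < r \<Longrightarrow> A i j \<subseteq> X"
    and N: "\<And>i. i \<in> N \<Longrightarrow> \<exists>j. good_pair A r i j"
  shows "\<exists>B. minor_model E X (good_pair A r) N B"
proof -
  let ?good = "good_pair A r"
  \<comment> \<open>A third index shows that a good half-edge of \<open>i\<close> avoids
    \<open>Z k\<close> even when \<open>k\<close> is its other end: \<open>Z k\<close> also lies in
    the half-edge of a different pair. Hence trimming never removes a centre.\<close>
  have third: "\<exists>l<r. l \<noteq> i \<and> l \<noteq> k" for i k
  proof -
    have "\<not> {..<r} \<subseteq> {i, k}"
    proof
      assume "{..<r} \<subseteq> {i, k}"
      then have "card {..<r} \<le> card {i, k}" by (intro card_mono) auto
      also have "\<dots> \<le> 2" by (simp add: card_insert_if)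
      finally show False using r by simp
    qed
    then show ?thesis by blast
  qed
  have zA: "A i j \<inter> Z k = {}" if g: "?good i j" and k: "k < r" "k \<noteq> i" for i j k
  proof -
    obtain l where l: "l < r" "l \<noteq> i" "l \<noteq> k" using third by blast
    have "{i, j} \<noteq> {k, l}" using k l by auto
    then have "A i j \<inter> A k l = {}" using good_pairD[OF g k(1) l(1)] k l by simp
    moreover have "Z k \<subseteq> A k l" using A[OF k(1) l(1)] l by simp
    ultimately show ?thesis by blast
  qed
  \<comment> \<open>Where the half-edges of \<open>{i, k}\<close> overlap, the smaller index gives way and keeps only \<open>T i k\<close>.\<close>
  define T where "T i k = {y. \<exists>x\<in>Z i. reach E (A i k - A k i) x y}" for i k
  have T: "Z i \<subseteq> T i k" "T i k \<subseteq> A i k - A k i" "conn E (T i k)" "\<exists>u\<in>T i k. \<exists>v\<in>A k i. E u v"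
    if g: "?good i k" for i k
  proof -
    have ik: "i < r" "k < r" "i \<noteq> k" using g by (auto simp: good_pair_def)
    have ZA: "Z i \<subseteq> A i k - A k i"
      using A[OF ik] zA[OF good_pair_sym[OF g] ik(1,3)] by blast
    show ZT: "Z i \<subseteq> T i k" by (auto simp: T_def intro: reach_refl)
    show TA: "T i k \<subseteq> A i k - A k i"
    proof
      fix y assume "y \<in> T i k"
      then obtain x where "x \<in> Z i" "reach E (A i k - A k i) x y" by (auto simp: T_def)
      then show "y \<in> A i k - A k i" using ZA reach_in by (meson subsetD)
    qed
    obtain x0 where x0: "x0 \<in> Z i" using Z(2)[OF ik(1)] by blast
    show "conn E (T i k)"
    proof (rule connI_from[OF sym, where x = x0])
      fix y assume "y \<in> T i k"
      then obtain x where x: "x \<in> Z i" "reach E (A i k - A k i) x y" by (auto simp: T_def)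
      have "comp E (A i k - A k i) x \<subseteq> T i k" using x(1) by (auto simp: T_def comp_def)
      then have "reach E (T i k) x y" by (rule reach_mono[OF reach_comp[OF x(2)]])
      moreover have "reach E (T i k) x0 x"
        by (rule reach_mono[OF connD[OF Z(1)[OF ik(1)] x0 x(1)] ZT])
      ultimately show "reach E (T i k) x0 y" by (blast intro: reach_trans)
    qed
    obtain c where c: "c \<in> A i k" "c \<in> A k i" using A[OF ik] by blast
    have x0A: "x0 \<in> A i k" using x0 ZA by blast
    have rc: "reach E (A i k) x0 c" using A[OF ik] x0A c by (meson connD)
    \<comment> \<open>\<open>T i k\<close> is maximal outside \<open>A k i\<close>, so the walk to
      the common point \<open>c\<close> can leave it only into \<open>A k i\<close>.\<close>
    show "\<exists>u\<in>T i k. \<exists>v\<in>A k i. E u v"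
    proof (rule reach_first_exit[OF rc x0A, of "T i k"])
      show "x0 \<in> T i k" using x0 ZT by blast
      show "c \<notin> T i k" using TA c by blast
      fix u v assume uv: "u \<in> A i k \<inter> T i k" "v \<in> A i k - T i k" "E u v"
      have "v \<in> A k i"
      proof (rule ccontr)
        assume "v \<notin> A k i"
        then have "reach E (A i k - A k i) u v" using uv TA by (intro reach_edge) auto
        moreover obtain x where "x \<in> Z i" "reach E (A i k - A k i) x u" using uv(1) by (auto simp: T_def)
        ultimately have "v \<in> T i k" unfolding T_def by (blast intro: reach_trans)
        then show False using uv(2) by blast
      qed
      then show ?thesis using uv by blast
    qed
  qed
  define C where "C i k = (if i < k then T i k else A i k)" for i k
  have C: "Z i \<subseteq> C i k" "C i k \<subseteq> A i k" "conn E (C i k)" if g: "?good i k" for i k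
  proof -
    have ik: "i < r" "k < r" "i \<noteq> k" using g by (auto simp: good_pair_def)
    show "Z i \<subseteq> C i k" using T(1)[OF g] A[OF ik] by (simp add: C_def)
    show "C i k \<subseteq> A i k" using T(2)[OF g] by (auto simp: C_def)
    show "conn E (C i k)" using T(3)[OF g] A[OF ik] by (simp add: C_def)
  qed
  have CC: "C i j \<inter> C k l = {}" if g: "?good i j" "?good k l" and ik: "i \<noteq> k" for i j k l
  proof (cases "{i, j} = {k, l}")
    case False
    have "k < r" "l < r" "k \<noteq> l" using g(2) by (auto simp: good_pair_def)
    then have "A i j \<inter> A k l = {}" using good_pairD[OF g(1)] False ik by simp
    then show ?thesis using C(2)[OF g(1)] C(2)[OF g(2)] by blast
  next
    case True
    then have jl: "j = k" "l = i" using ik by (auto simp: doubleton_eq_iff)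
    have *: "C a b \<inter> C b a = {}" if "?good a b" "a < b" for a b
      using T(2)[OF that(1)] that(2) by (auto simp: C_def)
    show ?thesis
    proof (cases "i < k")
      case True
      then show ?thesis using *[of i k] g(1) jl by simp
    next
      case False
      then have "k < i" using ik by simp
      then have "C k i \<inter> C i k = {}" using *[of k i] g(2) jl by simp
      then show ?thesis using jl by (simp add: Int_commute)
    qed
  qed
  define B where "B i = Z i \<union> (\<Union>k\<in>{k. ?good i k}. C i k)" for i
  have Bsub: "B i = (\<Union>k\<in>{k. ?good i k}. C i k)" if "i \<in> N" for i
    using N[OF that] C(1) unfolding B_def by blast
  have b1: "B i \<noteq> {} \<and> conn E (B i) \<and> B i \<subseteq> X" if i: "i \<in> N" for i
  proof -
    have ir: "i < r" using N[OF i] by (auto simp: good_pair_def)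
    obtain x0 where x0: "x0 \<in> Z i" using Z(2)[OF ir] by blast
    then have "B i \<noteq> {}" by (auto simp: B_def)
    moreover have "conn E (B i)" unfolding B_def
      using sym Z(1)[OF ir] x0
    proof (rule conn_UN)
      fix k assume "k \<in> {k. ?good i k}"
      then show "conn E (C i k)" "Z i \<inter> C i k \<noteq> {}" using C[of i k] x0 by auto
    qed
    moreover have "C i k \<subseteq> X" if "?good i k" for k
    proof -
      have "i < r" "k < r" using that by (simp_all add: good_pair_def)
      then show ?thesis using C(2)[OF that] AX by blast
    qed
    then have "B i \<subseteq> X" unfolding Bsub[OF i] by (intro UN_least) simp
    ultimately show ?thesis by blast
  qed
  have b2: "B i \<inter> B k = {}" if ik: "i \<in> N" "k \<in> N" "i \<noteq> k" for i k
  proof (rule equals0I)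
    fix p assume "p \<in> B i \<inter> B k"
    then obtain j l where "?good i j" "p \<in> C i j" "?good k l" "p \<in> C k l"
      unfolding Bsub[OF ik(1)] Bsub[OF ik(2)] by blast
    then show False using CC[of i j k l] ik(3) by blast
  qed
  have b3: "\<exists>x\<in>B i. \<exists>y\<in>B k. E x y" if g: "?good i k" for i k
  proof -
    have *: "\<exists>x\<in>B a. \<exists>y\<in>B b. E x y" if ab: "?good a b" "a < b" for a b
    proof -
      obtain u v where uv: "u \<in> T a b" "v \<in> A b a" "E u v" using T(4)[OF ab(1)] by blast
      have "u \<in> B a" unfolding B_def C_def using uv(1) ab by auto
      moreover have "v \<in> B b" unfolding B_def C_def using uv(2) ab good_pair_sym[OF ab(1)] by auto
      ultimately show ?thesis using uv(3) by blast
    qed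
    show ?thesis
    proof (cases "i < k")
      case True
      then show ?thesis using *[OF g] by blast
    next
      case False
      then have "k < i" using g by (auto simp: good_pair_def)
      then obtain x y where "x \<in> B k" "y \<in> B i" "E x y" using *[OF good_pair_sym[OF g]] by blast
      then show ?thesis using sym by (meson sympD)
    qed
  qed
  show ?thesis unfolding minor_model_def
    by (rule exI[of _ B], intro conjI ballI impI)
       ((rule b3, assumption) | (rule b2; assumption) | simp add: b1)+
qed

text \<open>A minor of a minor is a minor: the branch sets of the outer model are replaced by unions
  of inner ones.\<close>

lemma clique_model_compose:
  assumes sym: "symp E" and M: "clique_model gd N h M"
    and model: "minor_model E X gd N B"
  shows "clique_model E X h (\<lambda>a. \<Union>i\<in>M a. B i)"
proof -
  note B = model[unfolded minor_model_def, THEN conjunct1, rule_format]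
  note disj = model[unfolded minor_model_def, THEN conjunct2, THEN conjunct1, rule_format]
  note adj = model[unfolded minor_model_def, THEN conjunct2, THEN conjunct2, rule_format]
  show ?thesis
  proof (rule clique_modelI)
    fix a assume a: "a < h"
    then have Ma: "M a \<noteq> {}" "M a \<subseteq> N" "conn gd (M a)" using M by (simp_all add: clique_model_def)
    then show "(\<Union>i\<in>M a. B i) \<noteq> {}" "(\<Union>i\<in>M a. B i) \<subseteq> X" using B by blast+
    have sub: "reach E (\<Union>i\<in>M a. B i) x y" if "i \<in> M a" "x \<in> B i" "y \<in> B i" for i x y
    proof -
      have "reach E (B i) x y" using B Ma(2) that by (meson connD subsetD)
      then show ?thesis by (rule reach_mono) (use that in blast)
    qed
    have *: "\<forall>y\<in>B j. reach E (\<Union>i\<in>M a. B i) x y"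
      if "reach gd (M a) i j" "i \<in> M a" "x \<in> B i" for i j x
      using that(1)
    proof (induction rule: reach_induct)
      case base
      then show ?case using sub that by blast
    next
      case (step u v)
      obtain p q where pq: "p \<in> B u" "q \<in> B v" "E p q" using adj[of u v] step Ma(2) by blast
      show ?case
      proof
        fix y assume y: "y \<in> B v"
        have "reach E (\<Union>i\<in>M a. B i) p q" using pq step by (intro reach_edge) auto
        then show "reach E (\<Union>i\<in>M a. B i) x y"
          using step.IH pq(1) sub[OF step.hyps(4) pq(2) y] by (blast intro: reach_trans)
      qed
    qed
    show "conn E (\<Union>i\<in>M a. B i)"
      unfolding conn_def using * Ma(3) by (auto dest: connD)
  next
    fix a b assume ab: "b < a" "a < h"
    then have N: "M a \<subseteq> N" "M b \<subseteq> N" using M by (simp_all add: clique_model_def)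
    have dj: "M a \<inter> M b = {}" using clique_model_disjoint[OF M] ab by simp
    show "(\<Union>i\<in>M a. B i) \<inter> (\<Union>i\<in>M b. B i) = {}"
    proof (rule equals0I)
      fix p assume "p \<in> (\<Union>i\<in>M a. B i) \<inter> (\<Union>i\<in>M b. B i)"
      then obtain i j where "i \<in> M a" "p \<in> B i" "j \<in> M b" "p \<in> B j" by blast
      moreover have "i \<noteq> j" using calculation dj by blast
      ultimately show False using disj[of i j] N by blast
    qed
    obtain i j where ij: "i \<in> M a" "j \<in> M b" "gd i j"
      using M ab unfolding clique_model_def by (meson order_less_trans)
    then obtain x y where "x \<in> B i" "y \<in> B j" "E x y" using adj[of i j] N by blast
    with ij show "\<exists>x\<in>\<Union>i\<in>M a. B i. \<exists>y\<in>\<Union>i\<in>M b. B i. E x y" by blast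
  qed
qed

section \<open>Drawing paths of the intersection graph in the host\<close>

locale regions =
  fixes E :: "'b \<Rightarrow> 'b \<Rightarrow> bool" and V :: "'a set" and R :: "'a \<Rightarrow> 'b set"
  assumes symE: "symp E" and finV: "finite V"
    and conn_R: "\<And>v. v \<in> V \<Longrightarrow> conn E (R v)" and R_ne: "\<And>v. v \<in> V \<Longrightarrow> R v \<noteq> {}"
begin

definition tch :: "'a \<Rightarrow> 'a \<Rightarrow> bool" where
  "tch u v \<longleftrightarrow> R u \<inter> R v \<noteq> {}"

lemma symp_tch: "symp tch"
  by (rule sympI) (auto simp: tch_def)

lemma tch_refl: "v \<in> V \<Longrightarrow> tch v v"
  using R_ne by (simp add: tch_def)

lemma conn_Union_regions:
  assumes "P \<subseteq> V" "conn tch P"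
  shows "conn E (\<Union>v\<in>P. R v)"
proof -
  have sub: "reach E (\<Union>v\<in>P. R v) x y" if "v \<in> P" "x \<in> R v" "y \<in> R v" for v x y
  proof -
    have "reach E (R v) x y" using conn_R assms(1) that by (meson connD subsetD)
    then show ?thesis by (rule reach_mono) (use that in blast)
  qed
  have "\<forall>y\<in>R v. reach E (\<Union>v\<in>P. R v) x y" if "reach tch P u v" "u \<in> P" "x \<in> R u" for u v x
    using that(1)
  proof (induction rule: reach_induct)
    case base
    then show ?case using sub that by blast
  next
    case (step a b)
    then obtain p where "p \<in> R a" "p \<in> R b" by (auto simp: tch_def)
    then show ?case using step.IH sub[OF step.hyps(4)] by (blast intro: reach_trans)
  qed
  then show ?thesis unfolding conn_def using assms(2) by (auto dest: connD)
qed

text \<open>As \<open>tch\<close> is reflexive, \<open>deg\<close> is one more than the degree in the region intersection graph.\<close>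

definition deg :: "'a \<Rightarrow> nat" where
  "deg x = card {y \<in> V. tch x y}"

text \<open>Contrapositive: low congestion allows a drawing of the complete graph on
  \<open>r\<close> points with at most \<open>r\<^sup>2 / 512\<close> conflicts. Its good pairs form
  a dense graph on at least half of the points, whose clique model lifts to the host.\<close>

lemma congestion_lower_bound:
  fixes sel :: "'i \<Rightarrow> 'a \<Rightarrow> 'a \<Rightarrow> 'a set" and mu :: "'i \<Rightarrow> real"
  assumes no: "\<And>M. \<not> clique_model E (\<Union> (R ` V)) h M" and hs: "h \<ge> 1" "s \<ge> 1" "2 * h \<le> 2 ^ (s\<^sup>2)"
    and V': "V' \<subseteq> V" "V' \<noteq> {}" and I: "finite I"
    and mu: "\<And>i. i \<in> I \<Longrightarrow> 0 \<le> mu i" "sum mu I = 1"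
    and sel: "\<And>i u v. i \<in> I \<Longrightarrow> u \<in> V' \<Longrightarrow> v \<in> V' \<Longrightarrow>
        sel i u v \<subseteq> V' \<and> u \<in> sel i u v \<and> v \<in> sel i u v \<and> conn tch (sel i u v)"
  defines "p \<equiv> \<lambda>x. \<Sum>i\<in>I. mu i * (real (card {(u, v) \<in> V' \<times> V'. x \<in> sel i u v}) / (real (card V'))\<^sup>2)"
  shows "1 < 512 * (128 * real h * real s)\<^sup>2 * (\<Sum>x\<in>V'. real (deg x) * (p x)\<^sup>2)"
proof (rule ccontr)
  assume asm: "\<not> ?thesis"
  define r where "r = 128 * h * s"
  have r: "r \<ge> 128" using hs by (simp add: r_def)
  have finV': "finite V'" using V' finV by (meson finite_subset)
  define F where "F = (\<Sum>x\<in>V'. real (card {y \<in> V'. tch x y}) * (p x)\<^sup>2)"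
  have "F \<le> (\<Sum>x\<in>V'. real (deg x) * (p x)\<^sup>2)"
    unfolding F_def deg_def using V'(1) finV
    by (intro sum_mono mult_right_mono of_nat_mono card_mono) auto
  then have "512 * (real r)\<^sup>2 * F \<le> 512 * (real r)\<^sup>2 * (\<Sum>x\<in>V'. real (deg x) * (p x)\<^sup>2)"
    by (intro mult_left_mono) auto
  also have "\<dots> \<le> 1" using asm by (simp add: r_def)
  finally have "512 * (real r)\<^sup>2 * F \<le> 1" .
  then have "(real r)\<^sup>2 * (512 * (real r)\<^sup>2 * F) \<le> (real r)\<^sup>2 * 1" by (intro mult_left_mono) auto
  then have rF: "512 * (real r ^ 4 * F) \<le> (real r)\<^sup>2"
    by (simp add: power4_eq_xxxx power2_eq_square mult_ac)
  have sel_sub: "sel i u v \<subseteq> V'" if "i \<in> I" "u \<in> V'" "v \<in> V'" for i u v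
    using sel[OF that] by simp
  have "\<exists>z s' w. (\<forall>i<r. z i \<in> V' \<and> s' i \<in> I) \<and> (\<forall>i<r. \<forall>j<r. w i j \<in> V' \<and> w i j = w j i) \<and>
    real (card {e \<in> crossing_candidates r. case e of ((i, j), (k, l)) \<Rightarrow>
      \<exists>x\<in>sel (s' i) (z i) (w i j). \<exists>y\<in>sel (s' k) (z k) (w k l). tch x y}) \<le> real r ^ 4 * F"
    unfolding F_def p_def
    by (rule exists_few_conflicts[OF finV' V'(2) I _ mu(2) symp_tch]) (use mu(1) sel_sub in auto)
  then obtain z s' w where zsw: "\<forall>i<r. z i \<in> V' \<and> s' i \<in> I" "\<forall>i<r. \<forall>j<r. w i j \<in> V' \<and> w i j = w j i"
    and few: "real (card {e \<in> crossing_candidates r. case e of ((i, j), (k, l)) \<Rightarrow>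
      \<exists>x\<in>sel (s' i) (z i) (w i j). \<exists>y\<in>sel (s' k) (z k) (w k l). tch x y}) \<le> real r ^ 4 * F"
    by (elim exE conjE) (rule that)
  define P where "P i j = sel (s' i) (z i) (w i j)" for i j
  define A where "A i j = (\<Union>v\<in>P i j. R v)" for i j
  have P: "P i j \<subseteq> V'" "z i \<in> P i j" "w i j \<in> P i j" "conn tch (P i j)" if "i < r" "j < r" for i j
    using sel[of "s' i" "z i" "w i j"] zsw that by (auto simp: P_def)
  define Cf where "Cf = {e \<in> crossing_candidates r. case e of ((i, j), (k, l)) \<Rightarrow> \<exists>x\<in>P i j. \<exists>y\<in>P k l. tch x y}"
  have "Cf \<subseteq> ({..<r} \<times> {..<r}) \<times> ({..<r} \<times> {..<r})" by (auto simp: Cf_def crossing_candidates_def)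
  then have finCf: "finite Cf" by (rule finite_subset) simp
  have cCf: "512 * card Cf \<le> r\<^sup>2"
  proof -
    have "real (card Cf) \<le> real r ^ 4 * F" using few unfolding Cf_def P_def .
    then have "real (512 * card Cf) \<le> real (r\<^sup>2)" using rF by simp
    then show ?thesis by (simp only: of_nat_le_iff)
  qed
  define bad where "bad i = {j \<in> {..<r}. j \<noteq> i \<and> \<not> good_pair A r i j}" for i
  have CfI: "((a, b), (k, l)) \<in> Cf"
    if prems: "a < r" "b < r" "k < r" "l < r" "a \<noteq> b" "k \<noteq> l" "a \<noteq> k" "{a, b} \<noteq> {k, l}" "A a b \<inter> A k l \<noteq> {}" for a b k l
  proof -
    obtain y where "y \<in> A a b" "y \<in> A k l" using prems(9) by blast
    then obtain u v where "u \<in> P a b" "v \<in> P k l" "y \<in> R u" "y \<in> R v" unfolding A_def by blast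
    then have "\<exists>x\<in>P a b. \<exists>y\<in>P k l. tch x y" unfolding tch_def by blast
    with prems(1-8) show ?thesis by (simp add: Cf_def crossing_candidates_def)
  qed
  \<comment> \<open>Each bad pair is witnessed by a conflict in one of its two orientations, so
    there are at most \<open>2 * card Cf\<close> ordered bad pairs.\<close>
  have bad_Cf: "(i, j) \<in> fst ` Cf \<union> prod.swap ` fst ` Cf" if ij: "i < r" "j \<in> bad i" for i j
  proof -
    have j: "j < r" "i \<noteq> j" "\<not> good_pair A r i j" using ij by (auto simp: bad_def)
    then obtain k l where kl: "k < r" "l < r" "k \<noteq> l" "{i, j} \<noteq> {k, l}"
        "(i \<noteq> k \<and> A i j \<inter> A k l \<noteq> {}) \<or> (j \<noteq> k \<and> A j i \<inter> A k l \<noteq> {})"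
      using ij(1) unfolding good_pair_def by blast
    from kl(5) show ?thesis
    proof
      assume "i \<noteq> k \<and> A i j \<inter> A k l \<noteq> {}"
      then have "((i, j), (k, l)) \<in> Cf" using kl(1-4) j ij(1) by (intro CfI) simp_all
      then have "fst ((i, j), (k, l)) \<in> fst ` Cf" by (rule imageI)
      then show ?thesis by simp
    next
      assume a: "j \<noteq> k \<and> A j i \<inter> A k l \<noteq> {}"
      have "{j, i} \<noteq> {k, l}" using kl(4) by (metis insert_commute)
      with a have "((j, i), (k, l)) \<in> Cf" using kl(1-3) j(1,2) ij(1) by (intro CfI) simp_all
      then have "prod.swap (fst ((j, i), (k, l))) \<in> prod.swap ` fst ` Cf" by (intro imageI)
      then show ?thesis by simp
    qed
  qed
  \<comment> \<open>Markov: among at most \<open>r\<^sup>2 / 256\<close> ordered bad pairs, at most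
    half of the points have more than \<open>r / 128\<close> bad partners.\<close>
  define Hv where "Hv = {i \<in> {..<r}. r < 128 * card (bad i)}"
  have finbad: "finite (bad i)" for i by (simp add: bad_def)
  have finHv: "finite Hv" by (simp add: Hv_def)
  have "card (Sigma Hv bad) \<le> card (fst ` Cf \<union> prod.swap ` fst ` Cf)"
    using bad_Cf finCf by (intro card_mono) (auto simp: Hv_def simp del: Un_iff)
  also have "\<dots> \<le> card (fst ` Cf) + card (prod.swap ` fst ` Cf)" by (rule card_Un_le)
  also have "\<dots> \<le> card Cf + card Cf"
    using card_image_le[OF finCf, of fst] card_image_le[OF finite_imageI[OF finCf], of prod.swap fst] by linarith
  finally have "card (Sigma Hv bad) \<le> 2 * card Cf" by simp
  moreover have "card (Sigma Hv bad) = (\<Sum>i\<in>Hv. card (bad i))" using finHv finbad by (intro card_SigmaI) auto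
  ultimately have "128 * (\<Sum>i\<in>Hv. card (bad i)) \<le> 256 * card Cf" by simp
  moreover have "(\<Sum>i\<in>Hv. r) \<le> (\<Sum>i\<in>Hv. 128 * card (bad i))" by (intro sum_mono) (auto simp: Hv_def)
  then have "card Hv * r \<le> 128 * (\<Sum>i\<in>Hv. card (bad i))" by (simp add: sum_distrib_left)
  ultimately have "2 * (card Hv * r) \<le> r\<^sup>2" using cCf by linarith
  then have cHv: "2 * card Hv \<le> r" using r by (simp add: power2_eq_square)
  define N where "N = {..<r} - Hv"
  have finN: "finite N" by (simp add: N_def)
  have "Hv \<subseteq> {..<r}" by (auto simp: Hv_def)
  then have "card N = r - card Hv" using finHv by (simp add: N_def card_Diff_subset)
  then have cN: "r \<le> 2 * card N" using cHv by simp
  have nb: "32 * card {y \<in> N. \<not> good_pair A r x y} \<le> card N" if x: "x \<in> N" for x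
  proof -
    \<comment> \<open>\<open>x\<close> counts as its own non-neighbour; the extra 1 is absorbed
      because \<open>r\<close> is at least 128.\<close>
    have "{y \<in> N. \<not> good_pair A r x y} \<subseteq> insert x (bad x)" by (auto simp: N_def bad_def)
    then have "card {y \<in> N. \<not> good_pair A r x y} \<le> card (insert x (bad x))"
      using finbad by (intro card_mono) auto
    also have "\<dots> \<le> Suc (card (bad x))" by (rule card_insert_le_m1) simp_all
    finally have "card {y \<in> N. \<not> good_pair A r x y} \<le> Suc (card (bad x))" .
    moreover have "128 * card (bad x) \<le> r" using x by (auto simp: N_def Hv_def)
    ultimately show ?thesis using cN r by linarith
  qed
  have N8: "8 * h * s \<le> card N" using cN by (simp add: r_def)
  have symgp: "symp (good_pair A r)" by (rule sympI) (rule good_pair_sym)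
  have "\<exists>M. clique_model (good_pair A r) N h M"
    by (rule dense_clique_model[OF finN symgp nb hs(2,3) N8])
  then obtain M where M: "clique_model (good_pair A r) N h M" by blast
  have N_good: "\<exists>j. good_pair A r i j" if i: "i \<in> N" for i
  proof (rule ccontr)
    assume "\<not> ?thesis"
    then have "{y \<in> N. \<not> good_pair A r i y} = N" by auto
    then show False using nb[OF i] cN r by simp
  qed
  have AA: "conn E (A i j) \<and> R (z i) \<subseteq> A i j \<and> A i j \<inter> A j i \<noteq> {}" if "i < r" "j < r" "i \<noteq> j" for i j
  proof (intro conjI)
    show "conn E (A i j)" unfolding A_def using P[OF that(1,2)] V'(1) by (intro conn_Union_regions) auto
    show "R (z i) \<subseteq> A i j" using P(2)[OF that(1,2)] by (auto simp: A_def)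
    have "w i j \<in> V" using zsw(2) that V'(1) by blast
    then obtain y where "y \<in> R (w i j)" using R_ne by blast
    moreover have "w i j \<in> P i j" "w i j \<in> P j i" using P(3) that zsw(2) by metis+
    ultimately show "A i j \<inter> A j i \<noteq> {}" by (auto simp: A_def)
  qed
  have Rz: "conn E (R (z i))" "R (z i) \<noteq> {}" if "i < r" for i
    using zsw(1) V'(1) that conn_R R_ne by blast+
  have r3: "3 \<le> r" using r by simp
  have AX: "A i j \<subseteq> \<Union> (R ` V)" if "i < r" "j < r" for i j
  proof -
    have "P i j \<subseteq> V" using P(1)[OF that] V'(1) by simp
    then show ?thesis unfolding A_def by (rule Union_mono[OF image_mono])
  qed
  have "\<exists>B. minor_model E (\<Union> (R ` V)) (good_pair A r) N B"
    by (rule drawing_model[OF symE r3 Rz AA AX N_good])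
  then obtain B where "minor_model E (\<Union> (R ` V)) (good_pair A r) N B" by blast
  then have "clique_model E (\<Union> (R ` V)) h (\<lambda>a. \<Union>i\<in>M a. B i)"
    by (rule clique_model_compose[OF symE M])
  then show False using no by blast
qed

end

section \<open>Vertex weights with large average distance\<close>

context regions
begin

text \<open>Twice the number of edges plus the number of vertices of the intersection graph on
  \<open>V\<close>.\<close>

definition total_deg :: real where
  "total_deg = (\<Sum>x\<in>V. real (deg x))"

lemma deg_ge_1: "x \<in> V \<Longrightarrow> deg x \<ge> 1"
proof -
  assume x: "x \<in> V"
  have "{x} \<subseteq> {y \<in> V. tch x y}" using x tch_refl by simp
  then have "card {x} \<le> deg x" unfolding deg_def using finV by (intro card_mono) auto
  then show ?thesis by simp
qed

lemma total_deg_ge_1: "V \<noteq> {} \<Longrightarrow> total_deg \<ge> 1"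
proof -
  assume "V \<noteq> {}"
  then obtain x where x: "x \<in> V" by blast
  have "1 \<le> real (deg x)" using deg_ge_1[OF x] by simp
  also have "\<dots> \<le> total_deg" unfolding total_deg_def using x finV by (intro member_le_sum) auto
  finally show ?thesis .
qed

text \<open>The weights are \<open>deg x * p x\<close> for a near-minimiser, scaled and rounded up.
  Optimality bounds the average weight of every selection \<open>j\<close> below by
  \<open>F / 2\<close>, AM-GM bounds the total by \<open>c * F * sqrt total_deg\<close>, and
  \<open>F\<close> cancels in the ratio. The scale \<open>T\<close> may be made as large as later
  integer division requires; this is the purpose of \<open>K\<close>.\<close>

lemma spreading_weights:
  assumes no: "\<And>M. \<not> clique_model E (\<Union> (R ` V)) h M" and hs: "h \<ge> 1" "s \<ge> 1" "2 * h \<le> 2 ^ (s\<^sup>2)"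
    and V': "V' \<subseteq> V" "V' \<noteq> {}" "conn tch V'"
  shows "\<exists>(w :: 'a \<Rightarrow> nat) T. (\<forall>v. w v > 0) \<and> K \<le> T \<and>
    real (sum w V') \<le> 6000 * real h * real s * sqrt total_deg * real T \<and>
    (\<forall>j. (\<forall>u\<in>V'. \<forall>v\<in>V'. j u v \<subseteq> V' \<and> u \<in> j u v \<and> v \<in> j u v \<and> conn tch (j u v)) \<longrightarrow>
       (card V')\<^sup>2 * T \<le> (\<Sum>u\<in>V'. \<Sum>v\<in>V'. sum w (j u v)))"
proof -
  have finV': "finite V'" using V' finV by (meson finite_subset)
  define n where "n = real (card V')"
  have n0: "n > 0" using finV' V'(2) by (simp add: n_def card_gt_0_iff)
  define Adm where "Adm u v = {Q. Q \<subseteq> V' \<and> u \<in> Q \<and> v \<in> Q \<and> conn tch Q}" for u v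
  have finAdm: "finite (Adm u v)" for u v
    by (rule finite_subset[of _ "Pow V'"]) (use finV' in \<open>auto simp: Adm_def\<close>)
  \<comment> \<open>One element of \<open>I\<close> fixes a connected set for every pair of
    vertices. Connected sets stand in for paths and leave only finitely many choices to mix.\<close>
  define I where "I = Pi\<^sub>E (V' \<times> V') (\<lambda>(u, v). Adm u v)"
  have finI: "finite I" unfolding I_def using finV' finAdm by (intro finite_PiE) auto
  have inI: "restrict (\<lambda>(u, v). j u v) (V' \<times> V') \<in> I"
    if "\<forall>u\<in>V'. \<forall>v\<in>V'. j u v \<subseteq> V' \<and> u \<in> j u v \<and> v \<in> j u v \<and> conn tch (j u v)" for j
    using that by (auto simp: I_def Adm_def)
  have neI: "I \<noteq> {}" using inI[of "\<lambda>u v. V'"] V'(3) by auto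
  have selI: "i (u, v) \<subseteq> V' \<and> u \<in> i (u, v) \<and> v \<in> i (u, v) \<and> conn tch (i (u, v))"
    if "i \<in> I" "u \<in> V'" "v \<in> V'" for i u v
  proof -
    have "i (u, v) \<in> Adm u v" using PiE_mem[OF that(1)[unfolded I_def], of "(u, v)"] that by simp
    then show ?thesis by (simp add: Adm_def)
  qed
  define a where "a i x = real (card {(u, v) \<in> V' \<times> V'. x \<in> i (u, v)}) / n\<^sup>2" for i :: "'a \<times> 'a \<Rightarrow> 'a set" and x
  have a01: "0 \<le> a i x \<and> a i x \<le> 1" for i x
  proof -
    have "card {(u, v) \<in> V' \<times> V'. x \<in> i (u, v)} \<le> card (V' \<times> V')"
      using finV' by (intro card_mono) auto
    then have "real (card {(u, v) \<in> V' \<times> V'. x \<in> i (u, v)}) \<le> real (card (V' \<times> V'))" by (rule of_nat_mono)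
    also have "\<dots> = n\<^sup>2" by (simp add: card_cartesian_product n_def power2_eq_square)
    finally show ?thesis using n0 by (simp add: a_def)
  qed
  \<comment> \<open>\<open>23\<^sup>2 = 529\<close> dominates the factor 512 of the congestion
    bound.\<close>
  define c where "c = 23 * (128 * real h * real s)"
  have c0: "c > 0" using hs by (simp add: c_def)
  have low: "1 < c\<^sup>2 * (\<Sum>v\<in>V'. real (deg v) * (\<Sum>i\<in>I. mu i * a i v)\<^sup>2)"
    if mu: "\<And>i. i \<in> I \<Longrightarrow> 0 \<le> mu i" "sum mu I = 1" for mu
  proof -
    let ?F = "\<Sum>v\<in>V'. real (deg v) * (\<Sum>i\<in>I. mu i * a i v)\<^sup>2"
    have "1 < 512 * (128 * real h * real s)\<^sup>2 * ?F"
      unfolding a_def n_def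
      by (rule congestion_lower_bound[OF no hs V'(1,2) finI, where sel = "\<lambda>i u v. i (u, v)"])
         (use mu selI in auto)
    also have "\<dots> \<le> c\<^sup>2 * ?F"
      unfolding c_def power_mult_distrib by (intro mult_right_mono sum_nonneg) auto
    finally show ?thesis .
  qed
  have lower: "1 / c\<^sup>2 \<le> (\<Sum>v\<in>V'. real (deg v) * (\<Sum>i\<in>I. mu i * a i v)\<^sup>2)"
    if mu: "\<And>i. i \<in> I \<Longrightarrow> 0 \<le> mu i" "sum mu I = 1" for mu
    using low[OF mu] c0 by (simp add: field_simps)
  obtain mu where mu: "\<And>i. i \<in> I \<Longrightarrow> 0 \<le> mu i" "sum mu I = (1::real)"
    and opt: "\<And>j. j \<in> I \<Longrightarrow> (\<Sum>v\<in>V'. real (deg v) * (\<Sum>i\<in>I. mu i * a i v)\<^sup>2) / 2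
        \<le> (\<Sum>v\<in>V'. real (deg v) * (\<Sum>i\<in>I. mu i * a i v) * a j v)"
    by (rule approx_minimizer[OF finI neI finV', where a = a and d = "\<lambda>v. real (deg v)" and c = "1 / c\<^sup>2"])
       (use a01 c0 lower in auto)
  define p where "p x = (\<Sum>i\<in>I. mu i * a i x)" for x
  define F where "F = (\<Sum>x\<in>V'. real (deg x) * (p x)\<^sup>2)"
  define f where "f x = real (deg x) * p x" for x
  have p0: "p x \<ge> 0" for x unfolding p_def using mu(1) a01 by (intro sum_nonneg mult_nonneg_nonneg) auto
  then have f0: "f x \<ge> 0" for x by (simp add: f_def)
  have cF: "1 < c\<^sup>2 * F" using low[OF mu] by (simp add: F_def p_def)
  have F0: "F > 0"
  proof (rule ccontr)
    assume "\<not> F > 0"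
    then have "c\<^sup>2 * F \<le> 0" by (intro mult_nonneg_nonpos) auto
    then show False using cF by simp
  qed
  define W where "W = sqrt total_deg"
  have "V \<noteq> {}" using V' by blast
  then have W1: "W \<ge> 1" using total_deg_ge_1 by (simp add: W_def)
  have WW: "W * W = total_deg" using total_deg_ge_1[OF \<open>V \<noteq> {}\<close>] by (simp add: W_def)
  text \<open>AM-GM, with the scale chosen so that both sums contribute equally when \<open>c\<^sup>2 F = 1\<close>.\<close>
  have sumf: "sum f V' \<le> c * F * W"
  proof -
    have "sum f V' \<le> (\<Sum>x\<in>V'. real (deg x) * (p x)\<^sup>2 * (c * W / 2) + real (deg x) * (1 / (2 * c * W)))"
    proof (rule sum_mono)
      fix x
      have cW: "c * W > 0" using c0 W1 by simp
      have "0 \<le> (c * W * p x - 1)\<^sup>2" by simp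
      then have "2 * (c * W * p x) \<le> (c * W * p x)\<^sup>2 + 1" by (simp add: power2_eq_square algebra_simps)
      then have "2 * (c * W * p x) / (2 * (c * W)) \<le> ((c * W * p x)\<^sup>2 + 1) / (2 * (c * W))"
        using cW by (intro divide_right_mono) auto
      moreover have "2 * (c * W * p x) / (2 * (c * W)) = p x" using c0 W1 by simp
      moreover have "((c * W * p x)\<^sup>2 + 1) / (2 * (c * W)) = (p x)\<^sup>2 * (c * W / 2) + 1 / (2 * c * W)"
        using c0 W1 by (simp add: field_simps power2_eq_square)
      ultimately have "p x \<le> (p x)\<^sup>2 * (c * W / 2) + 1 / (2 * c * W)" by simp
      then have "real (deg x) * p x \<le> real (deg x) * ((p x)\<^sup>2 * (c * W / 2) + 1 / (2 * c * W))"
        by (intro mult_left_mono) auto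
      then show "f x \<le> real (deg x) * (p x)\<^sup>2 * (c * W / 2) + real (deg x) * (1 / (2 * c * W))"
        by (simp add: f_def algebra_simps)
    qed
    also have "\<dots> = F * (c * W / 2) + (\<Sum>x\<in>V'. real (deg x)) * (1 / (2 * c * W))"
      unfolding sum.distrib sum_distrib_right[symmetric] F_def ..
    also have "\<dots> \<le> F * (c * W / 2) + W * W * (1 / (2 * c * W))"
    proof -
      have "(\<Sum>x\<in>V'. real (deg x)) \<le> total_deg"
        unfolding total_deg_def using V'(1) finV by (intro sum_mono2) auto
      then show ?thesis unfolding WW using c0 W1 by (intro add_left_mono mult_right_mono) auto
    qed
    also have "W * W * (1 / (2 * c * W)) = W / 2 * (1 / c)" using W1 by simp
    also have "\<dots> \<le> W / 2 * (c * F)"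
    proof (rule mult_left_mono)
      show "1 / c \<le> c * F" using cF c0 by (simp add: field_simps power2_eq_square)
    qed (use W1 in simp)
    also have "F * (c * W / 2) + W / 2 * (c * F) = c * F * W" by simp
    finally show ?thesis by simp
  qed
  \<comment> \<open>As \<open>T\<close> is at least \<open>2 * card V'\<close>, the excess of at
    most 2 per rounded weight costs no more than \<open>T\<close> in total.\<close>
  define T where "T = 2 * (K + card V' + 1)"
  have T0: "real T > 0" by (simp add: T_def)
  define B where "B = 2 * real T / F"
  have B0: "B > 0" using T0 F0 by (simp add: B_def)
  define w where "w x = nat \<lceil>B * f x\<rceil> + 1" for x
  have w_ge: "B * f x \<le> real (w x)" for x unfolding w_def by linarith
  have w_le: "real (w x) \<le> B * f x + 2" for x
  proof -
    have "0 \<le> B * f x" using B0 f0 by simp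
    then show ?thesis unfolding w_def by linarith
  qed
  have sumw: "real (sum w V') \<le> 6000 * real h * real s * sqrt total_deg * real T"
  proof -
    have "real (sum w V') \<le> (\<Sum>x\<in>V'. B * f x + 2)"
      unfolding of_nat_sum by (intro sum_mono w_le)
    also have "\<dots> = B * sum f V' + 2 * n" by (simp add: sum.distrib sum_distrib_left n_def)
    also have "\<dots> \<le> B * (c * F * W) + real T"
      using sumf B0 by (intro add_mono mult_left_mono) (auto simp: T_def n_def)
    also have "B * (c * F * W) = 2 * c * W * real T" using F0 by (simp add: B_def)
    \<comment> \<open>\<open>2 * c\<close> is \<open>5888 * h * s\<close>; the remaining 112 up to
      6000 pays for the rounding.\<close>
    also have "2 * c * W * real T + real T \<le> 2 * c * W * real T + (112 * real h * real s * W) * real T"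
    proof -
      have "1 * 1 \<le> real h * real s" using hs by (intro mult_mono) auto
      then have "1 * 1 \<le> (real h * real s) * W" using W1 by (intro mult_mono) auto
      then have "1 \<le> 112 * real h * real s * W" by simp
      then show ?thesis using T0 by (intro add_left_mono) simp
    qed
    also have "\<dots> = 6000 * real h * real s * W * real T" by (simp add: c_def algebra_simps)
    finally show ?thesis by (simp add: W_def)
  qed
  have spread: "(card V')\<^sup>2 * T \<le> (\<Sum>u\<in>V'. \<Sum>v\<in>V'. sum w (j u v))"
    if j: "\<forall>u\<in>V'. \<forall>v\<in>V'. j u v \<subseteq> V' \<and> u \<in> j u v \<and> v \<in> j u v \<and> conn tch (j u v)" for j
  proof -
    let ?i = "restrict (\<lambda>(u, v). j u v) (V' \<times> V')"
    have ai: "n\<^sup>2 * a ?i x = (\<Sum>u\<in>V'. \<Sum>v\<in>V'. of_bool (x \<in> j u v))" for x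
    proof -
      have "{(u, v) \<in> V' \<times> V'. x \<in> ?i (u, v)} = {e \<in> V' \<times> V'. x \<in> j (fst e) (snd e)}" by auto
      then have "real (card {(u, v) \<in> V' \<times> V'. x \<in> ?i (u, v)}) = (\<Sum>e\<in>V' \<times> V'. of_bool (x \<in> j (fst e) (snd e)))"
        using card_filter_eq_sum[of "V' \<times> V'" "\<lambda>e. x \<in> j (fst e) (snd e)"] finV' by simp
      also have "\<dots> = (\<Sum>u\<in>V'. \<Sum>v\<in>V'. of_bool (x \<in> j u v))"
        unfolding sum.cartesian_product by (simp add: case_prod_beta)
      finally show ?thesis using n0 by (simp add: a_def)
    qed
    have "F / 2 \<le> (\<Sum>x\<in>V'. f x * a ?i x)"
      using opt[OF inI[OF j]] by (simp add: F_def f_def p_def)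
    then have "n\<^sup>2 * (F / 2) \<le> n\<^sup>2 * (\<Sum>x\<in>V'. f x * a ?i x)" by (rule mult_left_mono) simp
    also have "\<dots> = (\<Sum>x\<in>V'. f x * (n\<^sup>2 * a ?i x))" by (simp add: sum_distrib_left mult_ac)
    also have "\<dots> = (\<Sum>x\<in>V'. \<Sum>u\<in>V'. \<Sum>v\<in>V'. f x * of_bool (x \<in> j u v))"
      unfolding ai by (simp add: sum_distrib_left)
    also have "\<dots> = (\<Sum>u\<in>V'. \<Sum>x\<in>V'. \<Sum>v\<in>V'. f x * of_bool (x \<in> j u v))" by (rule sum.swap)
    also have "\<dots> = (\<Sum>u\<in>V'. \<Sum>v\<in>V'. \<Sum>x\<in>V'. f x * of_bool (x \<in> j u v))"
      by (intro sum.cong refl sum.swap)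
    also have "\<dots> = (\<Sum>u\<in>V'. \<Sum>v\<in>V'. sum f (j u v))"
    proof (rule sum.cong[OF refl], rule sum.cong[OF refl])
      fix u v assume "u \<in> V'" "v \<in> V'"
      then have "V' \<inter> j u v = j u v" using j by blast
      then show "(\<Sum>x\<in>V'. f x * of_bool (x \<in> j u v)) = sum f (j u v)"
        using finV' sum.inter_restrict[of V' f "j u v"] by (simp add: of_bool_def if_distrib cong: if_cong)
    qed
    finally have "n\<^sup>2 * (F / 2) \<le> (\<Sum>u\<in>V'. \<Sum>v\<in>V'. sum f (j u v))" .
    then have "B * (n\<^sup>2 * (F / 2)) \<le> B * (\<Sum>u\<in>V'. \<Sum>v\<in>V'. sum f (j u v))"
      using B0 by (intro mult_left_mono) auto
    also have "\<dots> = (\<Sum>u\<in>V'. \<Sum>v\<in>V'. \<Sum>x\<in>j u v. B * f x)" by (simp add: sum_distrib_left)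
    also have "\<dots> \<le> (\<Sum>u\<in>V'. \<Sum>v\<in>V'. \<Sum>x\<in>j u v. real (w x))" by (intro sum_mono w_ge)
    also have "\<dots> = real (\<Sum>u\<in>V'. \<Sum>v\<in>V'. sum w (j u v))" by simp
    finally have "B * (n\<^sup>2 * (F / 2)) \<le> real (\<Sum>u\<in>V'. \<Sum>v\<in>V'. sum w (j u v))" .
    moreover have "B * (n\<^sup>2 * (F / 2)) = real ((card V')\<^sup>2 * T)" using F0 by (simp add: B_def n_def)
    ultimately show ?thesis by (simp only: of_nat_le_iff)
  qed
  have "\<forall>v. w v > 0" by (simp add: w_def)
  moreover have "K \<le> T" by (simp add: T_def)
  ultimately show ?thesis using sumw spread by (intro exI[of _ w] exI[of _ T] conjI allI impI) auto
qed

end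

section \<open>Cheap spheres and large balls\<close>

text \<open>A discrete coarea argument: over all \<open>t\<close> the superlevel sets have total
  size \<open>sum g V\<close>, while \<open>v\<close> lies on the sphere, where
  \<open>g v < t + w v\<close>, for at most \<open>w v\<close> values of \<open>t\<close>. So some
  \<open>t\<close> is no worse than the ratio of the totals.\<close>

lemma threshold_cut:
  fixes g w :: "'a \<Rightarrow> nat"
  assumes V: "finite V" and pos: "sum g V > 0"
  shows "\<exists>t\<ge>1. {v \<in> V. t \<le> g v} \<noteq> {} \<and>
    card {v \<in> V. g v < t + w v \<and> t \<le> g v} * sum g V \<le> sum w V * card {v \<in> V. t \<le> g v}"
proof (rule ccontr)
  assume neg: "\<not> ?thesis"
  define L where "L = Max (g ` V)"
  have ne: "V \<noteq> {}" using pos by auto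
  have gL: "g v \<le> L" if "v \<in> V" for v unfolding L_def using that V by (intro Max_ge) auto
  have "L \<in> g ` V" unfolding L_def using V ne by (intro Max_in) auto
  then obtain v0 where v0: "v0 \<in> V" "g v0 = L" by blast
  have "L > 0"
  proof (rule ccontr)
    assume "\<not> 0 < L"
    then have "sum g V = 0" using gL by (intro sum.neutral) auto
    then show False using pos by simp
  qed
  have lt: "sum w V * card {v \<in> V. t \<le> g v} < card {v \<in> V. g v < t + w v \<and> t \<le> g v} * sum g V"
    if "t \<in> {1..L}" for t
  proof -
    have "v0 \<in> {v \<in> V. t \<le> g v}" using v0 that by simp
    then have "{v \<in> V. t \<le> g v} \<noteq> {}" by blast
    moreover have "t \<ge> 1" using that by simp
    ultimately show ?thesis using neg by (meson not_le)
  qed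
  have "(\<Sum>t\<in>{1..L}. card {v \<in> V. t \<le> g v}) = (\<Sum>v\<in>V. card {t \<in> {1..L}. t \<le> g v})"
    by (simp only: card_filter_eq_sum[OF V] card_filter_eq_sum[OF finite_atLeastAtMost] sum.swap[of _ V])
  also have "\<dots> = sum g V"
  proof (rule sum.cong[OF refl])
    fix v assume "v \<in> V"
    then have "{t \<in> {1..L}. t \<le> g v} = {1..g v}" using gL[of v] by auto
    then show "card {t \<in> {1..L}. t \<le> g v} = g v" by simp
  qed
  finally have s1: "(\<Sum>t\<in>{1..L}. card {v \<in> V. t \<le> g v}) = sum g V" .
  have "(\<Sum>t\<in>{1..L}. card {v \<in> V. g v < t + w v \<and> t \<le> g v}) =
      (\<Sum>v\<in>V. card {t \<in> {1..L}. g v < t + w v \<and> t \<le> g v})"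
    by (simp only: card_filter_eq_sum[OF V] card_filter_eq_sum[OF finite_atLeastAtMost] sum.swap[of _ V])
  also have "\<dots> \<le> sum w V"
  proof (rule sum_mono)
    fix v
    have "{t \<in> {1..L}. g v < t + w v \<and> t \<le> g v} \<subseteq> {g v - w v<..g v}" by auto
    then have "card {t \<in> {1..L}. g v < t + w v \<and> t \<le> g v} \<le> card {g v - w v<..g v}"
      by (intro card_mono) auto
    then show "card {t \<in> {1..L}. g v < t + w v \<and> t \<le> g v} \<le> w v" by simp
  qed
  finally have s2: "(\<Sum>t\<in>{1..L}. card {v \<in> V. g v < t + w v \<and> t \<le> g v}) \<le> sum w V" .
  have "(\<Sum>t\<in>{1..L}. sum w V * card {v \<in> V. t \<le> g v})
      < (\<Sum>t\<in>{1..L}. card {v \<in> V. g v < t + w v \<and> t \<le> g v} * sum g V)"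
    using \<open>L > 0\<close> lt by (intro sum_strict_mono) auto
  then have "sum w V * sum g V < (\<Sum>t\<in>{1..L}. card {v \<in> V. g v < t + w v \<and> t \<le> g v}) * sum g V"
    unfolding sum_distrib_left[symmetric] sum_distrib_right[symmetric] s1 .
  also have "\<dots> \<le> sum w V * sum g V" using s2 by (rule mult_le_mono1)
  finally show False by simp
qed

text \<open>Brings distances back from the host: the regions used by a walk, with the starting
  region \<open>u\<close>, form a connected vertex set, and a repeated region is weighed only
  once.\<close>

lemma (in strings) hop_chain:
  assumes "hop Y x n z" "u \<in> V" "x \<in> R u"
  shows "\<exists>Q\<subseteq>V. finite Q \<and> conn (\<lambda>u v. R u \<inter> R v \<noteq> {}) Q \<and> u \<in> Q \<and> sum w Q \<le> n + w u \<and> (\<exists>q\<in>Q. z \<in> R q)"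
  using assms(1)
proof (induction rule: hop.induct)
  case hop_refl
  then show ?case using assms(2,3) by (intro exI[of _ "{u}"]) auto
next
  case (hop_step n y v z)
  then obtain Q q where Q: "Q \<subseteq> V" "finite Q" "conn (\<lambda>u v. R u \<inter> R v \<noteq> {}) Q" "u \<in> Q"
      "sum w Q \<le> n + w u" "q \<in> Q" "y \<in> R q" by blast
  have sym: "symp (\<lambda>u v. R u \<inter> R v \<noteq> {})" by (rule sympI) auto
  have "R q \<inter> R v \<noteq> {}" using Q(7) hop_step.hyps(3) by blast
  then have "conn (\<lambda>u v. R u \<inter> R v \<noteq> {}) (Q \<union> {v})"
    using conn_Un[OF sym Q(3) conn_singleton Q(6), of v v] by simp
  moreover have "z \<in> R v"
  proof -
    have "y \<in> R v \<inter> Y" using hop_step.hyps hop_in by blast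
    then show ?thesis using reach_in[OF hop_step.hyps(4)] by blast
  qed
  moreover have "sum w (Q \<union> {v}) \<le> sum w Q + sum w {v}" using Q(2) by (simp add: sum.insert_if)
  ultimately show ?case using Q hop_step.hyps(2) by (intro exI[of _ "Q \<union> {v}"]) auto
qed

context regions
begin

lemma tch_eq: "tch = (\<lambda>u v. R u \<inter> R v \<noteq> {})"
  by (intro ext) (simp add: tch_def)

text \<open>Regions cut by the annuli go into \<open>S\<close>. If every ball in \<open>Z\<close>
  held less than a \<open>1 / h\<close> share, a greedy choice would give \<open>h\<close> mutually
  far points in one cluster, hence a clique model.\<close>

lemma chop:
  fixes w :: "'a \<Rightarrow> nat"
  assumes no: "\<And>M. \<not> clique_model E (\<Union> (R ` V)) h M" and h: "h \<ge> 2"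
    and U: "U \<subseteq> V" and w: "\<And>v. v \<in> U \<Longrightarrow> 0 < w v \<and> w v \<le> D" and D: "D > 0"
  shows "\<exists>S\<subseteq>U. card S * D \<le> h * sum w U \<and>
    (\<forall>Z\<subseteq>U - S. Z \<noteq> {} \<longrightarrow> (\<forall>u\<in>Z. \<forall>v\<in>Z. reach tch (U - S) u v) \<longrightarrow>
      (\<exists>x\<in>Z. \<exists>C\<subseteq>Z. card Z \<le> h * card C \<and>
        (\<forall>c\<in>C. \<exists>Q\<subseteq>U. conn tch Q \<and> x \<in> Q \<and> c \<in> Q \<and> sum w Q \<le> 22 * h * D + 2 * D)))"
proof -
  \<comment> \<open>Keeping only host edges inside a region of \<open>U\<close> makes
    \<open>cover\<close> true and creates no new clique model.\<close>
  define E' where "E' y z \<longleftrightarrow> E y z \<and> (\<exists>v\<in>U. y \<in> R v \<and> z \<in> R v)" for y z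
  have finU: "finite U" using U finV by (rule finite_subset)
  interpret fs: finite_strings E' U R w D
  proof unfold_locales
    show "symp E'" using symE by (auto simp: E'_def intro!: sympI dest: sympD)
    show "\<exists>v\<in>U. y \<in> R v \<and> z \<in> R v" if "E' y z" for y z using that by (auto simp: E'_def)
    show "0 < w v" if "v \<in> U" for v using w that by blast
    show "conn E' (R v)" if "v \<in> U" for v
      using conn_R[of v] by (rule conn_rel_mono) (use U that in \<open>auto simp: E'_def\<close>)
  qed (rule finU, rule D)
  let ?X = "\<Union> (R ` U)"
  have no': "\<not> clique_model E' ?X h M" for M
  proof
    assume M: "clique_model E' ?X h M"
    have "clique_model E (\<Union> (R ` V)) h M"
    proof (rule clique_modelI)
      fix i assume i: "i < h"
      have Mi: "M i \<noteq> {}" "M i \<subseteq> ?X" "conn E' (M i)" using M i by (simp_all add: clique_model_def)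
      show "M i \<noteq> {}" by (rule Mi(1))
      show "M i \<subseteq> \<Union> (R ` V)" using Mi(2) U by blast
      show "conn E (M i)" using Mi(3) by (rule conn_rel_mono) (simp add: E'_def)
    next
      fix i j assume ij: "j < i" "i < h"
      then have "M i \<inter> M j = {}" "\<exists>x\<in>M i. \<exists>y\<in>M j. E' x y" using M by (simp_all add: clique_model_def)
      then show "M i \<inter> M j = {}" "\<exists>x\<in>M i. \<exists>y\<in>M j. E x y" unfolding E'_def by blast+
    qed
    then show False using no by blast
  qed
  obtain a where a: "card {v \<in> U. \<not> fs.uncut a h v} * D \<le> h * sum w U" using fs.exists_offsets by blast
  define S where "S = {v \<in> U. \<not> fs.uncut a h v}"
  have "\<exists>x\<in>Z. \<exists>C\<subseteq>Z. card Z \<le> h * card C \<and>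
        (\<forall>c\<in>C. \<exists>Q\<subseteq>U. conn tch Q \<and> x \<in> Q \<and> c \<in> Q \<and> sum w Q \<le> 22 * h * D + 2 * D)"
    if Z: "Z \<subseteq> U - S" "Z \<noteq> {}" "\<forall>u\<in>Z. \<forall>v\<in>Z. reach tch (U - S) u v" for Z
  proof -
    have ZU: "Z \<subseteq> U" using Z(1) by blast
    have finZ: "finite Z" using ZU finU by (rule finite_subset)
    obtain z0 where z0: "z0 \<in> Z" using Z(2) by blast
    then have "R z0 \<noteq> {}" using ZU U R_ne by blast
    then obtain y where y: "y \<in> R z0" by blast
    let ?K = "fs.cluster a h y"
    have unc: "fs.uncut a h v" if "v \<in> U - S" for v using that by (simp add: S_def)
    \<comment> \<open>Consecutive uncut regions on a walk share a point, so all of them lie in the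
      same cluster.\<close>
    have RK: "R v \<subseteq> ?K" if v: "v \<in> Z" for v
    proof -
      have "reach tch (U - S) z0 v" using Z(3) z0 v by blast
      then show ?thesis
      proof (induction rule: reach_induct)
        case base
        show ?case using unc[of z0] z0 Z(1) y unfolding fs.uncut_def by blast
      next
        case (step u v)
        obtain p where p: "p \<in> R u" "p \<in> R v" using step.hyps(2) by (auto simp: tch_def)
        then have "p \<in> ?K" using step.IH by blast
        then have "fs.cluster a h p = ?K" by (rule fs.cluster_eq)
        moreover have "R v \<subseteq> fs.cluster a h p" using unc[OF step.hyps(4)] p(2) unfolding fs.uncut_def by blast
        ultimately show ?case by simp
      qed
    qed
    define rep where "rep v = (SOME p. p \<in> R v)" for v
    have rep: "rep v \<in> R v" if "v \<in> U" for v
    proof -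
      have "\<exists>p. p \<in> R v" using R_ne that U by blast
      then show ?thesis unfolding rep_def by (rule someI_ex)
    qed
    define near where "near x v \<longleftrightarrow> (\<exists>n\<le>22 * h * D. fs.hop ?X (rep x) n (rep v))" for x v
    have near_sym: "near x v \<Longrightarrow> near v x" for x v unfolding near_def using fs.hop_sym by blast
    define ball where "ball x = {v \<in> Z. near x v}" for x
    have "\<exists>x\<in>Z. card Z \<le> h * card (ball x)"
    proof (rule ccontr)
      assume "\<not> ?thesis"
      then have small: "h * card (ball x) \<le> card Z" if "x \<in> Z" for x using that by (simp add: not_le less_imp_le)
      have "\<exists>xs :: nat \<Rightarrow> 'a. (\<forall>b<k. xs b \<in> Z) \<and> (\<forall>b<k. \<forall>c<b. \<not> near (xs c) (xs b))" if "k \<le> h" for k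
        using that
      proof (induction k)
        case (Suc k)
        then obtain xs :: "nat \<Rightarrow> 'a" where xs: "\<forall>b<k. xs b \<in> Z" "\<forall>b<k. \<forall>c<b. \<not> near (xs c) (xs b)"
          by auto
        \<comment> \<open>Fewer than \<open>h\<close> balls, each with at most a
          \<open>1 / h\<close> share, cannot cover \<open>Z\<close>.\<close>
        have "h * card (\<Union>c<k. ball (xs c)) \<le> h * (\<Sum>c<k. card (ball (xs c)))"
          by (intro mult_le_mono2 card_UN_le) simp
        also have "\<dots> = (\<Sum>c<k. h * card (ball (xs c)))" by (rule sum_distrib_left)
        also have "\<dots> \<le> (\<Sum>c<k. card Z)" using xs(1) small by (intro sum_mono) simp
        also have "\<dots> = k * card Z" by simp
        also have "\<dots> < h * card Z" using Suc.prems finZ Z(2) by (simp add: card_gt_0_iff)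
        finally have "card (\<Union>c<k. ball (xs c)) < card Z" by simp
        moreover have "finite (\<Union>c<k. ball (xs c))" using finZ by (simp add: ball_def)
        ultimately have "\<not> Z \<subseteq> (\<Union>c<k. ball (xs c))" by (meson card_mono leD)
        then obtain v where v: "v \<in> Z" "\<And>c. c < k \<Longrightarrow> v \<notin> ball (xs c)" by blast
        define xs' where "xs' = xs(k := v)"
        have "xs' b \<in> Z" if "b < Suc k" for b
          using xs(1) v(1) that by (cases "b = k") (simp_all add: xs'_def)
        moreover have "\<not> near (xs' c) (xs' b)" if "b < Suc k" "c < b" for b c
        proof (cases "b = k")
          case True
          then show ?thesis using v that by (simp add: xs'_def ball_def)
        next
          case False
          then show ?thesis using xs(2) that by (simp add: xs'_def)
        qed
        ultimately show ?case by blast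
      qed simp
      then obtain xs :: "nat \<Rightarrow> 'a" where xs: "\<forall>b<h. xs b \<in> Z" "\<forall>b<h. \<forall>c<b. \<not> near (xs c) (xs b)" by blast
      have far: "\<not> near (xs b) (xs c)" if bc: "b < h" "c < h" "b \<noteq> c" for b c
      proof (cases "b < c")
        case True
        then show ?thesis using xs(2) bc by blast
      next
        case False
        then have "\<not> near (xs c) (xs b)" using xs(2) bc by simp
        then show ?thesis using near_sym by blast
      qed
      have "\<exists>M. clique_model E' ?X h M"
      proof (rule fs.far_points_clique_model[where p = "\<lambda>b. rep (xs b)" and a = a and y = y])
        show "w v \<le> D" if "v \<in> U" for v using w that by blast
        show "2 \<le> h" by (rule h)
        show "rep (xs b) \<in> ?K" if "b < h" for b
        proof -
          have "xs b \<in> Z" using xs(1) that by blast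
          then show ?thesis using RK rep ZU by blast
        qed
        show "22 * h * D < n" if "b < h" "c < h" "b \<noteq> c" "fs.hop ?X (rep (xs b)) n (rep (xs c))" for b c n
          using far[OF that(1-3)] that(4) unfolding near_def by (meson not_le)
        show "y \<in> ?X" using y z0 ZU by blast
      qed
      then show False using no' by blast
    qed
    then obtain x where x: "x \<in> Z" "card Z \<le> h * card (ball x)" by blast
    \<comment> \<open>The walk joins representatives, so the regions of \<open>x\<close> and of
      \<open>c\<close> complete the chain; each weighs at most \<open>D\<close>, hence the term
      \<open>2 * D\<close>.\<close>
    have "\<exists>Q\<subseteq>U. conn tch Q \<and> x \<in> Q \<and> c \<in> Q \<and> sum w Q \<le> 22 * h * D + 2 * D" if c: "c \<in> ball x" for c
    proof -
      have xU: "x \<in> U" and cU: "c \<in> U" using x(1) c ZU by (auto simp: ball_def)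
      obtain n where n: "n \<le> 22 * h * D" "fs.hop ?X (rep x) n (rep c)" using c by (auto simp: ball_def near_def)
      obtain Q q where Q: "Q \<subseteq> U" "finite Q" "conn tch Q" "x \<in> Q" "sum w Q \<le> n + w x" "q \<in> Q" "rep c \<in> R q"
        using fs.hop_chain[OF n(2) xU rep[OF xU]] unfolding tch_eq by blast
      have "tch q c" using Q(7) rep[OF cU] by (auto simp: tch_def)
      then have "conn tch (Q \<union> {c})" using conn_Un[OF symp_tch Q(3) conn_singleton Q(6), of c c] by simp
      moreover have "sum w (Q \<union> {c}) \<le> sum w Q + w c" using Q(2) by (simp add: sum.insert_if)
      then have "sum w (Q \<union> {c}) \<le> 22 * h * D + 2 * D" using Q(5) n(1) w[OF xU] w[OF cU] by simp
      ultimately show ?thesis using Q(1,4) cU by (intro exI[of _ "Q \<union> {c}"]) simp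
    qed
    then show ?thesis using x by (intro bexI[of _ x] exI[of _ "ball x"]) (auto simp: ball_def)
  qed
  moreover have "S \<subseteq> U" by (auto simp: S_def)
  moreover have "card S * D \<le> h * sum w U" using a by (simp add: S_def)
  ultimately show ?thesis by (intro exI[of _ S]) blast
qed

end

context regions
begin

section \<open>Balanced separators\<close>

text \<open>The bound refers to all of \<open>V\<close> even when \<open>U\<close> is a remainder,
  so that separators of remainders can be put together.\<close>

definition balances :: "'a set \<Rightarrow> 'a set \<Rightarrow> bool" where
  "balances S U \<longleftrightarrow> S \<subseteq> U \<and>
     (\<forall>Z\<subseteq>U - S. (\<forall>u\<in>Z. \<forall>v\<in>Z. reach tch (U - S) u v) \<longrightarrow> 3 * card Z \<le> 2 * card V)"

text \<open>
  If no bounded-diameter cluster of the decomposition is large, cutting along the clusters is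
  already balanced. Otherwise some ball \<open>C\<close> holds a \<open>1/h\<close> fraction of a large cluster; since the
  average distance is large, a sphere around \<open>C\<close> is a cut that is cheap compared with the side that
  is thrown away.
\<close>

lemma separation_step:
  assumes no: "\<And>M. \<not> clique_model E (\<Union> (R ` V)) h M" and hs: "h \<ge> 2" "s \<ge> 1" "2 * h \<le> 2 ^ (s\<^sup>2)"
    and V': "V' \<subseteq> V" "conn tch V'" and big: "2 * card V < 3 * card V'"
  shows "(\<exists>S. balances S V' \<and> real (card S) \<le> 2400000 * real h ^ 3 * real s * sqrt total_deg) \<or>
    (\<exists>S P Q. V' = S \<union> P \<union> Q \<and> S \<inter> P = {} \<and> S \<inter> Q = {} \<and> P \<inter> Q = {} \<and>
      (\<forall>u\<in>P. \<forall>v\<in>Q. \<not> tch u v) \<and> 3 * card Q \<le> 2 * card V \<and> S \<union> Q \<noteq> {} \<and>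
      real (card S) * real (card V) \<le> 36000 * (real h)\<^sup>2 * real s * sqrt total_deg * real (card (S \<union> Q)))"
proof -
  have finV': "finite V'" using V' finV by (meson finite_subset)
  have neV': "V' \<noteq> {}" using big by auto
  define n where "n = card V'"
  have n0: "n > 0" using finV' neV' by (simp add: n_def card_gt_0_iff)
  have nV: "n \<le> card V" unfolding n_def using V'(1) finV by (intro card_mono)
  define c where "c = real h * real s * sqrt total_deg"
  have "V \<noteq> {}" using V' neV' by blast
  then have sq1: "sqrt total_deg \<ge> 1" using total_deg_ge_1 by simp
  have c0: "c \<ge> 0" using sq1 by (simp add: c_def)
  have h1: "h \<ge> 1" using hs by simp
  have "\<exists>(w :: 'a \<Rightarrow> nat) T. (\<forall>v. w v > 0) \<and> 200 * h \<le> T \<and>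
    real (sum w V') \<le> 6000 * real h * real s * sqrt total_deg * real T \<and>
    (\<forall>j. (\<forall>u\<in>V'. \<forall>v\<in>V'. j u v \<subseteq> V' \<and> u \<in> j u v \<and> v \<in> j u v \<and> conn tch (j u v)) \<longrightarrow>
       (card V')\<^sup>2 * T \<le> (\<Sum>u\<in>V'. \<Sum>v\<in>V'. sum w (j u v)))"
    by (rule spreading_weights[OF no h1 hs(2,3) V'(1) neV' V'(2)])
  then obtain w :: "'a \<Rightarrow> nat" and T where w0: "\<forall>v. w v > 0" and T: "200 * h \<le> T"
    and sw: "real (sum w V') \<le> 6000 * real h * real s * sqrt total_deg * real T"
    and spread: "\<forall>j. (\<forall>u\<in>V'. \<forall>v\<in>V'. j u v \<subseteq> V' \<and> u \<in> j u v \<and> v \<in> j u v \<and> conn tch (j u v)) \<longrightarrow>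
       (card V')\<^sup>2 * T \<le> (\<Sum>u\<in>V'. \<Sum>v\<in>V'. sum w (j u v))"
    by (elim exE conjE) (rule that)
  have sw': "real (sum w V') \<le> 6000 * c * real T" using sw by (simp add: c_def mult_ac)
  have T0: "T > 0" using T hs by simp
  \<comment> \<open>The factor 100 makes twice the detour cost \<open>50 * h * D\<close> from
    \<open>jsum\<close> at most \<open>T\<close>. The bound \<open>200 * h \<le> T\<close> ensures
    that rounding down loses at most a factor 2.\<close>
  define D where "D = T div (100 * h)"
  have hD: "100 * h * D \<le> T" unfolding D_def by (rule times_div_less_eq_dividend)
  have D1: "D \<ge> 1"
  proof -
    have "1 * (100 * h) \<le> T" using T by simp
    then show ?thesis unfolding D_def using h1 by (subst less_eq_div_iff_mult_less_eq) auto
  qed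
  have TD: "T \<le> 200 * h * D"
  proof -
    have "T = 100 * h * D + T mod (100 * h)" unfolding D_def by simp
    moreover have "T mod (100 * h) < 100 * h" using h1 by simp
    moreover have "100 * h * 1 \<le> 100 * h * D" using D1 by (intro mult_le_mono2)
    moreover have "200 * h * D = 100 * h * D + 100 * h * D" by simp
    ultimately show ?thesis by linarith
  qed
  define U where "U = {v \<in> V'. w v \<le> D}"
  \<comment> \<open>Vertices heavier than \<open>D\<close> are too long for annuli of that width.
    They number at most \<open>sum w V' / D\<close> and go straight into the separator.\<close>
  define H where "H = {v \<in> V'. D < w v}"
  have UV: "U \<subseteq> V" using V'(1) by (auto simp: U_def)
  have "\<exists>S\<subseteq>U. card S * D \<le> h * sum w U \<and>
    (\<forall>Z\<subseteq>U - S. Z \<noteq> {} \<longrightarrow> (\<forall>u\<in>Z. \<forall>v\<in>Z. reach tch (U - S) u v) \<longrightarrow>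
      (\<exists>x\<in>Z. \<exists>C\<subseteq>Z. card Z \<le> h * card C \<and>
        (\<forall>c\<in>C. \<exists>Q\<subseteq>U. conn tch Q \<and> x \<in> Q \<and> c \<in> Q \<and> sum w Q \<le> 22 * h * D + 2 * D)))"
    by (rule chop[OF no hs(1) UV]) (use w0 D1 in \<open>auto simp: U_def\<close>)
  then obtain S1 where S1: "S1 \<subseteq> U" "card S1 * D \<le> h * sum w U"
    and cl: "\<forall>Z\<subseteq>U - S1. Z \<noteq> {} \<longrightarrow> (\<forall>u\<in>Z. \<forall>v\<in>Z. reach tch (U - S1) u v) \<longrightarrow>
      (\<exists>x\<in>Z. \<exists>C\<subseteq>Z. card Z \<le> h * card C \<and>
        (\<forall>c\<in>C. \<exists>Q\<subseteq>U. conn tch Q \<and> x \<in> Q \<and> c \<in> Q \<and> sum w Q \<le> 22 * h * D + 2 * D))"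
    by (elim exE conjE) (rule that)
  define S where "S = H \<union> S1"
  have US: "U - S1 = V' - S" by (auto simp: U_def H_def S_def)
  have SV': "S \<subseteq> V'" using S1(1) by (auto simp: U_def H_def S_def)
  have "card S * D \<le> (h + 1) * sum w V'"
  proof -
    have finH: "finite H" using finV' by (simp add: H_def)
    have "card H * D = (\<Sum>v\<in>H. D)" by simp
    also have "\<dots> \<le> sum w H" by (intro sum_mono) (auto simp: H_def)
    also have "\<dots> \<le> sum w V'" using finV' by (intro sum_mono2) (auto simp: H_def)
    finally have H: "card H * D \<le> sum w V'" .
    have "sum w U \<le> sum w V'" using finV' by (intro sum_mono2) (auto simp: U_def)
    then have "h * sum w U \<le> h * sum w V'" by (rule mult_le_mono2)
    with S1(2) have s1: "card S1 * D \<le> h * sum w V'" by (rule order_trans)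
    have "card S * D \<le> (card H + card S1) * D" unfolding S_def by (intro mult_le_mono1 card_Un_le)
    also have "\<dots> = card H * D + card S1 * D" by (rule add_mult_distrib)
    also have "\<dots> \<le> sum w V' + h * sum w V'" using H s1 by (rule add_mono)
    finally show ?thesis by simp
  qed
  also have "\<dots> \<le> (2 * h) * sum w V'" using h1 by (intro mult_le_mono1) simp
  finally have "real (card S * D) \<le> real ((2 * h) * sum w V')" by (rule of_nat_mono)
  then have "real (card S) * real D \<le> 2 * real h * real (sum w V')" by simp
  also have "\<dots> \<le> 2 * real h * (6000 * c * real T)" using sw' by (intro mult_left_mono) auto
  also have "\<dots> \<le> 2 * real h * (6000 * c * real (200 * h * D))"
    using TD c0 by (intro mult_left_mono of_nat_mono) auto
  \<comment> \<open>\<open>2 * 6000 * 200\<close> gives the constant; the factors \<open>h\<close>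
    come from the rounds of cutting, from \<open>c\<close> and from
    \<open>T \<le> 200 * h * D\<close>.\<close>
  also have "\<dots> = (2400000 * real h ^ 3 * real s * sqrt total_deg) * real D"
    by (simp add: c_def power3_eq_cube)
  finally have cS: "real (card S) \<le> 2400000 * real h ^ 3 * real s * sqrt total_deg"
    using D1 by simp
  show ?thesis
  proof (cases "balances S V'")
    case True
    with cS show ?thesis by blast
  next
    case False
    with SV' obtain Z where Z: "Z \<subseteq> V' - S" "\<forall>u\<in>Z. \<forall>v\<in>Z. reach tch (V' - S) u v" "2 * card V < 3 * card Z"
      unfolding balances_def by (auto simp: not_le)
    then have neZ: "Z \<noteq> {}" by auto
    obtain x C where x: "x \<in> Z" and C: "C \<subseteq> Z" "card Z \<le> h * card C"
      and near: "\<forall>c\<in>C. \<exists>Q\<subseteq>U. conn tch Q \<and> x \<in> Q \<and> c \<in> Q \<and> sum w Q \<le> 22 * h * D + 2 * D"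
      using cl[unfolded US, rule_format, OF Z(1) neZ] Z(2) by blast
    have ZU: "Z \<subseteq> U" using Z(1) US by blast
    then have CV': "C \<subseteq> V'" using C(1) by (auto simp: U_def)
    have "C \<noteq> {}"
    proof
      assume "C = {}"
      then show False using C(2) Z(3) by simp
    qed
    define adm where "adm v Q \<longleftrightarrow> Q \<subseteq> V' \<and> conn tch Q \<and> v \<in> Q \<and> Q \<inter> C \<noteq> {}" for v Q
    define f where "f v = (LEAST k. \<exists>Q. adm v Q \<and> sum w Q = k)" for v
    have f_le: "f v \<le> sum w Q" if "adm v Q" for v Q
      unfolding f_def using that by (intro Least_le) blast
    have "\<exists>Q. adm v Q \<and> sum w Q = f v" if "v \<in> V'" for v
    proof -
      have "adm v V'" using that V'(2) CV' \<open>C \<noteq> {}\<close> by (auto simp: adm_def)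
      then have "\<exists>k. \<exists>Q. adm v Q \<and> sum w Q = k" by blast
      then show ?thesis unfolding f_def by (rule LeastI_ex)
    qed
    then obtain Qf where Qf: "\<And>v. v \<in> V' \<Longrightarrow> adm v (Qf v)" "\<And>v. v \<in> V' \<Longrightarrow> sum w (Qf v) = f v" by metis
    have "\<exists>c. c \<in> Qf v \<and> c \<in> C" if "v \<in> V'" for v using Qf(1)[OF that] by (auto simp: adm_def)
    then obtain ce where ce: "\<And>v. v \<in> V' \<Longrightarrow> ce v \<in> Qf v \<and> ce v \<in> C" by metis
    obtain Qx where Qx: "\<And>c. c \<in> C \<Longrightarrow> Qx c \<subseteq> U \<and> conn tch (Qx c) \<and> x \<in> Qx c \<and> c \<in> Qx c \<and> sum w (Qx c) \<le> 22 * h * D + 2 * D"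
      using near by metis
    \<comment> \<open>Truncated subtraction makes \<open>g\<close> vanish on \<open>C\<close>, where
      \<open>f\<close> is at most \<open>D\<close>; every threshold \<open>t \<ge> 1\<close> then
      leaves \<open>C\<close> on the inner side.\<close>
    define g where "g v = f v - D" for v
    have fC: "f v \<le> D" if "v \<in> C" for v
    proof -
      have "adm v {v}" using that CV' by (auto simp: adm_def)
      then have "f v \<le> w v" using f_le by fastforce
      also have "w v \<le> D" using that C(1) ZU by (auto simp: U_def)
      finally show ?thesis .
    qed
    have lip: "g v \<le> g u + w v" if uv: "u \<in> V'" "v \<in> V'" "tch u v" for u v
    proof -
      have Qu: "Qf u \<subseteq> V'" "conn tch (Qf u)" "u \<in> Qf u" "Qf u \<inter> C \<noteq> {}"
        using Qf(1)[OF uv(1)] by (simp_all add: adm_def)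
      have "conn tch (Qf u \<union> {v})"
        using conn_Un[OF symp_tch Qu(2) conn_singleton Qu(3), of v v] uv(3) by simp
      then have "adm v (Qf u \<union> {v})" using Qu uv(2) unfolding adm_def by blast
      then have "f v \<le> sum w (Qf u \<union> {v})" by (rule f_le)
      also have "\<dots> \<le> f u + w v"
        using Qf(2)[OF uv(1)] finite_subset[OF Qu(1) finV'] by (simp add: sum.insert_if)
      finally show ?thesis unfolding g_def by simp
    qed
    \<comment> \<open>A route from \<open>u\<close> into \<open>C\<close>, to the centre
      \<open>x\<close>, back to \<open>C\<close> and out to \<open>v\<close>. Its weight is
      \<open>g u + g v\<close> up to a detour cost.\<close>
    define j where "j u v = (Qf u \<union> Qx (ce u)) \<union> (Qx (ce v) \<union> Qf v)" for u v
    have jadm: "j u v \<subseteq> V' \<and> u \<in> j u v \<and> v \<in> j u v \<and> conn tch (j u v)" if uv: "u \<in> V'" "v \<in> V'" for u v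
    proof -
      have Q1: "Qf u \<subseteq> V'" "conn tch (Qf u)" "u \<in> Qf u" using Qf(1)[OF uv(1)] by (simp_all add: adm_def)
      have Q2: "Qf v \<subseteq> V'" "conn tch (Qf v)" "v \<in> Qf v" using Qf(1)[OF uv(2)] by (simp_all add: adm_def)
      note X1 = Qx[OF conjunct2[OF ce[OF uv(1)]]] and X2 = Qx[OF conjunct2[OF ce[OF uv(2)]]]
      have "conn tch (Qf u \<union> Qx (ce u))"
        by (rule conn_Un[OF symp_tch Q1(2), of _ "ce u" "ce u"]) (use X1 ce[OF uv(1)] in auto)
      moreover have "conn tch (Qx (ce v) \<union> Qf v)"
        by (rule conn_Un[OF symp_tch _ Q2(2), of _ "ce v" "ce v"]) (use X2 ce[OF uv(2)] in auto)
      ultimately have "conn tch (j u v)" unfolding j_def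
        by (rule conn_Un[OF symp_tch, of _ _ x x]) (use X1 X2 in auto)
      moreover have "j u v \<subseteq> V'" using Q1 Q2 X1 X2 by (auto simp: j_def U_def)
      ultimately show ?thesis using Q1(3) Q2(3) by (simp add: j_def)
    qed
    have jsum: "sum w (j u v) \<le> g u + g v + 50 * h * D" if uv: "u \<in> V'" "v \<in> V'" for u v
    proof -
      have un: "sum w (A \<union> B) \<le> sum w A + sum w B" if "A \<subseteq> V'" "B \<subseteq> V'" for A B
        using sum.union_inter[of A B w] finite_subset[OF that(1) finV'] finite_subset[OF that(2) finV'] by linarith
      have sub: "Qf u \<subseteq> V'" "Qf v \<subseteq> V'" using Qf(1) uv by (simp_all add: adm_def)
      note X1 = Qx[OF conjunct2[OF ce[OF uv(1)]]] and X2 = Qx[OF conjunct2[OF ce[OF uv(2)]]]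
      have sub': "Qx (ce u) \<subseteq> V'" "Qx (ce v) \<subseteq> V'" using X1 X2 by (auto simp: U_def)
      have "sum w (j u v) \<le> sum w (Qf u \<union> Qx (ce u)) + sum w (Qx (ce v) \<union> Qf v)"
        unfolding j_def by (rule un) (use sub sub' in auto)
      also have "\<dots> \<le> (sum w (Qf u) + sum w (Qx (ce u))) + (sum w (Qx (ce v)) + sum w (Qf v))"
        using sub sub' by (intro add_mono un)
      also have "\<dots> \<le> (f u + (22 * h * D + 2 * D)) + ((22 * h * D + 2 * D) + f v)"
        using Qf(2) uv X1 X2 by (intro add_mono) simp_all
      also have "\<dots> \<le> g u + g v + (44 * (h * D) + 6 * D)" unfolding g_def by simp
      also have "\<dots> \<le> g u + g v + 50 * h * D"
      proof -
        have "1 * D \<le> h * D" using h1 by (rule mult_le_mono1)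
        then show ?thesis by simp
      qed
      finally show ?thesis .
    qed
    \<comment> \<open>The detours explain at most half of the spread \<open>n\<^sup>2 * T\<close>,
      so \<open>g\<close> is large on average.\<close>
    have "n\<^sup>2 * T \<le> (\<Sum>u\<in>V'. \<Sum>v\<in>V'. sum w (j u v))"
      using spread jadm unfolding n_def by blast
    also have "\<dots> \<le> (\<Sum>u\<in>V'. \<Sum>v\<in>V'. g u + g v + 50 * h * D)" by (intro sum_mono jsum)
    also have "\<dots> = 2 * (n * sum g V') + n\<^sup>2 * (50 * h * D)"
      by (simp add: sum.distrib n_def power2_eq_square sum_distrib_left algebra_simps)
    finally have "n\<^sup>2 * T \<le> 2 * (n * sum g V') + n\<^sup>2 * (50 * h * D)" .
    moreover have "n\<^sup>2 * (100 * h * D) \<le> n\<^sup>2 * T" using hD by (rule mult_le_mono2)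
    moreover have "n\<^sup>2 * (100 * h * D) = 2 * (n\<^sup>2 * (50 * h * D))" by simp
    ultimately have "n\<^sup>2 * T \<le> 4 * (n * sum g V')" by linarith
    then have "n * (n * T) \<le> n * (4 * sum g V')" by (simp add: power2_eq_square mult_ac)
    then have nT: "n * T \<le> 4 * sum g V'" using n0 by simp
    then have "sum g V' > 0" using n0 T0 by (metis gr0I mult_0_right mult_pos_pos not_le)
    then obtain t where t: "t \<ge> 1" "{v \<in> V'. t \<le> g v} \<noteq> {}"
      "card {v \<in> V'. g v < t + w v \<and> t \<le> g v} * sum g V' \<le> sum w V' * card {v \<in> V'. t \<le> g v}"
      using threshold_cut[OF finV'] by blast
    define St where "St = {v \<in> V'. g v < t + w v \<and> t \<le> g v}"
    define A where "A = {v \<in> V'. g v < t}"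
    define B where "B = {v \<in> V'. t + w v \<le> g v}"
    have StB: "{v \<in> V'. t \<le> g v} = St \<union> B" by (auto simp: St_def B_def)
    have part: "V' = St \<union> A \<union> B" "St \<inter> A = {}" "St \<inter> B = {}" "A \<inter> B = {}"
      by (auto simp: St_def A_def B_def)
    have fin: "finite St" "finite A" "finite B" using finV' by (auto simp: St_def A_def B_def)
    have noAB: "\<not> tch u v" if "u \<in> A" "v \<in> B" for u v
    proof
      assume "tch u v"
      then have "g v \<le> g u + w v" using that by (intro lip) (auto simp: A_def B_def)
      then show False using that by (auto simp: A_def B_def)
    qed
    then have sepAB: "\<forall>u\<in>A. \<forall>v\<in>B. \<not> tch u v" by blast
    have CA: "C \<subseteq> A" using fC CV' t(1) by (force simp: A_def g_def)
    have "card St * (n * T) \<le> card St * (4 * sum g V')" using nT by (rule mult_le_mono2)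
    also have "\<dots> \<le> 4 * (sum w V' * card (St \<union> B))" using t(3) unfolding StB St_def[symmetric] by simp
    finally have "real (card St * (n * T)) \<le> real (4 * (sum w V' * card (St \<union> B)))" by (rule of_nat_mono)
    then have "(real (card St) * real n) * real T \<le> 4 * (real (sum w V') * real (card (St \<union> B)))"
      by (simp add: mult_ac)
    also have "\<dots> \<le> 4 * ((6000 * c * real T) * real (card (St \<union> B)))"
      using sw' by (intro mult_left_mono mult_right_mono) auto
    also have "\<dots> = (24000 * c * real (card (St \<union> B))) * real T" by simp
    finally have St: "real (card St) * real n \<le> 24000 * c * real (card (St \<union> B))" using T0 by simp
    have "card A + card B = card (A \<union> B)" using fin part by (simp add: card_Un_disjoint)
    also have "\<dots> \<le> card V'" using finV' part(1) by (intro card_mono) auto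
    finally have cAB: "card A + card B \<le> card V'" .
    have K2: "36000 * (real h)\<^sup>2 * real s * sqrt total_deg = 36000 * (real h * c)"
      by (simp add: c_def power2_eq_square)
    have hc: "c \<le> real h * c" using c0 h1 mult_right_mono[of 1 "real h" c] by simp
    have bign: "2 * real (card V) \<le> 3 * real n" using big by (simp add: n_def)
    \<comment> \<open>The smaller of the inner side \<open>A\<close> and the outer side
      \<open>B\<close> is removed together with the sphere. If that is \<open>A\<close>, the cut is
      charged to \<open>C\<close>, which holds a \<open>1 / h\<close> share of the large set
      \<open>Z\<close>; hence the second factor \<open>h\<close>.\<close>
    show ?thesis
    proof (cases "card B \<le> card A")
      case True
      from cAB have cB: "3 * card B \<le> 2 * card V" using True nV by (simp add: n_def)
      have "real (card St) * (2 * real (card V)) \<le> real (card St) * (3 * real n)"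
        using bign by (intro mult_left_mono) auto
      also have "\<dots> = 3 * (real (card St) * real n)" by simp
      also have "\<dots> \<le> 3 * (24000 * c * real (card (St \<union> B)))" using St by (rule mult_left_mono) simp
      also have "\<dots> \<le> 3 * (24000 * (real h * c) * real (card (St \<union> B)))"
        using hc by (intro mult_left_mono mult_right_mono) auto
      finally have "real (card St) * real (card V) \<le> 36000 * (real h * c) * real (card (St \<union> B))"
        by (simp add: mult_ac)
      then show ?thesis unfolding K2
        using part sepAB cB t(2)[unfolded StB]
        by (intro disjI2 exI[of _ St] exI[of _ A] exI[of _ B] conjI)
    next
      case False
      from cAB have cA: "3 * card A \<le> 2 * card V" using False nV by (simp add: n_def)
      have "real (card St) * real n \<le> 24000 * c * real n"
      proof -
        have "card (St \<union> B) \<le> n" unfolding n_def using finV' part(1) by (intro card_mono) auto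
        then have "24000 * c * real (card (St \<union> B)) \<le> 24000 * c * real n"
          using c0 by (intro mult_left_mono of_nat_mono) auto
        with St show ?thesis by (rule order_trans)
      qed
      then have St': "real (card St) \<le> 24000 * c" using n0 by simp
      have "card C \<le> card (St \<union> A)" using CA fin by (intro card_mono) auto
      then have "h * card C \<le> h * card (St \<union> A)" by (rule mult_le_mono2)
      then have "2 * card V \<le> 3 * (h * card (St \<union> A))" using C(2) Z(3) by linarith
      then have "real (2 * card V) \<le> real (3 * (h * card (St \<union> A)))" by (rule of_nat_mono)
      then have V2: "2 * real (card V) \<le> 3 * (real h * real (card (St \<union> A)))" by simp
      have "real (card St) * (2 * real (card V)) \<le> (24000 * c) * (3 * (real h * real (card (St \<union> A))))"
        by (rule mult_mono[OF St' V2]) (use c0 in auto)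
      moreover have "(24000 * c) * (3 * (real h * real (card (St \<union> A)))) =
          2 * (36000 * (real h * c) * real (card (St \<union> A)))" by simp
      ultimately have "real (card St) * real (card V) \<le> 36000 * (real h * c) * real (card (St \<union> A))"
        by linarith
      moreover have "V' = St \<union> B \<union> A" "B \<inter> A = {}" using part by auto
      moreover have "St \<union> A \<noteq> {}" using CA \<open>C \<noteq> {}\<close> by blast
      moreover have "\<forall>u\<in>B. \<forall>v\<in>A. \<not> tch u v" using sepAB sympD[OF symp_tch] by blast
      ultimately show ?thesis unfolding K2
        using part(2,3) cA
        by (intro disjI2 exI[of _ St] exI[of _ B] exI[of _ A] conjI)
    qed
  qed
qed

end

section \<open>Amortised iteration of the cuts\<close>

lemma reach_Un_no_edges:
  assumes "reach T (P \<union> Q) u v" "u \<in> P" and "\<And>a b. a \<in> P \<Longrightarrow> b \<in> Q \<Longrightarrow> \<not> T a b"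
  shows "v \<in> P \<and> reach T P u v"
  using assms(1)
proof (induction rule: reach_induct)
  case base
  show ?case using assms(2) by simp
next
  case (step a b)
  then have "b \<in> P" using assms(3) by blast
  then show ?case using step by (blast intro: reach_trans reach_edge)
qed

context regions
begin

text \<open>Each sparse cut is charged to the vertices it removes, so all of them together cost a
  multiple of \<open>card U\<close>, while the cubic term is paid at most once, when the recursion
  ends. Only \<open>P\<close> is treated further, because \<open>Q\<close> is already small.\<close>

lemma separator_exists:
  assumes no: "\<And>M. \<not> clique_model E (\<Union> (R ` V)) h M" and hs: "h \<ge> 2" "s \<ge> 1" "2 * h \<le> 2 ^ (s\<^sup>2)"
    and U: "U \<subseteq> V"
  shows "\<exists>S. balances S U \<and> real (card S) * real (card V) \<le>
      2400000 * real h ^ 3 * real s * sqrt total_deg * real (card V) +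
      36000 * (real h)\<^sup>2 * real s * sqrt total_deg * real (card U)"
  using U
proof (induction "card U" arbitrary: U rule: less_induct)
  case less
  define K1 where "K1 = 2400000 * real h ^ 3 * real s * sqrt total_deg"
  define K2 where "K2 = 36000 * (real h)\<^sup>2 * real s * sqrt total_deg"
  have W0: "total_deg \<ge> 0" unfolding total_deg_def by (rule sum_nonneg) simp
  have K0: "K1 \<ge> 0" "K2 \<ge> 0" using W0 by (simp_all add: K1_def K2_def)
  have finU: "finite U" using less.prems finV by (rule finite_subset)
  have IH: "\<exists>S. balances S P \<and> real (card S) * real (card V) \<le> K1 * real (card V) + K2 * real (card P)"
    if "card P < card U" "P \<subseteq> V" for P
    using less.hyps[OF that] unfolding K1_def K2_def .
  have glue: "\<exists>S. balances S U \<and> real (card S) * real (card V) \<le> K1 * real (card V) + K2 * real (card U)"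
    if part: "U = S \<union> P \<union> Q" "S \<inter> P = {}" "S \<inter> Q = {}" "P \<inter> Q = {}"
      and sep: "\<And>u v. u \<in> P \<Longrightarrow> v \<in> Q \<Longrightarrow> \<not> tch u v" and Q: "3 * card Q \<le> 2 * card V" and ne: "S \<union> Q \<noteq> {}"
      and S: "real (card S) * real (card V) \<le> K2 * real (card (S \<union> Q))" for S P Q
  proof -
    have fin: "finite S" "finite P" "finite Q" using finU part(1) by auto
    have "U = P \<union> (S \<union> Q)" "P \<inter> (S \<union> Q) = {}" using part by auto
    then have cU: "card U = card P + card (S \<union> Q)" using fin by (simp add: card_Un_disjoint)
    moreover have "card (S \<union> Q) > 0" using ne fin by (simp add: card_gt_0_iff)
    ultimately have "card P < card U" by simp
    moreover have PV: "P \<subseteq> V" using part(1) less.prems by blast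
    ultimately obtain S1 where S1: "balances S1 P" "real (card S1) * real (card V) \<le> K1 * real (card V) + K2 * real (card P)"
      using IH by blast
    have S1P: "S1 \<subseteq> P" using S1(1) by (simp add: balances_def)
    have eq: "U - (S \<union> S1) = (P - S1) \<union> Q" using part S1P by auto
    have sep': "\<not> tch a b" if "a \<in> Q" "b \<in> P - S1" for a b
      using sep[of b a] that symp_tch by (auto dest: sympD)
    have "3 * card Z \<le> 2 * card V"
      if Z: "Z \<subseteq> U - (S \<union> S1)" "\<forall>u\<in>Z. \<forall>v\<in>Z. reach tch (U - (S \<union> S1)) u v" for Z
    proof (cases "Z \<subseteq> Q")
      case True
      then have "card Z \<le> card Q" using fin by (intro card_mono)
      then show ?thesis using Q by simp
    next
      case False
      then obtain u where u: "u \<in> Z" "u \<in> P - S1" using Z(1) eq by blast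
      have ZP: "v \<in> P - S1" if "v \<in> Z" for v
      proof -
        have "reach tch ((P - S1) \<union> Q) u v" using Z(2) u(1) that unfolding eq by blast
        then show ?thesis using reach_Un_no_edges[OF _ u(2)] sep by blast
      qed
      have "reach tch (P - S1) a b" if "a \<in> Z" "b \<in> Z" for a b
      proof -
        have "reach tch ((P - S1) \<union> Q) a b" using Z(2) that unfolding eq by blast
        then show ?thesis using reach_Un_no_edges[OF _ ZP[OF that(1)]] sep by blast
      qed
      moreover have "Z \<subseteq> P - S1" using ZP by blast
      ultimately show ?thesis using S1(1) unfolding balances_def by blast
    qed
    moreover have "S \<union> S1 \<subseteq> U" using part(1) S1P by blast
    ultimately have "balances (S \<union> S1) U" unfolding balances_def by blast
    moreover have "real (card (S \<union> S1)) * real (card V) \<le> K1 * real (card V) + K2 * real (card U)"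
    proof -
      have "real (card (S \<union> S1)) \<le> real (card S) + real (card S1)"
        using card_Un_le[of S S1] by linarith
      then have "real (card (S \<union> S1)) * real (card V) \<le> (real (card S) + real (card S1)) * real (card V)"
        by (intro mult_right_mono) auto
      also have "\<dots> = real (card S) * real (card V) + real (card S1) * real (card V)" by (simp add: algebra_simps)
      also have "\<dots> \<le> K2 * real (card (S \<union> Q)) + (K1 * real (card V) + K2 * real (card P))"
        using S S1(2) by (rule add_mono)
      also have "\<dots> = K1 * real (card V) + K2 * real (card U)" by (simp add: cU algebra_simps)
      finally show ?thesis .
    qed
    ultimately show ?thesis by blast
  qed
  have "\<exists>S. balances S U \<and> real (card S) * real (card V) \<le> K1 * real (card V) + K2 * real (card U)"
  proof (cases "balances {} U")
    case True
    then show ?thesis using K0 by (intro exI[of _ "{}"]) simp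
  next
    case False
    then obtain Z where Z: "Z \<subseteq> U" "\<forall>u\<in>Z. \<forall>v\<in>Z. reach tch U u v" "2 * card V < 3 * card Z"
      unfolding balances_def by (auto simp: not_le)
    have "Z \<noteq> {}" using Z(3) by auto
    then obtain z where z: "z \<in> Z" by blast
    define P where "P = comp tch U z"
    have PU: "P \<subseteq> U" unfolding P_def using z Z(1) by (intro comp_subset) blast
    have ZP: "Z \<subseteq> P" using Z(2) z by (auto simp: P_def comp_def)
    have bigP: "2 * card V < 3 * card P"
    proof -
      have "card Z \<le> card P" using ZP finite_subset[OF PU finU] by (intro card_mono)
      then show ?thesis using Z(3) by simp
    qed
    show ?thesis
    proof (cases "P = U")
      case False
      have "card U \<le> card V" using less.prems finV by (intro card_mono)
      moreover have "card (U - P) = card U - card P" using PU finU by (meson card_Diff_subset finite_subset)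
      ultimately have small: "3 * card (U - P) \<le> 2 * card V" using bigP by simp
      show ?thesis
      \<comment> \<open>In a disconnected remainder everything outside the large component is split
        off by an empty cut.\<close>
      proof (rule glue[of "{}" P "U - P"])
        show "\<not> tch u v" if "u \<in> P" "v \<in> U - P" for u v
        proof
          assume "tch u v"
          then have "reach tch U u v" using that PU by (intro reach_edge) auto
          then have "v \<in> P" using that(1) by (auto simp: P_def comp_def intro: reach_trans)
          then show False using that by blast
        qed
      qed (use PU False small K0 in auto)
    next
      case True
      then have "conn tch U" using conn_comp[OF symp_tch, of U z] by (simp add: P_def)
      moreover have "2 * card V < 3 * card U" using bigP True by simp
      ultimately consider (a) "\<exists>S. balances S U \<and> real (card S) \<le> K1"
        | (b) "\<exists>S P Q. U = S \<union> P \<union> Q \<and> S \<inter> P = {} \<and> S \<inter> Q = {} \<and> P \<inter> Q = {} \<and>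
          (\<forall>u\<in>P. \<forall>v\<in>Q. \<not> tch u v) \<and> 3 * card Q \<le> 2 * card V \<and> S \<union> Q \<noteq> {} \<and>
          real (card S) * real (card V) \<le> K2 * real (card (S \<union> Q))"
        using separation_step[OF no hs less.prems] unfolding K1_def K2_def by blast
      then show ?thesis
      proof cases
        case a
        then obtain S where S: "balances S U" "real (card S) \<le> K1" by blast
        have "real (card S) * real (card V) \<le> K1 * real (card V)" using S(2) by (intro mult_right_mono) auto
        also have "\<dots> \<le> K1 * real (card V) + K2 * real (card U)" using K0 by simp
        finally show ?thesis using S(1) by blast
      next
        case b
        then obtain S P Q where "U = S \<union> P \<union> Q" "S \<inter> P = {}" "S \<inter> Q = {}" "P \<inter> Q = {}"
          "\<forall>u\<in>P. \<forall>v\<in>Q. \<not> tch u v" "3 * card Q \<le> 2 * card V" "S \<union> Q \<noteq> {}"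
          "real (card S) * real (card V) \<le> K2 * real (card (S \<union> Q))"
          by (elim exE conjE) (rule that)
        then show ?thesis by (intro glue[of S P Q]) simp_all
      qed
    qed
  qed
  then show ?case unfolding K1_def K2_def .
qed

end

section \<open>Transfer to library digraphs and counting of edges\<close>

lemma reachable_imp_reach:
  assumes "u \<rightarrow>\<^sup>*\<^bsub>with_proj H\<^esub> v"
  shows "reach (arc_rel H) (pverts H) u v \<and> u \<in> pverts H \<and> v \<in> pverts H"
proof -
  have "(u, v) \<in> rtrancl_on (pverts H) (parcs H)" using assms by (simp add: reachable_def)
  then show ?thesis
  proof (induction rule: rtrancl_on.induct)
    case (rtrancl_on_refl a)
    then show ?case by simp
  next
    case (rtrancl_on_into_rtrancl_on a b c)
    then have "reach (arc_rel H) (pverts H) b c" by (intro reach_edge) auto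
    with rtrancl_on_into_rtrancl_on show ?case by (auto intro: reach_trans)
  qed
qed

text \<open>The library's \<open>connected\<close> refers to the symmetric closure, which adds no
  arcs outside \<open>G\<close> because the arcs of a \<open>pair_graph\<close> are
  symmetric.\<close>

lemma connected_induce_imp_conn:
  assumes G: "pair_graph G" and conn: "Digraph_Component.connected (with_proj G \<restriction> A)"
  shows "A \<noteq> {} \<and> conn (arc_rel G) A"
proof -
  let ?H = "mk_symmetric (with_proj G \<restriction> A)"
  interpret pair_graph G by fact
  have V: "pverts ?H = A" by (simp add: mk_symmetric_def)
  have E: "(x, y) \<in> parcs G" if "(x, y) \<in> parcs ?H" for x y
  proof -
    have "(x, y) \<in> parcs G \<or> (y, x) \<in> parcs G"
      using that by (auto simp: mk_symmetric_def induce_subgraph_def)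
    then show ?thesis using pair_sym_arcs by (auto simp: symmetric_def dest: symD)
  qed
  have "A \<noteq> {}" "\<forall>u\<in>A. \<forall>v\<in>A. u \<rightarrow>\<^sup>*\<^bsub>with_proj ?H\<^esub> v"
    using conn V by (simp_all add: connected_def strongly_connected_def)
  moreover have "reach (arc_rel G) A u v" if "u \<rightarrow>\<^sup>*\<^bsub>with_proj ?H\<^esub> v" for u v
  proof -
    have "reach (arc_rel ?H) A u v" using reachable_imp_reach[OF that] V by simp
    then show ?thesis by (rule reach_rel_mono) (rule E)
  qed
  ultimately show ?thesis by (auto simp: conn_def)
qed

lemma sccs_verts_induce_reach:
  assumes "C \<in> pre_digraph.sccs_verts (with_proj G \<restriction> A)"
  shows "C \<subseteq> A \<and> (\<forall>u\<in>C. \<forall>v\<in>C. reach (arc_rel G) A u v)"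
proof -
  let ?H = "\<lparr>pverts = A, parcs = {(x, y) \<in> parcs G. x \<in> A \<and> y \<in> A}\<rparr>"
  have "with_proj G \<restriction> A = with_proj ?H"
    by (auto simp: induce_subgraph_def with_proj_def)
  then have "\<forall>u\<in>C. \<forall>v\<in>C. u \<rightarrow>\<^sup>*\<^bsub>with_proj ?H\<^esub> v"
    using assms by (simp add: pre_digraph.sccs_verts_def)
  then have r: "reach (arc_rel ?H) A u v \<and> u \<in> A" if "u \<in> C" "v \<in> C" for u v
    using reachable_imp_reach[where u = u and v = v and H = "?H"] that by simp
  moreover have "reach (arc_rel G) A u v" if "reach (arc_rel ?H) A u v" for u v
    using that by (rule reach_rel_mono) simp
  ultimately show ?thesis by blast
qed

lemma card_parcs_le_edges:
  assumes "finite (parcs G)"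
  shows "card (parcs G) \<le> 2 * card (edges G)"
proof -
  have fin: "finite (edges G)" using assms by (simp add: edges_def)
  have "parcs G = (\<Union>e\<in>edges G. {a \<in> parcs G. {fst a, snd a} = e})"
    by (force simp: edges_def)
  then have "card (parcs G) = card (\<Union>e\<in>edges G. {a \<in> parcs G. {fst a, snd a} = e})" by simp
  also have "\<dots> \<le> (\<Sum>e\<in>edges G. card {a \<in> parcs G. {fst a, snd a} = e})"
    using fin by (rule card_UN_le)
  also have "\<dots> \<le> (\<Sum>e\<in>edges G. 2)"
  proof (rule sum_mono)
    fix e assume "e \<in> edges G"
    then obtain u v where e: "e = {u, v}" by (auto simp: edges_def)
    have sub: "{a \<in> parcs G. {fst a, snd a} = e} \<subseteq> {(u, v), (v, u)}"
      unfolding e by (auto simp: doubleton_eq_iff)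
    have "card {a \<in> parcs G. {fst a, snd a} = e} \<le> card {(u, v), (v, u)}"
      by (rule card_mono[OF _ sub]) simp
    also have "\<dots> \<le> 2" by (rule card_insert_le_m1) simp_all
    finally show "card {a \<in> parcs G. {fst a, snd a} = e} \<le> 2" .
  qed
  finally show ?thesis by simp
qed

text \<open>\<open>total_deg\<close> counts vertices too, whereas the bound is in edges. Unless the
  empty set separates, more than two thirds of the vertices form a mutually reachable set
  \<open>Z\<close> of size at least 2. Each of them has a neighbour, so the number of vertices is at
  most of the order of the number of edges.\<close>

lemma rig_separator:
  fixes G0 :: "nat pair_pre_digraph" and G :: "'a pair_pre_digraph"
  assumes h: "h \<ge> 1" and s: "s \<ge> 1" "2 * h \<le> 2 ^ (s\<^sup>2)"
    and G0: "pair_graph G0" "excludes_complete_minor h G0" and G: "G \<in> rig G0" and ne1: "card (pverts G) \<noteq> 1"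
  shows "\<exists>S. balanced_separator G S \<and>
    real (card S) \<le> 10000000 * real h ^ 3 * real s * sqrt (real (card (edges G)))"
proof -
  define V where "V = pverts G"
  let ?E = "arc_rel G0"
  obtain R where pG: "pair_graph G"
    and R: "\<forall>u\<in>V. R u \<subseteq> pverts G0 \<and> Digraph_Component.connected (with_proj G0 \<restriction> R u)"
    and adj: "\<forall>u\<in>V. \<forall>v\<in>V. u \<noteq> v \<longrightarrow> ((u, v) \<in> parcs G \<longleftrightarrow> R u \<inter> R v \<noteq> {})"
    using G unfolding rig_def V_def by blast
  interpret G: pair_graph G by fact
  interpret G0: pair_graph G0 by fact
  interpret regions ?E V R
  proof unfold_locales
    show "symp ?E" using G0.pair_sym_arcs by (auto simp: symmetric_def intro!: sympI dest: symD)
    show "finite V" unfolding V_def by (rule G.pair_finite_verts)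
    show "conn ?E (R v)" "R v \<noteq> {}" if "v \<in> V" for v
      using connected_induce_imp_conn[OF G0(1)] R that by blast+
  qed
  have RG0: "\<Union> (R ` V) \<subseteq> pverts G0" using R by blast
  have no: "\<not> clique_model ?E (\<Union> (R ` V)) h M" for M
  proof
    assume "clique_model ?E (\<Union> (R ` V)) h M"
    then have "clique_model ?E (pverts G0) h M" using RG0 unfolding clique_model_def by (meson order_trans)
    then show False using excludes_complete_minor_no_model[OF G0] by blast
  qed
  have arc_tch: "tch u v" if "(u, v) \<in> parcs G" for u v
  proof -
    have "u \<in> V" "v \<in> V" "u \<noteq> v"
      using that G.in_arcsD1 G.in_arcsD2 G.pair_no_loops[OF that] by (auto simp: V_def)
    then show ?thesis using adj that by (simp add: tch_def)
  qed
  have scc: "Z \<subseteq> V - S \<and> (\<forall>u\<in>Z. \<forall>v\<in>Z. reach tch (V - S) u v)"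
    if "Z \<in> pre_digraph.sccs_verts (with_proj G \<restriction> (pverts G - S))" for Z S
    using sccs_verts_induce_reach[OF that] arc_tch unfolding V_def[symmetric]
    by (blast intro: reach_rel_mono)
  have sepI: "balanced_separator G S"
    if S: "balances S V" for S
    unfolding balanced_separator_def
  proof (intro conjI ballI)
    have "S \<subseteq> V" using S unfolding balances_def by blast
    then show "S \<subseteq> pverts G" by (simp add: V_def)
    fix Z assume "Z \<in> pre_digraph.sccs_verts (with_proj G \<restriction> (pverts G - S))"
    from scc[OF this] have "3 * card Z \<le> 2 * card V"
      using S[unfolded balances_def, THEN conjunct2, THEN spec, THEN mp, THEN mp, of Z] by simp
    then have "real (3 * card Z) \<le> real (2 * card V)" by (rule of_nat_mono)
    then show "real (card Z) \<le> 2 / 3 * real (card (pverts G))" by (simp add: V_def)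
  qed
  show ?thesis
  proof (cases "balances {} V")
    case True
    then have "balanced_separator G {}" by (rule sepI)
    then show ?thesis by (intro exI[of _ "{}"]) simp
  next
    case False
    then obtain Z where Z: "Z \<subseteq> V" "\<forall>u\<in>Z. \<forall>v\<in>Z. reach tch V u v" "2 * card V < 3 * card Z"
      unfolding balances_def by (auto simp: not_le)
    have finZ: "finite Z" using Z(1) finV by (rule finite_subset)
    have "card Z \<le> card V" using Z(1) finV by (intro card_mono)
    then have V2: "card V \<ge> 2" using Z(3) ne1 unfolding V_def by linarith
    then have cZ: "card Z \<ge> 2" using Z(3) by linarith
    \<comment> \<open>For \<open>h = 1\<close> any single point of a region is a clique
      model.\<close>
    have h2: "h \<ge> 2"
    proof (rule ccontr)
      assume "\<not> h \<ge> 2"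
      then have h1: "h = 1" using h by simp
      have "V \<noteq> {}" using V2 by auto
      then obtain x where "x \<in> \<Union> (R ` V)" using R_ne by blast
      then have "clique_model ?E (\<Union> (R ` V)) h (\<lambda>_. {x})" by (simp add: clique_model_def h1)
      then show False using no by blast
    qed
    have nbr: "\<exists>y. (x, y) \<in> parcs G" if x: "x \<in> Z" for x
    proof -
      have "Z \<noteq> {x}" using cZ by auto
      then obtain z where z: "z \<in> Z" "z \<noteq> x" using x by blast
      have "reach tch V x z" using Z(2) x z(1) by blast
      moreover have "x \<in> V" using x Z(1) by blast
      ultimately obtain u v where uv: "u \<in> V \<inter> {x}" "v \<in> V - {x}" "tch u v"
        by (rule reach_first_exit[where T = "{x}"]) (use z in auto)
      then have "(x, v) \<in> parcs G" using adj by (auto simp: tch_def)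
      then show ?thesis by blast
    qed
    have finA: "finite (parcs G)" by (rule G.pair_finite_arcs)
    have "Z \<subseteq> fst ` parcs G" using nbr by force
    then have "card Z \<le> card (fst ` parcs G)" using finA by (intro card_mono) auto
    also have "\<dots> \<le> card (parcs G)" using finA by (rule card_image_le)
    finally have ZA: "card Z \<le> card (parcs G)" .
    have "sum deg V \<le> (\<Sum>x\<in>V. Suc (card {y. (x, y) \<in> parcs G}))"
    proof (rule sum_mono)
      fix x assume x: "x \<in> V"
      have "{y. (x, y) \<in> parcs G} \<subseteq> V" using G.in_arcsD2 by (auto simp: V_def)
      then have fin: "finite {y. (x, y) \<in> parcs G}" using finV by (rule finite_subset)
      have "{y \<in> V. tch x y} \<subseteq> insert x {y. (x, y) \<in> parcs G}" using adj x by (auto simp: tch_def)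
      then have "deg x \<le> card (insert x {y. (x, y) \<in> parcs G})"
        unfolding deg_def using fin by (intro card_mono) auto
      also have "\<dots> \<le> Suc (card {y. (x, y) \<in> parcs G})" by (rule card_insert_le_m1) simp_all
      finally show "deg x \<le> Suc (card {y. (x, y) \<in> parcs G})" .
    qed
    also have "\<dots> = card (SIGMA x:V. {y. (x, y) \<in> parcs G}) + card V"
    proof -
      have "finite {y. (x, y) \<in> parcs G}" for x
        by (rule finite_subset[of _ "snd ` parcs G"]) (use finA in force)+
      then show ?thesis using finV by (simp add: sum_Suc)
    qed
    also have "(SIGMA x:V. {y. (x, y) \<in> parcs G}) = parcs G"
      using G.in_arcsD1 by (auto simp: V_def)
    finally have "sum deg V \<le> card (parcs G) + card V" .
    moreover have "card (parcs G) \<le> 2 * card (edges G)" using finA by (rule card_parcs_le_edges)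
    \<comment> \<open>With \<open>e\<close> edges there are at most \<open>2 * e\<close> arcs and
      fewer than \<open>3 * e\<close> vertices; 9 is a convenient square above 5.\<close>
    ultimately have "sum deg V \<le> 9 * card (edges G)" using ZA Z(3) by linarith
    then have "real (sum deg V) \<le> real (9 * card (edges G))" by (rule of_nat_mono)
    then have "total_deg \<le> 9 * real (card (edges G))" by (simp add: total_deg_def)
    then have "sqrt total_deg \<le> sqrt (9 * real (card (edges G)))" by (rule real_sqrt_le_mono)
    also have "\<dots> = 3 * sqrt (real (card (edges G)))" by (simp add: real_sqrt_mult)
    finally have W: "sqrt total_deg \<le> 3 * sqrt (real (card (edges G)))" .
    obtain S where S: "balances S V" "real (card S) * real (card V) \<le>
      2400000 * real h ^ 3 * real s * sqrt total_deg * real (card V) +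
      36000 * (real h)\<^sup>2 * real s * sqrt total_deg * real (card V)"
      using separator_exists[OF no h2 s order_refl] by (elim exE conjE) (rule that)
    have "real (card S) * real (card V) \<le> ((2400000 * real h ^ 3 + 36000 * (real h)\<^sup>2) * (real s * sqrt total_deg)) * real (card V)"
      using S(2) by (simp add: algebra_simps)
    then have "real (card S) \<le> (2400000 * real h ^ 3 + 36000 * (real h)\<^sup>2) * (real s * sqrt total_deg)"
      by (rule mult_right_le_imp_le) (use V2 in simp)
    also have "\<dots> \<le> (2500000 * real h ^ 3) * (real s * (3 * sqrt (real (card (edges G)))))"
    proof (rule mult_mono)
      have "(real h)\<^sup>2 * 1 \<le> (real h)\<^sup>2 * real h" using h by (intro mult_left_mono) auto
      then have "(real h)\<^sup>2 \<le> real h ^ 3" by (simp add: power2_eq_square power3_eq_cube)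
      moreover have "0 \<le> real h ^ 3" by simp
      ultimately show "2400000 * real h ^ 3 + 36000 * (real h)\<^sup>2 \<le> 2500000 * real h ^ 3" by linarith
      show "real s * sqrt total_deg \<le> real s * (3 * sqrt (real (card (edges G))))"
        using W by (intro mult_left_mono) auto
      have "total_deg \<ge> 0" unfolding total_deg_def by (rule sum_nonneg) simp
      then show "0 \<le> real s * sqrt total_deg" by simp
    qed simp
    also have "\<dots> = 7500000 * (real h ^ 3 * real s * sqrt (real (card (edges G))))" by simp
    also have "\<dots> \<le> 10000000 * (real h ^ 3 * real s * sqrt (real (card (edges G))))"
      by (intro mult_right_mono mult_nonneg_nonneg) auto
    finally have "real (card S) \<le> 10000000 * real h ^ 3 * real s * sqrt (real (card (edges G)))"
      by (simp add: mult_ac)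
    then show ?thesis using sepI[OF S(1)] by blast
  qed
qed

theorem theorem1p1:
  shows "\<exists>c :: nat \<Rightarrow> real.
    c \<in> O(\<lambda>h. real h ^ 3 * sqrt (ln (real h))) \<and>
    (\<forall>h \<ge> 1. \<forall>(G0 :: nat pair_pre_digraph) (G :: nat pair_pre_digraph).
       pair_graph G0 \<longrightarrow> excludes_complete_minor h G0 \<longrightarrow> G \<in> rig G0 \<longrightarrow>
       card (pverts G) \<noteq> 1 \<longrightarrow>
       (\<exists>S. balanced_separator G S \<and>
            real (card S) \<le> c h * sqrt (real (card (edges G)))))"
proof -
  \<comment> \<open>The least integer whose square reaches \<open>log 2 (2 * h)\<close> when
    \<open>h \<ge> 1\<close>, as the dense-graph argument requires; the root of \<open>log h\<close>
    in the estimate comes from here.\<close>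
  define s where "s h = nat \<lceil>sqrt (log 2 (2 * real h))\<rceil>" for h :: nat
  have log1: "log 2 (2 * real h) \<ge> 1" if "h \<ge> 1" for h
    using that by (simp add: le_log_iff)
  have s1: "s h \<ge> 1" if "h \<ge> 1" for h
  proof -
    have "0 < sqrt (log 2 (2 * real h))" using log1[OF that] by simp
    then show ?thesis unfolding s_def by linarith
  qed
  have s_ge: "sqrt (log 2 (2 * real h)) \<le> real (s h)" for h unfolding s_def by linarith
  have s2: "2 * h \<le> 2 ^ ((s h)\<^sup>2)" if h: "h \<ge> 1" for h
  proof -
    have "log 2 (2 * real h) = (sqrt (log 2 (2 * real h)))\<^sup>2" using log1[OF h] by simp
    also have "\<dots> \<le> (real (s h))\<^sup>2" using s_ge log1[OF h] by (intro power_mono) auto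
    finally have "log 2 (2 * real h) \<le> real ((s h)\<^sup>2)" by simp
    then have "2 * real h \<le> 2 powr real ((s h)\<^sup>2)" using h by (simp add: log_le_iff)
    also have "\<dots> = 2 ^ ((s h)\<^sup>2)" by (rule powr_realpow) simp
    finally have "real (2 * h) \<le> real (2 ^ ((s h)\<^sup>2))" by simp
    then show ?thesis by (simp only: of_nat_le_iff)
  qed
  define c where "c h = 10000000 * real h ^ 3 * real (s h)" for h
  have "c \<in> O(\<lambda>h. real h ^ 3 * (sqrt (log 2 (2 * real h)) + 1))"
  proof (rule bigoI[where c = 10000000], rule eventuallyI)
    fix h
    have "real h ^ 3 * real (s h) \<le> real h ^ 3 * (sqrt (log 2 (2 * real h)) + 1)"
    proof (cases "h \<ge> 1")
      case True
      then have "0 \<le> sqrt (log 2 (2 * real h))" using log1[OF True] by simp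
      then have "real (s h) \<le> sqrt (log 2 (2 * real h)) + 1" unfolding s_def by linarith
      then show ?thesis by (intro mult_left_mono) auto
    next
      case False
      then have "h = 0" by simp
      then show ?thesis by simp
    qed
    moreover have "0 \<le> real h ^ 3 * real (s h)" by simp
    ultimately show "norm (c h) \<le> 10000000 * norm (real h ^ 3 * (sqrt (log 2 (2 * real h)) + 1))"
      by (simp add: c_def)
  qed
  \<comment> \<open>An asymptotic comparison only: at \<open>h = 1\<close> the right-hand side is
    0.\<close>
  also have "(\<lambda>h. real h ^ 3 * (sqrt (log 2 (2 * real h)) + 1)) \<in> O(\<lambda>h. real h ^ 3 * sqrt (ln (real h)))"
    by real_asymp
  finally have "c \<in> O(\<lambda>h. real h ^ 3 * sqrt (ln (real h)))" .
  moreover have "\<exists>S. balanced_separator G S \<and> real (card S) \<le> c h * sqrt (real (card (edges G)))"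
    if "h \<ge> 1" "pair_graph G0" "excludes_complete_minor h G0" "G \<in> rig G0" "card (pverts G) \<noteq> 1"
    for h and G0 G :: "nat pair_pre_digraph"
    using rig_separator[OF that(1) s1[OF that(1)] s2[OF that(1)] that(2-5)] by (simp add: c_def)
  ultimately show ?thesis by blast
qed

end
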